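(* Let $n\ge2$ and $p\in\mathbb{N}$. For any $K\in\mathcal{K}(\mathbb{R}^n)$ and $t\in[0,1]$, one has $$\sum_{j=0}^n t^j(1-t)^{n-j}\,V\big(-\Delta_pK[j],K^p[np-j]\big)\leq|K|^p.$$ If $\dim(K)=n$ and equality holds for some $t\in(0,1)$, then $K$ is a simplex.
   Context: $\mathcal{K}(\mathbb{R}^n)$ denotes the set of convex bodies, i.e. nonempty compact convex subsets of $\mathbb{R}^n$; $|\cdot|$ is Lebesgue measure (in the dimension of the ambient space); $\dim K$ is the dimension of the affine span of $K$; a simplex is the convex hull of affinely independent points. The mixed volume of $K_1,\dots,K_N\in\mathcal{K}(\mathbb{R}^N)$ is $V(K_1,\dots,K_N)=\frac1{N!}\frac{\partial^N}{\partial t_1\cdots\partial t_N}\big|_{t_1=\dots=t_N=0}|t_1K_1+\dots+t_NK_N|$ (Minkowski sums; the volume is a homogeneous polynomial of degree $N$ in $t_1,\dots,t_N\ge0$). $L[k]$ means that $L$ is repeated $k$ times. Identify $\mathbb{R}^{np}=(\mathbb{R}^n)^p$; $\Delta_p:\mathbb{R}^n\to\mathbb{R}^{np}$, $\Delta_p(x)=(x,\dots,x)$; $-\Delta_pK=\{-\Delta_p(x):x\in K\}$; $K^p=K\times\cdots\times K\subset\mathbb{R}^{np}$. Convention $0^0=1$. *)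

theory Defs
  imports "HOL-Analysis.Analysis" "HOL-Library.Set_Algebras"
begin

definition convex_body :: "'a::euclidean_space set \<Rightarrow> bool" where
  "convex_body K \<longleftrightarrow> K \<noteq> {} \<and> compact K \<and> convex K"

text \<open>The \<^const>\<open>sum\<close> is the Minkowski sum (addition of sets); bodies and
  parameters are numbered from 0.\<close>

definition minkowski_combination ::
    "'a::euclidean_space set list \<Rightarrow> (nat \<Rightarrow> real) \<Rightarrow> 'a set" where
  "minkowski_combination Ks t = (\<Sum>i<length Ks. (\<lambda>x. t i *\<^sub>R x) ` (Ks ! i))"

text \<open>The volume of a Minkowski combination is polynomial only for nonnegative parameters
  (for instance, the length of \<open>t K\<close> is \<open>\<bar>t\<bar>\<close> times that of \<open>K\<close> on the line), so the partial
  derivatives at 0 are taken relative to \<open>[0,\<infinity>)\<close>.\<close>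

definition partial_deriv :: "nat \<Rightarrow> ((nat \<Rightarrow> real) \<Rightarrow> real) \<Rightarrow> (nat \<Rightarrow> real) \<Rightarrow> real" where
  "partial_deriv i f t = vector_derivative (\<lambda>s. f (t(i := s))) (at (t i) within {0..})"

text \<open>Meant for lists of \<open>N = DIM('a)\<close> convex bodies.  The fold is
  \<open>\<partial>/\<partial>t\<^sub>0 (\<dots> (\<partial>/\<partial>t\<^sub>N\<^sub>-\<^sub>1 vol) \<dots>)\<close>.\<close>

definition mixed_volume :: "'a::euclidean_space set list \<Rightarrow> real" where
  "mixed_volume Ks =
     foldr partial_deriv [0..<length Ks]
       (\<lambda>t. measure lebesgue (minkowski_combination Ks t)) (\<lambda>_. 0) / fact (length Ks)"

definition diag_emb :: "'a \<Rightarrow> 'a ^ 'p" where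
  "diag_emb x = (\<chi> i. x)"

definition cart_power :: "'a set \<Rightarrow> ('a ^ 'p) set" where
  "cart_power K = {x. \<forall>i. x $ i \<in> K}"

end

theory Submission
  imports Defs "HOL-Probability.Distributions"
begin

text \<open>The proof runs the Rogers--Shephard argument on cones.  In \<open>\<real> \<times> \<real> \<times> (\<real>\<^sup>n)\<^sup>p\<close> let \<open>C\<close> be the
  cone of all \<open>(a, b, z)\<close> with \<open>z \<in> a K\<^sup>p - b \<Delta>\<^sub>p K\<close>, and over such a point consider the fibre of all
  \<open>v \<in> b K\<close> with \<open>z\<^sub>i + v \<in> a K\<close> for all \<open>i\<close>.  If \<open>(a - \<mu>, b - \<mu>, z) \<in> C\<close>, then the fibre over
  \<open>(a, b, z)\<close> contains a translate of \<open>\<mu> K\<close>, so its volume is at least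
  \<open>|K| \<integral> n \<mu>\<^sup>n\<^sup>-\<^sup>1 [(a - \<mu>, b - \<mu>, z) \<in> C] d\<mu>\<close>.  Integrate both sides against
  \<open>exp (- a / (1 - t) - b / t)\<close>: on the left Fubini gives \<open>|K|\<^sup>p\<^sup>+\<^sup>1\<close> times Gamma factors, on the right
  one gets the integral of \<open>|a K\<^sup>p - b \<Delta>\<^sub>p K|\<close>, in which the Gamma factors cancel the binomial
  coefficients of the mixed volume expansion.

  That \<open>|B + r A|\<close> is a polynomial in \<open>r\<close> is shown by Gromov's argument: for polytopes the map
  \<open>\<nabla>\<phi>\<^sub>B + r \<nabla>\<phi>\<^sub>A\<close>, with \<open>\<phi>\<close> the log-sum-exp function of the vertices, is a diffeomorphism onto
  the interior of \<open>B + r A\<close>, and its Jacobian is polynomial in \<open>r\<close>; in the form of Lagrange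
  interpolation the statement passes to limits of polytopes.

  In the equality case almost every fibre is homothetic to \<open>K\<close>.  Letting \<open>a \<rightarrow> \<infinity>\<close> near a boundary
  point where \<open>K\<close> contains a touching ball, every cap of \<open>K\<close> cut off parallel to the tangent
  hyperplane is homothetic to \<open>K\<close>, so \<open>K\<close> is a pyramid over the face in that hyperplane.  Every extreme
  point is the apex of such a pyramid, hence the extreme points are affinely independent.\<close>

section \<open>The gradient of the log-sum-exp function\<close>

text \<open>Mixed volumes enter as iterated one-sided derivatives at 0, about which nothing can be
  said before the volume of \<open>a A + b B\<close> is known to be a polynomial; hence the long
  preparation. Only two different bodies occur, so a one-parameter family \<open>B + r A\<close>
  suffices. The rates \<open>x = 1 / (1 - t)\<close> and \<open>y = 1 / t\<close> are chosen because
  \<open>x + y = x * y\<close>: with them the Gamma factors of both sides turn into powers of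
  \<open>t\<close> and \<open>1 - t\<close> and almost everything cancels. With N = np, what remains
  is a bound by |K|^p (1 - t)^(N - n) for a sum over all j \<le> N, not only over j \<le> n. The
  surplus terms are removed by the bound itself: as t tends to 1 its right side decays so fast that
  the mixed volumes with j > n must vanish, after which (1 - t)^(N - n) can be divided out. The
  polynomial needs a body with interior, and the rates need 0 < t < 1. Flat bodies therefore get a
  separate argument, in which all volumes are 0, and the endpoints of [0, 1] follow by
  continuity.\<close>

definition softmax :: "'a::euclidean_space set \<Rightarrow> 'a \<Rightarrow> 'a \<Rightarrow> real" where
  "softmax V x v = exp (v \<bullet> x) / (\<Sum>w\<in>V. exp (w \<bullet> x))"

definition logsumexp :: "'a::euclidean_space set \<Rightarrow> 'a \<Rightarrow> real" where
  "logsumexp V x = ln (\<Sum>v\<in>V. exp (v \<bullet> x))"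

definition softmean :: "'a::euclidean_space set \<Rightarrow> 'a \<Rightarrow> 'a" where
  "softmean V x = (\<Sum>v\<in>V. softmax V x v *\<^sub>R v)"

text \<open>The covariance operator of the points of \<open>V\<close> under the Gibbs weights
  \<open>softmax V x\<close>. It is the Hessian of log-sum-exp at \<open>x\<close>.\<close>

definition softcov :: "'a::euclidean_space set \<Rightarrow> 'a \<Rightarrow> 'a \<Rightarrow> 'a" where
  "softcov V x h =
     (\<Sum>v\<in>V. (softmax V x v * ((v - softmean V x) \<bullet> h)) *\<^sub>R (v - softmean V x))"

context
  fixes V :: "'a::euclidean_space set"
  assumes fin: "finite V" and ne: "V \<noteq> {}"
begin

lemma sum_exp_pos: "0 < (\<Sum>v\<in>V. exp (v \<bullet> x))"
  using fin ne by (intro sum_pos) auto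

lemma softmax_pos: "0 < softmax V x v"
  unfolding softmax_def using sum_exp_pos by simp

lemma sum_softmax: "(\<Sum>v\<in>V. softmax V x v) = 1"
  unfolding softmax_def sum_divide_distrib [symmetric] using sum_exp_pos [of x] by simp

lemma softmean_in_hull: "softmean V x \<in> convex hull V"
  unfolding softmean_def using fin softmax_pos sum_softmax
  by (intro convex_sum) (auto simp: hull_inc intro: less_imp_le)

text \<open>Log-sum-exp dominates the support function of the hull. This makes the function
  minimised in \<open>interior_subset_range_softmean_pencil\<close> coercive.\<close>

lemma inner_le_logsumexp:
  assumes "q \<in> convex hull V"
  shows "q \<bullet> x \<le> logsumexp V x"
proof -
  have "v \<bullet> x \<le> logsumexp V x" if "v \<in> V" for v
  proof -
    have "exp (v \<bullet> x) \<le> (\<Sum>v\<in>V. exp (v \<bullet> x))"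
      using that fin by (intro member_le_sum) auto
    then show ?thesis
      unfolding logsumexp_def using sum_exp_pos [of x] by (simp add: ln_ge_iff)
  qed
  then have "V \<subseteq> {q. x \<bullet> q \<le> logsumexp V x}"
    by (auto simp: inner_commute)
  then have "convex hull V \<subseteq> {q. x \<bullet> q \<le> logsumexp V x}"
    by (intro hull_minimal convex_halfspace_le)
  with assms show ?thesis by (auto simp: inner_commute)
qed

lemma logsumexp_has_derivative:
  "(logsumexp V has_derivative (\<lambda>h. softmean V x \<bullet> h)) (at x)"
  unfolding logsumexp_def [abs_def] softmean_def softmax_def
  by (rule has_derivative_eq_rhs, (rule derivative_intros sum_exp_pos)+)
    (auto simp: inner_sum_left sum_distrib_left sum_divide_distrib field_simps)

lemma softmax_has_derivative:
  "((\<lambda>x. softmax V x v) has_derivative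
      (\<lambda>h. softmax V x v * ((v - softmean V x) \<bullet> h))) (at x)"
proof -
  let ?S = "\<Sum>v\<in>V. exp (v \<bullet> x)"
  have S: "?S \<noteq> 0" using sum_exp_pos [of x] by simp
  have m: "softmean V x \<bullet> h = (\<Sum>w\<in>V. exp (w \<bullet> x) * (w \<bullet> h)) / ?S" for h
    unfolding softmean_def softmax_def
    by (simp add: inner_sum_left sum_divide_distrib)
  show ?thesis
    unfolding softmax_def
    by (rule has_derivative_eq_rhs, (rule derivative_intros S)+)
      (use S in \<open>simp add: m inner_diff_left field_simps sum_distrib_left\<close>)
qed

lemma sum_softmax_deviation: "(\<Sum>v\<in>V. softmax V x v *\<^sub>R (v - softmean V x)) = 0"
  by (simp add: scaleR_diff_right sum_subtractf softmean_def [symmetric]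
      scaleR_left.sum [symmetric] sum_softmax)

lemma softmean_has_derivative: "(softmean V has_derivative softcov V x) (at x)"
proof -
  have "(softmean V has_derivative
      (\<lambda>h. \<Sum>v\<in>V. (softmax V x v * ((v - softmean V x) \<bullet> h)) *\<^sub>R v)) (at x)"
    unfolding softmean_def [abs_def]
    by (intro has_derivative_sum has_derivative_scaleR_left)
      (rule softmax_has_derivative [unfolded softmean_def])
  \<comment> \<open>Differentiating the weights leaves the uncentred vectors \<open>v\<close>;
    recentring is free because the deviations from the mean have weighted sum 0.\<close>
  moreover have "(\<Sum>v\<in>V. (softmax V x v * ((v - softmean V x) \<bullet> h)) *\<^sub>R v) = softcov V x h" for h
  proof -
    have "(\<Sum>v\<in>V. softmax V x v * ((v - softmean V x) \<bullet> h)) = 0"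
      using arg_cong [OF sum_softmax_deviation [of x], of "\<lambda>z. z \<bullet> h"]
      by (simp add: inner_sum_left)
    then show ?thesis
      unfolding softcov_def
      by (simp add: scaleR_diff_right sum_subtractf scaleR_left.sum [symmetric])
  qed
  ultimately show ?thesis by simp
qed

lemma inner_softcov: "softcov V x h \<bullet> h = (\<Sum>v\<in>V. softmax V x v * ((v - softmean V x) \<bullet> h)\<^sup>2)"
  by (simp add: softcov_def inner_sum_left power2_eq_square mult.assoc)

lemma inner_softcov_nonneg: "0 \<le> softcov V x h \<bullet> h"
  unfolding inner_softcov by (intro sum_nonneg mult_nonneg_nonneg less_imp_le [OF softmax_pos] zero_le_power2)

text \<open>The quadratic form is the variance of the functional \<open>h\<close> under strictly
  positive weights. It vanishes only if \<open>h\<close> is constant on \<open>V\<close>, and then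
  the hull lies in a hyperplane.\<close>

lemma inner_softcov_pos:
  assumes "interior (convex hull V) \<noteq> {}" "h \<noteq> 0"
  shows "0 < softcov V x h \<bullet> h"
proof (rule ccontr)
  assume "\<not> ?thesis"
  then have "softcov V x h \<bullet> h = 0" using inner_softcov_nonneg [of x h] by simp
  then have "\<forall>v\<in>V. softmax V x v * ((v - softmean V x) \<bullet> h)\<^sup>2 = 0"
    unfolding inner_softcov using fin
    by (subst (asm) sum_nonneg_eq_0_iff)
      (auto intro!: mult_nonneg_nonneg less_imp_le [OF softmax_pos])
  then have "\<forall>v\<in>V. (v - softmean V x) \<bullet> h = 0"
    using softmax_pos by (metis mult_eq_0_iff order_less_irrefl power_eq_0_iff)
  then have "V \<subseteq> {q. h \<bullet> q = h \<bullet> softmean V x}"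
    by (auto simp: inner_diff_left inner_commute [of h])
  then have "convex hull V \<subseteq> {q. h \<bullet> q = h \<bullet> softmean V x}"
    by (intro hull_minimal convex_hyperplane)
  then have "interior (convex hull V) \<subseteq> interior {q. h \<bullet> q = h \<bullet> softmean V x}"
    by (rule interior_mono)
  then show False using assms by simp
qed

end

section \<open>Volumes of Minkowski combinations\<close>

text \<open>No symmetry is assumed, so eigenvalues are avoided: every matrix on the segment from the
  identity to \<open>M\<close> has trivial kernel, hence the determinant keeps along it the sign
  that it has at the identity.\<close>

lemma det_pos_if_positive_definite:
  fixes M :: "real^'n^'n"
  assumes pd: "\<And>h. h \<noteq> 0 \<Longrightarrow> 0 < h \<bullet> (M *v h)"
  shows "0 < det M"
proof (rule ccontr)
  assume neg: "\<not> ?thesis"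
  define q where "q s = det ((1 - s) *\<^sub>R mat 1 + s *\<^sub>R M)" for s :: real
  have nz: "q s \<noteq> 0" if "0 \<le> s" "s \<le> 1" for s
  proof
    assume "q s = 0"
    then obtain h where h: "h \<noteq> 0" "((1 - s) *\<^sub>R mat 1 + s *\<^sub>R M) *v h = 0"
      unfolding q_def by (metis invertible_det_nz invertible_left_inverse matrix_left_invertible_ker)
    then have "0 = h \<bullet> (((1 - s) *\<^sub>R mat 1 + s *\<^sub>R M) *v h)" by simp
    also have "\<dots> = (1 - s) * (h \<bullet> h) + s * (h \<bullet> (M *v h))"
      by (simp add: matrix_vector_mult_add_rdistrib scaleR_matrix_vector_assoc [symmetric] inner_add_right)
    also have "\<dots> > 0"
    proof (cases "s = 1")
      case True then show ?thesis using pd [OF h(1)] by simp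
    next
      case False
      then have "0 < (1 - s) * (h \<bullet> h)" using that h by simp
      moreover have "0 \<le> s * (h \<bullet> (M *v h))" using pd [of h] h that by simp
      ultimately show ?thesis by linarith
    qed
    finally show False by simp
  qed
  have "continuous_on {0..1} q"
    unfolding q_def det_def by (intro continuous_intros)
  moreover have "q 1 \<le> 0" "0 \<le> q 0" using neg by (simp_all add: q_def)
  ultimately obtain s where "0 \<le> s" "s \<le> 1" "q s = 0"
    using IVT2' [of q 1 0 0] by auto
  with nz show False by blast
qed

lemma det_pencil_is_poly:
  fixes M L :: "real^'n^'n"
  obtains p where "degree p \<le> CARD('n)" "\<And>r. det (M + r *\<^sub>R L) = poly p r"
proof
  define p where "p = (\<Sum>\<pi> | \<pi> permutes (UNIV::'n set).
      of_int (sign \<pi>) * (\<Prod>i\<in>UNIV. [:M $ i $ \<pi> i, L $ i $ \<pi> i:]))"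
  show "det (M + r *\<^sub>R L) = poly p r" for r
    by (simp add: p_def det_def poly_sum poly_prod)
  show "degree p \<le> CARD('n)"
    unfolding p_def
  proof (intro degree_sum_le)
    fix \<pi> :: "'n \<Rightarrow> 'n"
    have "degree (\<Prod>i\<in>UNIV. [:M $ i $ \<pi> i, L $ i $ \<pi> i:]) \<le> (\<Sum>i\<in>(UNIV::'n set). 1)"
      by (rule order.trans [OF degree_prod_sum_le]) (simp, rule sum_mono, simp)
    then show "degree (of_int (sign \<pi>) * (\<Prod>i\<in>UNIV. [:M $ i $ \<pi> i, L $ i $ \<pi> i:])) \<le> CARD('n)"
      by (auto simp: of_int_poly intro!: order.trans[OF degree_mult_le])
  qed simp
qed

definition lagrange_basis :: "nat \<Rightarrow> nat \<Rightarrow> real poly" where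
  "lagrange_basis N k = (\<Prod>i\<in>{..N} - {k}. smult (1 / (real k - real i)) [:- real i, 1:])"

lemma degree_lagrange_basis: "k \<le> N \<Longrightarrow> degree (lagrange_basis N k) \<le> N"
  unfolding lagrange_basis_def
  by (rule order.trans [OF degree_prod_sum_le]) auto

lemma poly_lagrange_basis:
  assumes "k \<le> N" "i \<le> N"
  shows "poly (lagrange_basis N k) (real i) = (if i = k then 1 else 0)"
  using assms
  by (auto simp: lagrange_basis_def poly_prod diff_divide_distrib [symmetric] intro!: prod.neutral)

lemma lagrange_interpolation:
  assumes "degree p \<le> N"
  shows "poly p r = (\<Sum>k\<le>N. poly (lagrange_basis N k) r * poly p (real k))"
proof -
  define d where "d = p - (\<Sum>k\<le>N. smult (poly p (real k)) (lagrange_basis N k))"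
  have deg: "degree d \<le> N"
    unfolding d_def using assms degree_lagrange_basis
    by (intro degree_diff_le degree_sum_le) (auto intro: order.trans [OF degree_smult_le])
  have "poly d (real i) = 0" if "i \<le> N" for i
    using that by (simp add: d_def poly_sum poly_lagrange_basis if_distrib cong: if_cong)
  then have sub: "real ` {..N} \<subseteq> {x. poly d x = 0}" by auto
  have "d = 0"
  proof (rule ccontr)
    assume "d \<noteq> 0"
    then have "card (real ` {..N}) \<le> card {x. poly d x = 0}"
      by (intro card_mono poly_roots_finite sub)
    also have "\<dots> \<le> degree d" by (rule card_poly_roots_bound) fact
    also have "\<dots> \<le> N" by (rule deg)
    finally show False by (simp add: card_image inj_on_def)
  qed
  then have "poly d r = 0" by simp
  then show ?thesis by (simp add: d_def poly_sum mult.commute)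
qed

lemma compact_set_plus:
  fixes S T :: "'a::real_normed_vector set"
  shows "compact S \<Longrightarrow> compact T \<Longrightarrow> compact (S + T)"
  using compact_sums' [of S T] by (auto simp: set_plus_def intro: back_subst [of compact])

text \<open>The polynomial in \<open>r\<close> is expressed by its values at the nodes 0, ..., N
  with weights that do not depend on the matrices. The identity can therefore be integrated over
  \<open>x\<close> term by term.\<close>

lemma det_pencil_interpolation:
  fixes M L :: "real^'n^'n"
  shows "det (M + r *\<^sub>R L) =
    (\<Sum>k\<le>CARD('n). poly (lagrange_basis CARD('n) k) r * det (M + real k *\<^sub>R L))"
proof (rule det_pencil_is_poly [of M L])
  fix p assume deg: "degree p \<le> CARD('n)" and p: "\<And>r. det (M + r *\<^sub>R L) = poly p r"
  show ?thesis unfolding p by (rule lagrange_interpolation [OF deg])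
qed

section \<open>The gradient map of a pencil of two polytopes\<close>

context
  fixes A B :: "'a::euclidean_space set" and r :: real
  assumes A: "finite A" "A \<noteq> {}" and B: "finite B" "B \<noteq> {}"
    and int: "interior (convex hull B) \<noteq> {}" and r: "0 \<le> r"
begin

abbreviation "hull_pencil \<equiv> convex hull B + (\<lambda>x. r *\<^sub>R x) ` (convex hull A)"
abbreviation "mean_pencil x \<equiv> softmean B x + r *\<^sub>R softmean A x"
abbreviation "cov_pencil x h \<equiv> softcov B x h + r *\<^sub>R softcov A x h"

lemma softmean_pencil_has_derivative: "(mean_pencil has_derivative cov_pencil x) (at x)"
  by (intro has_derivative_add has_derivative_scaleR_right softmean_has_derivative A B)

lemma softmean_pencil_derivative_pos: "h \<noteq> 0 \<Longrightarrow> 0 < cov_pencil x h \<bullet> h"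
  using inner_softcov_pos [OF B int, of h x] inner_softcov_nonneg [OF A, of x h] r
  by (simp add: inner_add_left add_pos_nonneg)

text \<open>A gradient of a strictly convex function is strictly monotone: along the segment from
  \<open>x\<close> to \<open>y\<close> the component of the map in direction \<open>y - x\<close>
  has positive derivative.\<close>

lemma inj_softmean_pencil: "inj mean_pencil"
proof (rule ccontr)
  assume "\<not> inj mean_pencil"
  then obtain x y where xy: "mean_pencil x = mean_pencil y" "x \<noteq> y" by (auto simp: inj_def)
  define h where "h = y - x"
  have h: "h \<noteq> 0" using xy by (simp add: h_def)
  define f where "f s = mean_pencil (x + s *\<^sub>R h) \<bullet> h" for s
  have "(f has_real_derivative cov_pencil (x + s *\<^sub>R h) h \<bullet> h) (at s)" for s
  proof -
    have "((\<lambda>s. mean_pencil (x + s *\<^sub>R h)) has_derivative (\<lambda>t. cov_pencil (x + s *\<^sub>R h) (t *\<^sub>R h))) (at s)"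
      by (rule has_derivative_compose [OF _ softmean_pencil_has_derivative]) (auto intro!: derivative_eq_intros)
    then have "(f has_derivative (\<lambda>t. cov_pencil (x + s *\<^sub>R h) (t *\<^sub>R h) \<bullet> h)) (at s)"
      unfolding f_def by (rule has_derivative_inner_left)
    moreover have "(\<lambda>t. cov_pencil (x + s *\<^sub>R h) (t *\<^sub>R h) \<bullet> h) = (*) (cov_pencil (x + s *\<^sub>R h) h \<bullet> h)"
    proof
      fix t
      have eq: "cov_pencil (x + s *\<^sub>R h) (t *\<^sub>R h) = t *\<^sub>R cov_pencil (x + s *\<^sub>R h) h"
        by (rule linear_cmul [OF has_derivative_linear [OF softmean_pencil_has_derivative]])
      show "cov_pencil (x + s *\<^sub>R h) (t *\<^sub>R h) \<bullet> h = (cov_pencil (x + s *\<^sub>R h) h \<bullet> h) * t"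
        unfolding eq inner_scaleR_left by (rule mult.commute)
    qed
    ultimately show ?thesis
      unfolding has_field_derivative_def by (rule has_derivative_eq_rhs)
  qed
  then have der: "\<exists>d. (f has_real_derivative d) (at s) \<and> 0 < d" for s
    using softmean_pencil_derivative_pos [OF h] by blast
  have "f 0 < f 1"
    by (rule DERIV_pos_imp_increasing [OF zero_less_one der])
  moreover have "f 0 = f 1"
    unfolding f_def h_def using arg_cong [OF xy(1), of "\<lambda>z. z \<bullet> (y - x)"]
    by (simp only: scaleR_zero_left scaleR_one add_0_right add_diff_cancel_left' diff_add_cancel add_diff_eq)
  ultimately show False by simp
qed

lemma softmean_pencil_in: "mean_pencil x \<in> hull_pencil"
  by (intro set_plus_intro imageI softmean_in_hull A B)

text \<open>A given \<open>y\<close> is the value of the gradient at a minimiser of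
  \<open>\<psi>\<close>, the potential minus the linear functional of \<open>y\<close>. A minimiser
  exists because the ball of radius \<open>d\<close> around \<open>y\<close> inside the pencil makes
  \<open>\<psi>\<close> grow at least like \<open>d * norm x\<close>.\<close>

lemma interior_subset_range_softmean_pencil: "interior hull_pencil \<subseteq> range mean_pencil"
proof
  fix y assume "y \<in> interior hull_pencil"
  then obtain d where d: "0 < d" "cball y d \<subseteq> hull_pencil" by (auto simp: mem_interior_cball)
  define \<psi> where "\<psi> x = logsumexp B x + r * logsumexp A x - y \<bullet> x" for x
  have der: "(\<psi> has_derivative (\<lambda>h. (mean_pencil x - y) \<bullet> h)) (at x)" for x
    unfolding \<psi>_def
    by (rule has_derivative_eq_rhs, (rule derivative_intros logsumexp_has_derivative A B)+)
      (simp add: inner_diff_left inner_add_left)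
  have grow: "d * norm x \<le> \<psi> x" for x
  proof (cases "x = 0")
    case True
    obtain a b where "a \<in> A" "b \<in> B" using A B by auto
    then show ?thesis
      using inner_le_logsumexp [OF A hull_inc, of a 0] inner_le_logsumexp [OF B hull_inc, of b 0] r True
      by (simp add: \<psi>_def)
  next
    case False
    have "y + (d / norm x) *\<^sub>R x \<in> hull_pencil"
      using d False by (intro subsetD [OF d(2)]) (simp add: dist_norm)
    then obtain p q where pq: "p \<in> convex hull B" "q \<in> convex hull A" "y + (d / norm x) *\<^sub>R x = p + r *\<^sub>R q"
      by (auto elim!: set_plus_elim)
    have "y \<bullet> x + d * norm x = (y + (d / norm x) *\<^sub>R x) \<bullet> x"
      using False by (simp add: inner_add_left power2_norm_eq_inner [symmetric] power2_eq_square)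
    also have "\<dots> = p \<bullet> x + r * (q \<bullet> x)"
      unfolding pq by (simp add: inner_add_left)
    also have "\<dots> \<le> logsumexp B x + r * logsumexp A x"
      using pq r by (intro add_mono mult_left_mono inner_le_logsumexp A B)
    finally show ?thesis by (simp add: \<psi>_def)
  qed
  \<comment> \<open>Beyond this radius the linear growth exceeds \<open>\<psi> 0\<close>, so a
    minimum over the ball is a global one.\<close>
  define R where "R = \<psi> 0 / d"
  have cont: "continuous_on S \<psi>" for S
    using der by (meson has_derivative_continuous continuous_at_imp_continuous_on)
  have R: "0 \<le> R" using grow [of 0] d by (simp add: R_def)
  then obtain x where x: "x \<in> cball 0 R" "\<And>z. z \<in> cball 0 R \<Longrightarrow> \<psi> x \<le> \<psi> z"
    using continuous_attains_inf [of "cball 0 R" \<psi>] cont by auto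
  have "\<psi> x \<le> \<psi> z" for z
  proof (cases "norm z \<le> R")
    case True then show ?thesis using x by simp
  next
    case False
    then have "\<psi> 0 \<le> d * norm z" using d by (simp add: R_def field_simps)
    also have "\<dots> \<le> \<psi> z" by (rule grow)
    finally show ?thesis using x(2) [of 0] R by simp
  qed
  then have "(\<lambda>h. (mean_pencil x - y) \<bullet> h) = (\<lambda>h. 0)"
    by (intro differential_zero_maxmin [OF _ open_UNIV der]) auto
  then have "(mean_pencil x - y) \<bullet> (mean_pencil x - y) = 0" by metis
  then have "y = mean_pencil x" by simp
  then show "y \<in> range mean_pencil" by (rule range_eqI)
qed

lemma compact_convex_pencil: "compact hull_pencil" "convex hull_pencil"
  using A B
  by (auto intro!: compact_set_plus convex_set_plus compact_scaling convex_scaling finite_imp_compact_convex_hull)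

end

text \<open>The range of the gradient map lies between the interior of the closed convex pencil and
  the pencil itself, so it misses only a null set. Positivity of the Jacobian removes the absolute
  value in the change of variables, which leaves an integrand polynomial in
  \<open>r\<close>.\<close>

lemma has_integral_det_pencil:
  fixes A B :: "(real^'k::{finite,wellorder}) set"
  assumes "finite A" "A \<noteq> {}" "finite B" "B \<noteq> {}" "interior (convex hull B) \<noteq> {}" "0 \<le> r"
  shows "((\<lambda>x. det (matrix (softcov B x) + r *\<^sub>R matrix (softcov A x))) has_integral
    measure lebesgue (convex hull B + (\<lambda>x. r *\<^sub>R x) ` (convex hull A))) UNIV"
proof -
  note asm = assms
  let ?P = "convex hull B + (\<lambda>x. r *\<^sub>R x) ` (convex hull A)"
  let ?g = "\<lambda>x. softmean B x + r *\<^sub>R softmean A x"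
  let ?g' = "\<lambda>x h. softcov B x h + r *\<^sub>R softcov A x h"
  have P: "compact ?P" "convex ?P" by (rule compact_convex_pencil [OF asm])+
  have meas: "?P \<in> lmeasurable" using P lmeasurable_compact by blast
  have neg: "negligible (frontier ?P)" by (rule negligible_convex_frontier [OF P(2)])
  have "?P - range ?g \<union> (range ?g - ?P) \<subseteq> frontier ?P"
    using interior_subset_range_softmean_pencil [OF asm] softmean_pencil_in [OF asm]
      compact_imp_closed [OF P(1)] by (auto simp: frontier_def closure_closed)
  then have neg': "negligible (?P - range ?g \<union> (range ?g - ?P))"
    using neg negligible_subset by blast
  have "range ?g \<in> lmeasurable" "measure lebesgue (range ?g) = measure lebesgue ?P"
    using lmeasurable_negligible_symdiff [OF meas neg'] measure_negligible_symdiff [OF meas neg'] by auto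
  then have "((\<lambda>x. \<bar>det (matrix (?g' x))\<bar>) has_integral measure lebesgue ?P) UNIV"
    using has_measure_differentiable_image [of UNIV ?g ?g'] softmean_pencil_has_derivative [OF asm]
      inj_softmean_pencil [OF asm] by auto
  moreover have "\<bar>det (matrix (?g' x))\<bar> = det (matrix (softcov B x) + r *\<^sub>R matrix (softcov A x))" for x
  proof -
    have lin: "linear (?g' x)" using softmean_pencil_has_derivative [OF asm] has_derivative_linear by blast
    have "0 < det (matrix (?g' x))"
      using softmean_pencil_derivative_pos [OF asm, of _ x]
      by (intro det_pos_if_positive_definite) (simp add: matrix_works lin inner_commute)
    moreover have "matrix (?g' x) = matrix (softcov B x) + r *\<^sub>R matrix (softcov A x)"
      by (simp add: matrix_def vec_eq_iff)
    ultimately show ?thesis by simp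
  qed
  ultimately show ?thesis by simp
qed

text \<open>Says that the volume agrees for r \<ge> 0 with a polynomial of degree at most the
  dimension. No coefficients are named: every term is a volume, so pointwise convergence of volumes
  is all that a limit needs.\<close>

definition volume_interpolates :: "'a::euclidean_space set \<Rightarrow> 'a set \<Rightarrow> bool" where
  "volume_interpolates B A \<longleftrightarrow> (\<forall>r\<ge>0. measure lebesgue (B + (\<lambda>x. r *\<^sub>R x) ` A) =
     (\<Sum>k\<le>DIM('a). poly (lagrange_basis DIM('a) k) r *
        measure lebesgue (B + (\<lambda>x. real k *\<^sub>R x) ` A)))"

lemma volume_interpolates_polytope_cart:
  fixes A B :: "(real^'k::{finite,wellorder}) set"
  assumes "finite A" "A \<noteq> {}" "finite B" "B \<noteq> {}" "interior (convex hull B) \<noteq> {}"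
  shows "volume_interpolates (convex hull B) (convex hull A)"
  unfolding volume_interpolates_def
proof (intro allI impI)
  fix r :: real assume r: "0 \<le> r"
  let ?N = "CARD('k)"
  let ?D = "\<lambda>r x. det (matrix (softcov B x) + r *\<^sub>R matrix (softcov A x))"
  let ?m = "\<lambda>r. measure lebesgue (convex hull B + (\<lambda>x. r *\<^sub>R x) ` (convex hull A))"
  have "?D r x = (\<Sum>k\<le>?N. poly (lagrange_basis ?N k) r * ?D (real k) x)" for x
    by (rule det_pencil_interpolation)
  then have "((\<lambda>x. \<Sum>k\<le>?N. poly (lagrange_basis ?N k) r * ?D (real k) x) has_integral ?m r) UNIV"
    by (rule has_integral_eq [OF _ has_integral_det_pencil [OF assms r]])
  moreover have "((\<lambda>x. \<Sum>k\<le>?N. poly (lagrange_basis ?N k) r * ?D (real k) x) has_integral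
     (\<Sum>k\<le>?N. poly (lagrange_basis ?N k) r * ?m (real k))) UNIV"
    by (intro has_integral_sum has_integral_mult_right has_integral_det_pencil assms) auto
  ultimately have "?m r = (\<Sum>k\<le>?N. poly (lagrange_basis ?N k) r * ?m (real k))"
    by (rule has_integral_unique)
  then show "?m r = (\<Sum>k\<le>DIM((real, 'k) vec). poly (lagrange_basis DIM((real, 'k) vec) k) r * ?m (real k))"
    unfolding DIM_cart DIM_real mult_1_right .
qed

text \<open>The change of variables theorem is only available for Cartesian spaces whose index type is
  well-ordered, so \<^typ>\<open>'a\<close> is identified with the Cartesian space over a well-ordered copy of
  its basis.\<close>

typedef (overloaded) 'a coord = "Basis :: 'a::euclidean_space set"
  by (rule nonempty_Basis [unfolded ex_in_conv [symmetric]])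

lemma bij_betw_Rep_coord:
  "bij_betw (Rep_coord :: 'a::euclidean_space coord \<Rightarrow> 'a) UNIV Basis"
  by (metis Rep_coord_inject bij_betw_def inj_on_def type_definition.Rep_range type_definition_coord)

instance coord :: (euclidean_space) finite
proof
  show "finite (UNIV :: 'a coord set)"
    using bij_betw_finite [OF bij_betw_Rep_coord] by simp
qed

lemma CARD_coord: "CARD('a::euclidean_space coord) = DIM('a)"
  by (rule bij_betw_same_card [OF bij_betw_Rep_coord])

definition coord_index :: "'a::euclidean_space coord \<Rightarrow> nat" where
  "coord_index = (SOME f. inj f)"

lemma inj_coord_index: "inj coord_index"
proof -
  have "\<exists>f :: 'a coord \<Rightarrow> nat. inj f"
    using finite_imp_inj_to_nat_seg [of "UNIV :: 'a coord set"] by auto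
  then show ?thesis unfolding coord_index_def by (rule someI_ex)
qed

instantiation coord :: (euclidean_space) wellorder
begin

definition less_eq_coord :: "'a coord \<Rightarrow> 'a coord \<Rightarrow> bool" where
  "x \<le> y \<longleftrightarrow> coord_index x \<le> coord_index y"

definition less_coord :: "'a coord \<Rightarrow> 'a coord \<Rightarrow> bool" where
  "x < y \<longleftrightarrow> coord_index x < coord_index y"

instance
proof
  fix P :: "'a coord \<Rightarrow> bool" and a
  assume step: "\<And>x. (\<And>y. y < x \<Longrightarrow> P y) \<Longrightarrow> P x"
  show "P a"
    by (induction a rule: measure_induct_rule [of coord_index]) (use step in \<open>auto simp: less_coord_def\<close>)
qed (use inj_coord_index in \<open>auto simp: less_eq_coord_def less_coord_def inj_def\<close>)

end

definition to_coords :: "'a::euclidean_space \<Rightarrow> real ^ 'a coord" where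
  "to_coords x = (\<chi> i. x \<bullet> Rep_coord i)"

definition of_coords :: "real ^ 'a::euclidean_space coord \<Rightarrow> 'a" where
  "of_coords y = (\<Sum>i\<in>UNIV. (y $ i) *\<^sub>R Rep_coord i)"

lemma sum_coord: "(\<Sum>i\<in>UNIV. f (Rep_coord i)) = (\<Sum>b\<in>Basis. f b)"
  by (rule sum.reindex_bij_betw [OF bij_betw_Rep_coord])

lemma prod_coord: "(\<Prod>i\<in>UNIV. f (Rep_coord i)) = (\<Prod>b\<in>Basis. f b)"
  by (rule prod.reindex_bij_betw [OF bij_betw_Rep_coord])

lemma of_to_coords [simp]: "of_coords (to_coords x) = x"
  by (simp add: of_coords_def to_coords_def sum_coord [of "\<lambda>b. (x \<bullet> b) *\<^sub>R b"] euclidean_representation)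

lemma Rep_coord_inner: "Rep_coord i \<bullet> Rep_coord j = (if i = j then 1 else 0)"
  using inner_Basis [OF Rep_coord Rep_coord, of i j] by (simp add: Rep_coord_inject)

lemma of_coords_inner: "of_coords y \<bullet> Rep_coord i = y $ i"
  by (simp add: of_coords_def inner_sum_left Rep_coord_inner if_distrib cong: if_cong)

lemma to_of_coords [simp]: "to_coords (of_coords y) = y"
  by (simp add: to_coords_def of_coords_inner)

lemma linear_to_coords: "linear to_coords"
  by (auto intro!: linearI simp: to_coords_def vec_eq_iff inner_add_left)

lemma linear_of_coords: "linear of_coords"
  by (auto intro!: linearI simp: of_coords_def scaleR_add_left sum.distrib scaleR_sum_right)

text \<open>The map carries the standard basis to \<open>Basis\<close>, so preimages of boxes are
  boxes with the same side lengths.\<close>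

lemma distr_of_coords:
  "distr lborel borel (of_coords :: real ^ 'a::euclidean_space coord \<Rightarrow> 'a) = lborel"
proof (rule lborel_eqI [symmetric])
  fix l u :: 'a assume lu: "\<And>b. b \<in> Basis \<Longrightarrow> l \<bullet> b \<le> u \<bullet> b"
  have Basis: "(\<forall>b\<in>Basis. Q b) \<longleftrightarrow> (\<forall>i. Q (Rep_coord i))" for Q :: "'a \<Rightarrow> bool"
    by (metis Rep_coord Rep_coord_cases)
  have meas: "(of_coords :: real ^ 'a coord \<Rightarrow> 'a) \<in> borel_measurable borel"
    by (intro borel_measurable_continuous_onI linear_continuous_on linear_conv_bounded_linear [THEN iffD1] linear_of_coords)
  have "of_coords -` box l u = box (to_coords l) (to_coords u)"
    unfolding box_def Basis by (auto simp: of_coords_inner Basis_vec_def inner_axis to_coords_def)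
  then have "emeasure (distr lborel borel of_coords) (box l u) = emeasure lborel (box (to_coords l) (to_coords u))"
    using meas by (simp add: emeasure_distr)
  also have "\<dots> = ennreal (\<Prod>i\<in>UNIV. (u - l) \<bullet> Rep_coord i)"
  proof -
    have "(\<Prod>b\<in>Basis. (to_coords u - to_coords l) \<bullet> b) = (\<Prod>i\<in>UNIV. (to_coords u - to_coords l) $ i)"
      by (subst Basis_vec_def) (simp add: UNION_singleton_eq_range prod.reindex inj_on_def axis_eq_axis inner_axis)
    also have "\<dots> = (\<Prod>i\<in>UNIV. (u - l) \<bullet> Rep_coord i)"
      by (simp add: to_coords_def inner_diff_left)
    finally show ?thesis
      using lu [OF Rep_coord]
      by (subst emeasure_lborel_box) (auto simp: Basis_vec_def inner_axis to_coords_def)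
  qed
  also have "\<dots> = ennreal (\<Prod>b\<in>Basis. (u - l) \<bullet> b)" by (subst prod_coord) simp
  finally show "emeasure (distr lborel borel of_coords) (box l u) = ennreal (\<Prod>b\<in>Basis. (u - l) \<bullet> b)" .
qed simp

lemma measure_lebesgue_borel: "S \<in> sets borel \<Longrightarrow> measure lebesgue S = measure lborel S"
  by (simp add: measure_completion)

lemma measure_to_coords:
  fixes S :: "'a::euclidean_space set"
  assumes "compact S"
  shows "measure lebesgue (to_coords ` S) = measure lebesgue S"
proof -
  have meas: "(of_coords :: real ^ 'a coord \<Rightarrow> 'a) \<in> borel_measurable borel"
    by (intro borel_measurable_continuous_onI linear_continuous_on linear_conv_bounded_linear [THEN iffD1] linear_of_coords)
  have eq: "to_coords ` S = of_coords -` S"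
    by (auto simp: image_iff) (metis to_of_coords)
  have "compact (to_coords ` S)"
    by (intro compact_continuous_image assms linear_continuous_on linear_conv_bounded_linear [THEN iffD1] linear_to_coords)
  then have "measure lebesgue (to_coords ` S) = measure lborel (to_coords ` S)"
    by (intro measure_lebesgue_borel borel_compact)
  also have "\<dots> = measure lborel (of_coords -` S)" unfolding eq ..
  also have "\<dots> = measure (distr lborel borel of_coords) S"
    using meas assms by (subst measure_distr) (auto simp: borel_compact)
  also have "\<dots> = measure lebesgue S"
    using assms by (simp add: distr_of_coords measure_lebesgue_borel borel_compact)
  finally show ?thesis .
qed

lemma linear_image_set_plus: "linear f \<Longrightarrow> f ` (S + T) = f ` S + f ` T"
  by (force simp: set_plus_def image_iff linear_add)

lemma volume_interpolates_polytope:
  fixes A B :: "'a::euclidean_space set"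
  assumes "finite A" "A \<noteq> {}" "finite B" "B \<noteq> {}" "interior (convex hull B) \<noteq> {}"
  shows "volume_interpolates (convex hull B) (convex hull A)"
proof -
  have "interior (convex hull (to_coords ` B)) = to_coords ` interior (convex hull B)"
    by (subst convex_hull_linear_image [OF linear_to_coords, symmetric])
      (intro interior_bijective_linear_image linear_to_coords bijI' ; metis of_to_coords to_of_coords)
  with assms have *: "volume_interpolates (convex hull (to_coords ` B)) (convex hull (to_coords ` A))"
    by (intro volume_interpolates_polytope_cart) auto
  have eq: "measure lebesgue (convex hull (to_coords ` B) + (\<lambda>x. r *\<^sub>R x) ` (convex hull (to_coords ` A)))
     = measure lebesgue (convex hull B + (\<lambda>x. r *\<^sub>R x) ` (convex hull A))" for r
  proof -
    have "convex hull (to_coords ` B) + (\<lambda>x. r *\<^sub>R x) ` (convex hull (to_coords ` A))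
      = to_coords ` (convex hull B + (\<lambda>x. r *\<^sub>R x) ` (convex hull A))"
      unfolding convex_hull_linear_image [OF linear_to_coords, symmetric]
        linear_image_set_plus [OF linear_to_coords] image_image linear_cmul [OF linear_to_coords] ..
    then show ?thesis
      using assms by (simp add: measure_to_coords compact_set_plus compact_scaling finite_imp_compact_convex_hull)
  qed
  show ?thesis
    using * unfolding volume_interpolates_def eq CARD_coord DIM_cart DIM_real mult_1_right .
qed

section \<open>From polytopes to convex bodies\<close>

text \<open>The union of an increasing sequence of convex sets is convex, so its frontier is null.
  \<open>D\<close> lies between the union and its closure and thus has the same volume.\<close>

lemma measure_convex_incseq_limit:
  fixes C :: "nat \<Rightarrow> 'a::euclidean_space set"
  assumes cvx: "\<And>m. convex (C m)" and cpt: "\<And>m. compact (C m)" and inc: "incseq C"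
    and sub: "\<And>m. C m \<subseteq> D" and D: "compact D" "D \<subseteq> closure (\<Union>m. C m)"
  shows "(\<lambda>m. measure lebesgue (C m)) \<longlonglongrightarrow> measure lebesgue D"
proof -
  let ?U = "\<Union>m. C m"
  have "convex ?U"
  proof (rule convexI)
    fix x y and a b :: real
    assume "x \<in> ?U" "y \<in> ?U" and ab: "0 \<le> a" "0 \<le> b" "a + b = 1"
    then obtain i j where "x \<in> C i" "y \<in> C j" by auto
    then have "x \<in> C (max i j)" "y \<in> C (max i j)"
      using inc [unfolded incseq_def] by (meson max.cobounded1 max.cobounded2 subsetD)+
    then have "a *\<^sub>R x + b *\<^sub>R y \<in> C (max i j)" using cvx ab by (simp add: convex_def)
    then show "a *\<^sub>R x + b *\<^sub>R y \<in> ?U" by blast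
  qed
  moreover have "bounded ?U" using sub D compact_imp_bounded bounded_subset by (metis UN_least)
  ultimately have U: "?U \<in> lmeasurable" "negligible (frontier ?U)"
    by (auto intro: measurable_convex negligible_convex_frontier)
  have "?U - D \<union> (D - ?U) \<subseteq> frontier ?U"
    using sub D interior_subset [of ?U] by (auto simp: frontier_def)
  then have "measure lebesgue D = measure lebesgue ?U"
    using U negligible_subset by (intro measure_negligible_symdiff) blast+
  moreover have "(\<lambda>m. measure lebesgue (C m)) \<longlonglongrightarrow> measure lebesgue ?U"
    using cpt U(1) inc
    by (intro Lim_measure_incseq) (auto simp: borel_compact fmeasurable_def)
  ultimately show ?thesis by simp
qed

lemma dense_sequence:
  fixes K :: "'a::euclidean_space set"
  assumes "K \<noteq> {}"
  obtains s :: "nat \<Rightarrow> 'a" where "range s \<subseteq> K" "K \<subseteq> closure (range s)"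
proof -
  obtain T where T: "countable T" "T \<subseteq> K" "K \<subseteq> closure T" using separable [of K] by blast
  with assms have "T \<noteq> {}" by auto
  then have "range (from_nat_into T) = T" using T by simp
  with T that [of "from_nat_into T"] show thesis by simp
qed

lemma measure_pos_if_interior:
  fixes S :: "'a::euclidean_space set"
  assumes "compact S" "convex S"
  shows "0 < measure lebesgue S \<longleftrightarrow> interior S \<noteq> {}"
  using negligible_convex_interior [OF assms(2)] negligible_iff_measure0 [of S] lmeasurable_compact [OF assms(1)]
  by (simp add: zero_less_measure_iff)

lemma compact_convex_set_plus_scale:
  fixes S T :: "'a::euclidean_space set"
  assumes "compact S" "convex S" "compact T" "convex T"
  shows "compact (S + (\<lambda>x. r *\<^sub>R x) ` T)" "convex (S + (\<lambda>x. r *\<^sub>R x) ` T)"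
  using assms by (auto intro!: compact_set_plus convex_set_plus compact_scaling convex_scaling)

lemma volume_interpolates_convex_body:
  fixes A B :: "'a::euclidean_space set"
  assumes A: "convex_body A" and B: "convex_body B" and int: "interior B \<noteq> {}"
  shows "volume_interpolates B A"
proof -
  have ne: "A \<noteq> {}" "B \<noteq> {}" using A B by (auto simp: convex_body_def)
  obtain s :: "nat \<Rightarrow> 'a" where s: "range s \<subseteq> A" "A \<subseteq> closure (range s)"
    by (rule dense_sequence [OF ne(1)])
  obtain u :: "nat \<Rightarrow> 'a" where u: "range u \<subseteq> B" "B \<subseteq> closure (range u)"
    by (rule dense_sequence [OF ne(2)])
  define PA where "PA m = convex hull (s ` {..m})" for m :: nat
  define PB where "PB m = convex hull (u ` {..m})" for m :: nat
  note cvx = A [unfolded convex_body_def] B [unfolded convex_body_def]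
  have sub: "PA m \<subseteq> A" "PB m \<subseteq> B" for m
    unfolding PA_def PB_def using s u cvx by (intro hull_minimal; blast)+
  have poly: "compact (PA m)" "convex (PA m)" "compact (PB m)" "convex (PB m)" for m
    by (auto simp: PA_def PB_def finite_imp_compact_convex_hull)
  have inc: "PA i \<subseteq> PA j" "PB i \<subseteq> PB j" if "i \<le> j" for i j
    using that by (auto simp: PA_def PB_def intro!: hull_mono image_mono)
  have mem: "s i \<in> PA i" "u i \<in> PB i" for i
    by (auto simp: PA_def PB_def intro!: hull_inc)
  have lim: "(\<lambda>m. measure lebesgue (PB m + (\<lambda>x. r *\<^sub>R x) ` PA m)) \<longlonglongrightarrow>
      measure lebesgue (B + (\<lambda>x. r *\<^sub>R x) ` A)" for r
  proof (rule measure_convex_incseq_limit)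
    show "incseq (\<lambda>m. PB m + (\<lambda>x. r *\<^sub>R x) ` PA m)"
      unfolding incseq_def by (intro allI impI set_plus_mono2 image_mono inc)
    show "PB m + (\<lambda>x. r *\<^sub>R x) ` PA m \<subseteq> B + (\<lambda>x. r *\<^sub>R x) ` A" for m
      by (intro set_plus_mono2 image_mono sub)
    show "B + (\<lambda>x. r *\<^sub>R x) ` A \<subseteq> closure (\<Union>m. PB m + (\<lambda>x. r *\<^sub>R x) ` PA m)"
    proof
      fix z assume "z \<in> B + (\<lambda>x. r *\<^sub>R x) ` A"
      then obtain b a where "z = b + r *\<^sub>R a" "b \<in> B" "a \<in> A"
        by (auto elim!: set_plus_elim)
      then have z: "z = b + r *\<^sub>R a" "b \<in> closure (range u)" "a \<in> closure (range s)"
        using s u by auto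
      then obtain f g where f: "\<And>n. f n \<in> range u" "f \<longlonglongrightarrow> b" and g: "\<And>n. g n \<in> range s" "g \<longlonglongrightarrow> a"
        by (auto simp: closure_sequential)
      have "f n + r *\<^sub>R g n \<in> closure (\<Union>m. PB m + (\<lambda>x. r *\<^sub>R x) ` PA m)" for n
      proof (rule subsetD [OF closure_subset])
        obtain i j where ij: "f n = u i" "g n = s j" using f(1) g(1) by (metis imageE)
        have "u i \<in> PB (max i j)" "s j \<in> PA (max i j)"
          using mem inc by (meson max.cobounded1 max.cobounded2 subsetD)+
        then show "f n + r *\<^sub>R g n \<in> (\<Union>m. PB m + (\<lambda>x. r *\<^sub>R x) ` PA m)"
          unfolding ij by blast
      qed
      moreover have "(\<lambda>n. f n + r *\<^sub>R g n) \<longlonglongrightarrow> z"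
        unfolding z by (intro tendsto_intros f g)
      ultimately show "z \<in> closure (\<Union>m. PB m + (\<lambda>x. r *\<^sub>R x) ` PA m)"
        by (metis (no_types, lifting) closed_closure closed_sequentially)
    qed
  qed (use cvx poly in \<open>auto intro!: compact_convex_set_plus_scale\<close>)
  have zero: "S + (\<lambda>x. 0 *\<^sub>R x) ` T = S" if "T \<noteq> {}" for S T :: "'a set"
    using that by (auto simp: set_plus_def)
  have PA_ne: "PA m \<noteq> {}" for m using mem inc by (metis empty_iff subset_empty le0 empty_subsetI)
  \<comment> \<open>The polytope case needs a hull with interior. The case r = 0 of
    \<open>lim\<close> shows that the volumes of the polytopes inside \<open>B\<close> tend to the
    positive volume of \<open>B\<close>, so this holds eventually.\<close>
  have "\<forall>\<^sub>F m in sequentially. 0 < measure lebesgue (PB m)"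
    using lim [of 0] measure_pos_if_interior [of B] cvx int unfolding zero [OF PA_ne] zero [OF ne(1)]
    by (intro order_tendstoD) auto
  then have ev: "\<forall>\<^sub>F m in sequentially. volume_interpolates (PB m) (PA m)"
  proof eventually_elim
    case (elim m)
    then have "interior (PB m) \<noteq> {}" using measure_pos_if_interior poly by blast
    then show ?case unfolding PA_def PB_def
      by (intro volume_interpolates_polytope) auto
  qed
  let ?L = "\<lambda>k. poly (lagrange_basis DIM('a) k)"
  show ?thesis
    unfolding volume_interpolates_def
  proof (intro allI impI)
    fix r :: real assume r: "0 \<le> r"
    have "\<forall>\<^sub>F m in sequentially. (\<Sum>k\<le>DIM('a). ?L k r * measure lebesgue (PB m + (\<lambda>x. real k *\<^sub>R x) ` PA m))
       = measure lebesgue (PB m + (\<lambda>x. r *\<^sub>R x) ` PA m)"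
      using ev by eventually_elim (use r in \<open>simp add: volume_interpolates_def\<close>)
    moreover have "(\<lambda>m. \<Sum>k\<le>DIM('a). ?L k r * measure lebesgue (PB m + (\<lambda>x. real k *\<^sub>R x) ` PA m))
       \<longlonglongrightarrow> (\<Sum>k\<le>DIM('a). ?L k r * measure lebesgue (B + (\<lambda>x. real k *\<^sub>R x) ` A))"
      by (intro tendsto_intros lim)
    ultimately have "(\<lambda>m. measure lebesgue (PB m + (\<lambda>x. r *\<^sub>R x) ` PA m))
       \<longlonglongrightarrow> (\<Sum>k\<le>DIM('a). ?L k r * measure lebesgue (B + (\<lambda>x. real k *\<^sub>R x) ` A))"
      by (rule Lim_transform_eventually [rotated])
    with lim show "measure lebesgue (B + (\<lambda>x. r *\<^sub>R x) ` A) =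
      (\<Sum>k\<le>DIM('a). ?L k r * measure lebesgue (B + (\<lambda>x. real k *\<^sub>R x) ` A))"
      by (rule LIMSEQ_unique)
  qed
qed

text \<open>Translated so that it contains 0, \<open>B\<close> has decreasing dilates by 1/(k + 1),
  and by compactness the sums shrink to \<open>A\<close>. This covers the coefficient 0 in front of
  \<open>B\<close>, where it cannot be factored out of the Minkowski sum.\<close>

lemma measure_add_shrinking:
  fixes A B :: "'a::euclidean_space set"
  assumes A: "convex_body A" and B: "convex_body B"
  shows "(\<lambda>k. measure lebesgue (A + (\<lambda>x. (1 / real (Suc k)) *\<^sub>R x) ` B)) \<longlonglongrightarrow> measure lebesgue A"
proof -
  obtain b where b: "b \<in> B" using B by (auto simp: convex_body_def)
  define C where "C = (\<lambda>x. x - b) ` B"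
  have C: "compact C" "convex C" "0 \<in> C"
    using B b by (auto simp: C_def convex_body_def compact_translation_subtract image_iff convex_translation_subtract)
  let ?s = "\<lambda>k x. (1 / real (Suc k)) *\<^sub>R (x::'a)"
  define D where "D k = A + ?s k ` C" for k
  have D: "compact (D k)" for k
    using A C unfolding D_def convex_body_def by (intro compact_convex_set_plus_scale) auto
  have "A + ?s k ` B = (\<lambda>x. ?s k b + x) ` D k" for k
    by (auto simp: D_def C_def set_plus_def image_iff scaleR_diff_right algebra_simps)
      (metis diff_add_cancel)+
  then have eq: "measure lebesgue (A + ?s k ` B) = measure lebesgue (D k)" for k
    by (simp only: measure_translation)
  have "?s j ` C \<subseteq> ?s i ` C" if "i \<le> j" for i j
  proof clarify
    fix c assume "c \<in> C"
    then have "(real (Suc i) / real (Suc j)) *\<^sub>R c \<in> C"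
      using C that convexD_alt [of C 0 c "real (Suc i) / real (Suc j)"] by simp
    moreover have "?s j c = ?s i ((real (Suc i) / real (Suc j)) *\<^sub>R c)" by simp
    ultimately show "?s j c \<in> ?s i ` C" by blast
  qed
  then have "decseq D" unfolding decseq_def D_def by (intro allI impI set_plus_mono2) auto
  then have "(\<lambda>k. measure lebesgue (D k)) \<longlonglongrightarrow> measure lebesgue (\<Inter>k. D k)"
    using D lmeasurable_compact by (intro Lim_measure_decseq) (auto simp: borel_compact fmeasurable_def less_top)
  moreover have "(\<Inter>k. D k) = A"
  proof (intro equalityI subsetI INT_I)
    fix x k assume "x \<in> A"
    then have "x + ?s k 0 \<in> D k" unfolding D_def using C by blast
    then show "x \<in> D k" by simp
  next
    fix x assume "x \<in> (\<Inter>k. D k)"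
    then have "\<forall>k. \<exists>a\<in>A. \<exists>c\<in>C. x = a + ?s k c" by (force simp: D_def elim!: set_plus_elim)
    then obtain a c where ac: "\<And>k. a k \<in> A" "\<And>k. c k \<in> C" "\<And>k. x = a k + ?s k (c k)" by metis
    obtain M where M: "\<And>z. z \<in> C \<Longrightarrow> norm z \<le> M" using C compact_imp_bounded bounded_iff by metis
    have "(\<lambda>k. ?s k (c k)) \<longlonglongrightarrow> 0"
    proof (rule Lim_null_comparison)
      show "\<forall>\<^sub>F k in sequentially. norm (?s k (c k)) \<le> M * inverse (real (Suc k))"
        using mult_right_mono [OF M [OF ac(2)], of "inverse (real (Suc _))"]
        by (auto simp: divide_inverse mult.commute)
      show "(\<lambda>k. M * inverse (real (Suc k))) \<longlonglongrightarrow> 0"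
        by (rule tendsto_mult_right_zero [OF LIMSEQ_inverse_real_of_nat])
    qed
    then have "(\<lambda>k. x - ?s k (c k)) \<longlonglongrightarrow> x - 0" by (intro tendsto_intros)
    moreover have "x - ?s k (c k) = a k" for k using ac(3) [of k] by (metis add_diff_cancel_right')
    ultimately have "a \<longlonglongrightarrow> x" by simp
    then show "x \<in> A" using A ac(1) unfolding convex_body_def
      by (metis closed_sequentially compact_imp_closed)
  qed
  ultimately show ?thesis by (simp only: eq)
qed

lemma poly_eq_sum_bound:
  fixes p :: "real poly"
  shows "degree p \<le> N \<Longrightarrow> poly p x = (\<Sum>j\<le>N. coeff p j * x ^ j)"
  unfolding poly_altdef by (intro sum.mono_neutral_left) (auto simp: coeff_eq_0)

theorem volume_polynomial:
  fixes A B :: "'a::euclidean_space set"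
  assumes A: "convex_body A" and B: "convex_body B" and int: "interior B \<noteq> {}"
  obtains c where "\<And>a b. 0 \<le> a \<Longrightarrow> 0 \<le> b \<Longrightarrow>
    measure lebesgue ((\<lambda>x. a *\<^sub>R x) ` A + (\<lambda>x. b *\<^sub>R x) ` B) = (\<Sum>j\<le>DIM('a). c j * a ^ j * b ^ (DIM('a) - j))"
proof -
  let ?N = "DIM('a)"
  let ?m = "\<lambda>r. measure lebesgue (B + (\<lambda>x. r *\<^sub>R x) ` A)"
  define c where "c j = (\<Sum>k\<le>?N. coeff (lagrange_basis ?N k) j * ?m (real k))" for j
  have one: "?m r = (\<Sum>j\<le>?N. c j * r ^ j)" if "0 \<le> r" for r
  proof -
    have "?m r = (\<Sum>k\<le>?N. poly (lagrange_basis ?N k) r * ?m (real k))"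
      using volume_interpolates_convex_body [OF assms] that unfolding volume_interpolates_def by blast
    also have "\<dots> = (\<Sum>k\<le>?N. (\<Sum>j\<le>?N. coeff (lagrange_basis ?N k) j * r ^ j) * ?m (real k))"
      by (intro sum.cong refl arg_cong2 [of _ _ _ _ "(*)"] poly_eq_sum_bound degree_lagrange_basis) auto
    also have "\<dots> = (\<Sum>j\<le>?N. c j * r ^ j)"
      unfolding c_def sum_distrib_right by (subst sum.swap) (simp add: mult_ac)
    finally show ?thesis .
  qed
  have pos: "measure lebesgue ((\<lambda>x. a *\<^sub>R x) ` A + (\<lambda>x. b *\<^sub>R x) ` B) = (\<Sum>j\<le>?N. c j * a ^ j * b ^ (?N - j))"
    if "0 \<le> a" "0 < b" for a b
  proof -
    \<comment> \<open>Homogeneity: factoring out \<open>b\<close> leaves the one-parameter family at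
      \<open>a / b\<close>.\<close>
    have "(\<lambda>x. a *\<^sub>R x) ` A + (\<lambda>x. b *\<^sub>R x) ` B = (\<lambda>x. b *\<^sub>R x) ` (B + (\<lambda>x. (a / b) *\<^sub>R x) ` A)"
      using that by (subst linear_image_set_plus) (auto simp: image_image add.commute linear_scaleR)
    then have "measure lebesgue ((\<lambda>x. a *\<^sub>R x) ` A + (\<lambda>x. b *\<^sub>R x) ` B) = b ^ ?N * ?m (a / b)"
      using measure_lebesgue_affine [of b 0 "B + (\<lambda>x. (a / b) *\<^sub>R x) ` A"] that by simp
    also have "\<dots> = (\<Sum>j\<le>?N. b ^ ?N * (c j * (a / b) ^ j))"
      using that by (subst one) (auto simp: sum_distrib_left)
    also have "\<dots> = (\<Sum>j\<le>?N. c j * a ^ j * b ^ (?N - j))"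
      using that by (intro sum.cong refl) (simp add: power_divide power_diff)
    finally show ?thesis .
  qed
  have zero: "measure lebesgue ((\<lambda>x. a *\<^sub>R x) ` A + (\<lambda>x. 0 *\<^sub>R x) ` B) = (\<Sum>j\<le>?N. c j * a ^ j * 0 ^ (?N - j))"
    if "0 \<le> a" for a
  proof -
    let ?A = "(\<lambda>x. a *\<^sub>R x) ` A"
    have "convex_body ?A" using A by (auto simp: convex_body_def compact_scaling convex_scaling)
    then have "(\<lambda>k. measure lebesgue (?A + (\<lambda>x. (1 / real (Suc k)) *\<^sub>R x) ` B)) \<longlonglongrightarrow> measure lebesgue ?A"
      by (rule measure_add_shrinking [OF _ B])
    moreover have "?A + (\<lambda>x. 0 *\<^sub>R x) ` B = ?A" using B by (auto simp: set_plus_def convex_body_def)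
    ultimately have "(\<lambda>k. \<Sum>j\<le>?N. c j * a ^ j * (1 / real (Suc k)) ^ (?N - j)) \<longlonglongrightarrow>
       measure lebesgue (?A + (\<lambda>x. 0 *\<^sub>R x) ` B)"
      using that by (subst (asm) pos) auto
    moreover have "(\<lambda>k. \<Sum>j\<le>?N. c j * a ^ j * (1 / real (Suc k)) ^ (?N - j)) \<longlonglongrightarrow>
      (\<Sum>j\<le>?N. c j * a ^ j * 0 ^ (?N - j))"
      using LIMSEQ_inverse_real_of_nat by (intro tendsto_intros) (simp add: inverse_eq_divide)
    ultimately show ?thesis by (rule LIMSEQ_unique)
  qed
  show thesis
  proof (rule that [of c])
    fix a b :: real assume ab: "0 \<le> a" "0 \<le> b"
    show "measure lebesgue ((\<lambda>x. a *\<^sub>R x) ` A + (\<lambda>x. b *\<^sub>R x) ` B) = (\<Sum>j\<le>?N. c j * a ^ j * b ^ (?N - j))"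
    proof (cases "b = 0")
      case True
      show ?thesis unfolding True by (rule zero [OF ab(1)])
    next
      case False
      with ab show ?thesis by (intro pos) auto
    qed
  qed
qed

section \<open>Mixed volumes of two bodies\<close>

text \<open>Convexity is what keeps the left side from being larger: \<open>a x + b y\<close> is
  \<open>a + b\<close> times a convex combination of \<open>x\<close> and \<open>y\<close>.\<close>

lemma scale_add_convex:
  fixes A :: "'a::real_vector set"
  assumes "convex A" "0 \<le> a" "0 \<le> b"
  shows "(\<lambda>x. a *\<^sub>R x) ` A + (\<lambda>x. b *\<^sub>R x) ` A = (\<lambda>x. (a + b) *\<^sub>R x) ` A"
proof (intro equalityI subsetI)
  fix z assume "z \<in> (\<lambda>x. a *\<^sub>R x) ` A + (\<lambda>x. b *\<^sub>R x) ` A"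
  then obtain x y where xy: "x \<in> A" "y \<in> A" "z = a *\<^sub>R x + b *\<^sub>R y" by (auto elim!: set_plus_elim)
  show "z \<in> (\<lambda>x. (a + b) *\<^sub>R x) ` A"
  proof (cases "a + b = 0")
    case True
    then have "a = 0" "b = 0" using assms by auto
    then show ?thesis using xy by auto
  next
    case False
    then have pos: "0 < a + b" using assms by simp
    then have "(a / (a + b)) *\<^sub>R x + (b / (a + b)) *\<^sub>R y \<in> A"
      using assms xy by (intro convexD) (auto simp: add_divide_distrib [symmetric])
    moreover have "z = (a + b) *\<^sub>R ((a / (a + b)) *\<^sub>R x + (b / (a + b)) *\<^sub>R y)"
      using pos xy by (simp add: scaleR_add_right)
    ultimately show ?thesis by blast
  qed
qed (auto simp: scaleR_add_left)

lemma sum_scale_convex: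
  fixes A :: "'a::real_vector set"
  assumes "convex A" "A \<noteq> {}" "finite I" "\<And>i. i \<in> I \<Longrightarrow> 0 \<le> t i"
  shows "(\<Sum>i\<in>I. (\<lambda>x. t i *\<^sub>R x) ` A) = (\<lambda>x. (\<Sum>i\<in>I. t i) *\<^sub>R x) ` A"
  using assms(3,4)
proof (induction rule: finite_induct)
  case empty
  then show ?case using assms(2) by (auto simp: set_zero)
next
  case (insert i I)
  then show ?case using scale_add_convex [OF assms(1), of "t i" "sum t I"] by (simp add: sum_nonneg)
qed

lemma minkowski_combination_two:
  fixes A B :: "'a::euclidean_space set"
  assumes "convex_body A" "convex_body B" "\<And>i. 0 \<le> t i" "j \<le> N"
  shows "minkowski_combination (replicate j A @ replicate (N - j) B) t =
    (\<lambda>x. (\<Sum>i<j. t i) *\<^sub>R x) ` A + (\<lambda>x. (\<Sum>i=j..<N. t i) *\<^sub>R x) ` B"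
proof -
  let ?Ks = "replicate j A @ replicate (N - j) B"
  have "{..<N} = {..<j} \<union> {j..<N}" using assms by auto
  then have "minkowski_combination ?Ks t =
    (\<Sum>i<j. (\<lambda>x. t i *\<^sub>R x) ` (?Ks ! i)) + (\<Sum>i=j..<N. (\<lambda>x. t i *\<^sub>R x) ` (?Ks ! i))"
    using assms by (simp add: minkowski_combination_def) (subst sum.union_disjoint, auto)
  also have "\<dots> = (\<Sum>i<j. (\<lambda>x. t i *\<^sub>R x) ` A) + (\<Sum>i=j..<N. (\<lambda>x. t i *\<^sub>R x) ` B)"
    by (intro arg_cong2 [of _ _ _ _ "(+)"] sum.cong refl) (auto simp: nth_append)
  finally show ?thesis
    using assms by (simp add: convex_body_def sum_scale_convex)
qed

text \<open>Typically \<open>P\<close> is a polynomial that continues the function to negative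
  \<open>s\<close>, so an ordinary derivative yields the one-sided one.\<close>

lemma partial_deriv_eqI:
  assumes "t i = 0" "\<And>s. 0 \<le> s \<Longrightarrow> f (t(i := s)) = P s" "(P has_real_derivative d) (at 0)"
  shows "partial_deriv i f t = d"
proof -
  have "(P has_vector_derivative d) (at 0 within {0..})"
    using assms(3) has_real_derivative_iff_has_vector_derivative has_vector_derivative_at_within by blast
  then have "((\<lambda>s. f (t(i := s))) has_vector_derivative d) (at 0 within {0..})"
    by (rule has_vector_derivative_transform [rotated 2]) (use assms(2) in auto)
  moreover have "at (0::real) within {0..} \<noteq> bot"
    by (simp add: at_within_Ici_at_right)
  ultimately show ?thesis
    unfolding partial_deriv_def assms(1) by (intro vector_derivative_within) auto
qed

text \<open>The fold differentiates in the last variable first. \<open>upper\<close> treats the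
  variables belonging to the second body, whose derivatives at 0 single out the term k = j;
  \<open>lower\<close> then differentiates the remaining power of the sum over the first j
  variables.\<close>

lemma iterated_partial_deriv:
  fixes F :: "(nat \<Rightarrow> real) \<Rightarrow> real"
  assumes jN: "j \<le> N"
    and F: "\<And>t. (\<And>i. 0 \<le> t i) \<Longrightarrow> F t = (\<Sum>k\<le>N. c k * (\<Sum>i<j. t i) ^ k * (\<Sum>i=j..<N. t i) ^ (N - k))"
  shows "foldr partial_deriv [0..<N] F (\<lambda>_. 0) = c j * fact j * fact (N - j)"
proof -
  \<comment> \<open>What the derivatives in the variables N - 1, ..., m leave as the factor of the
    power with exponent \<open>m - k\<close>. It has to be 0 for k > m, since the truncated exponent
    would otherwise keep a constant.\<close>
  define d :: "nat \<Rightarrow> nat \<Rightarrow> real" where "d m k = (if k \<le> m then fact (N - k) / fact (m - k) else 0)" for m k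
  have upper: "foldr partial_deriv [m..<N] F t =
      (\<Sum>k\<le>N. c k * (\<Sum>i<j. t i) ^ k * (d m k * (\<Sum>i=j..<m. t i) ^ (m - k)))"
    if "m \<le> N" "j \<le> m" "\<And>i. 0 \<le> t i" "\<And>i. m \<le> i \<Longrightarrow> t i = 0" for m t
    using that
  proof (induction arbitrary: t rule: inc_induct)
    case base
    then show ?case using jN by (auto simp: F d_def intro!: sum.cong)
  next
    case (step m)
    have upt: "[m..<N] = m # [Suc m..<N]" using step.hyps by (simp add: upt_conv_Cons)
    let ?a = "\<Sum>i<j. t i" and ?b = "\<Sum>i=j..<m. t i"
    have "foldr partial_deriv [Suc m..<N] F (t(m := s)) =
       (\<Sum>k\<le>N. c k * ?a ^ k * (d (Suc m) k * (?b + s) ^ (Suc m - k)))" if "0 \<le> s" for s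
    proof -
      have "(\<Sum>i<j. (t(m := s)) i) = ?a" using step.prems by (intro sum.cong) auto
      moreover have "(\<Sum>i=j..<Suc m. (t(m := s)) i) = ?b + s" using step.prems by simp
      ultimately show ?thesis
        using step.prems that by (subst step.IH) auto
    qed
    moreover have "((\<lambda>s. \<Sum>k\<le>N. c k * ?a ^ k * (d (Suc m) k * (?b + s) ^ (Suc m - k))) has_real_derivative
       (\<Sum>k\<le>N. c k * ?a ^ k * (d m k * ?b ^ (m - k)))) (at 0)"
    proof (intro DERIV_sum DERIV_cmult)
      fix k
      have "d m k = d (Suc m) k * real (Suc m - k)"
        by (auto simp: d_def Suc_diff_le le_Suc_eq)
      then show "((\<lambda>s. d (Suc m) k * (?b + s) ^ (Suc m - k)) has_real_derivative d m k * ?b ^ (m - k)) (at 0)"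
        by (auto intro!: derivative_eq_intros)
    qed
    ultimately show ?case unfolding upt foldr.simps o_apply
      using step.prems by (intro partial_deriv_eqI) auto
  qed
  have lower: "foldr partial_deriv [m..<N] F t = c j * fact j / fact m * fact (N - j) * (\<Sum>i<m. t i) ^ m"
    if "m \<le> j" "\<And>i. 0 \<le> t i" "\<And>i. m \<le> i \<Longrightarrow> t i = 0" for m t
    using that
  proof (induction arbitrary: t rule: inc_induct)
    case base
    \<comment> \<open>At m = j the sum over the second group is empty. Terms with k < j vanish as
      positive powers of 0, and those with k > j because \<open>d j k\<close> is 0.\<close>
    have "c k * (\<Sum>i<j. t i) ^ k * (d j k * 0 ^ (j - k)) =
        (if k = j then c j * fact j / fact j * fact (N - j) * (\<Sum>i<j. t i) ^ j else 0)" for k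
      by (auto simp: d_def)
    then show ?case using base jN upper [of j t] by simp
  next
    case (step m)
    have upt: "[m..<N] = m # [Suc m..<N]" using step.hyps jN by (simp add: upt_conv_Cons)
    let ?a = "\<Sum>i<m. t i"
    have "foldr partial_deriv [Suc m..<N] F (t(m := s)) =
       c j * fact j / fact (Suc m) * fact (N - j) * (?a + s) ^ Suc m" if "0 \<le> s" for s
      using step.prems that by (subst step.IH) auto
    moreover have "((\<lambda>s. c j * fact j / fact (Suc m) * fact (N - j) * (?a + s) ^ Suc m) has_real_derivative
       c j * fact j / fact m * fact (N - j) * ?a ^ m) (at 0)"
    proof -
      have fs: "(fact (Suc m) :: real) = real (Suc m) * fact m" by simp
      show ?thesis unfolding fs
        by (auto intro!: derivative_eq_intros simp del: power_Suc of_nat_Suc)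
    qed
    ultimately show ?case unfolding upt foldr.simps o_apply
      using step.prems by (intro partial_deriv_eqI) auto
  qed
  show ?thesis using lower [of 0 "\<lambda>_. 0"] by simp
qed

lemma mixed_volume_two:
  fixes A B :: "'a::euclidean_space set"
  assumes "convex_body A" "convex_body B" "j \<le> DIM('a)"
    and vol: "\<And>a b. 0 \<le> a \<Longrightarrow> 0 \<le> b \<Longrightarrow>
      measure lebesgue ((\<lambda>x. a *\<^sub>R x) ` A + (\<lambda>x. b *\<^sub>R x) ` B) = (\<Sum>k\<le>DIM('a). c k * a ^ k * b ^ (DIM('a) - k))"
  shows "mixed_volume (replicate j A @ replicate (DIM('a) - j) B) = c j * fact j * fact (DIM('a) - j) / fact DIM('a)"
proof -
  have "length (replicate j A @ replicate (DIM('a) - j) B) = DIM('a)" using assms by simp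
  moreover have "foldr partial_deriv [0..<DIM('a)]
      (\<lambda>t. measure lebesgue (minkowski_combination (replicate j A @ replicate (DIM('a) - j) B) t)) (\<lambda>_. 0)
    = c j * fact j * fact (DIM('a) - j)"
    using assms by (intro iterated_partial_deriv) (auto simp: minkowski_combination_two vol sum_nonneg)
  ultimately show ?thesis by (simp add: mixed_volume_def)
qed

section \<open>Integration on Cartesian powers\<close>

lemma measurable_vec_lambda_PiM [measurable]:
  "(\<lambda>f. \<chi> i. f i) \<in> (\<Pi>\<^sub>M i\<in>(UNIV::'p::finite set). borel :: 'a::euclidean_space measure) \<rightarrow>\<^sub>M (borel :: ('a^'p) measure)"
proof (rule borel_measurable_euclidean_space [THEN iffD2], intro ballI)
  fix b :: "'a^'p" assume "b \<in> Basis"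
  then obtain i u where b: "b = axis i u" by (auto simp: Basis_vec_def)
  show "(\<lambda>f. (\<chi> i. f i) \<bullet> b) \<in> borel_measurable (\<Pi>\<^sub>M i\<in>UNIV. borel)"
    unfolding b by (simp add: inner_axis)
qed

lemma prod_Basis_vec:
  "(\<Prod>b\<in>(Basis :: ('a::euclidean_space^'p) set). f b) = (\<Prod>i\<in>UNIV. \<Prod>u\<in>Basis. f (axis i u))"
proof -
  have eq: "Basis = (\<lambda>(i, u). axis i u) ` (UNIV \<times> (Basis :: 'a set))"
    by (auto simp: Basis_vec_def)
  have inj: "inj_on (\<lambda>(i, u). axis i u) (UNIV \<times> (Basis :: 'a set))"
    by (auto simp: inj_on_def axis_eq_axis)
  show ?thesis
    by (subst eq, subst prod.reindex [OF inj]) (simp add: prod.cartesian_product split_def)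
qed

lemma distr_vec_lambda:
  "distr (\<Pi>\<^sub>M i\<in>(UNIV::'p::finite set). lborel) borel (\<lambda>f. \<chi> i. f i) = (lborel :: ('a::euclidean_space^'p) measure)"
proof (rule lborel_eqI [symmetric])
  interpret product_sigma_finite "\<lambda>_::'p. lborel :: 'a measure" ..
  have sets: "sets (\<Pi>\<^sub>M i\<in>(UNIV::'p set). lborel :: 'a measure) = sets (\<Pi>\<^sub>M i\<in>(UNIV::'p set). borel)"
    by (intro sets_PiM_cong) auto
  fix l u :: "'a^'p" assume lu: "\<And>b. b \<in> Basis \<Longrightarrow> l \<bullet> b \<le> u \<bullet> b"
  have lu': "l $ i \<bullet> b \<le> u $ i \<bullet> b" if "b \<in> Basis" for i b
    using lu [of "axis i b"] that by (auto simp: Basis_vec_def inner_axis)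
  have meas: "(\<lambda>f. \<chi> i. f i) \<in> (\<Pi>\<^sub>M i\<in>(UNIV::'p set). lborel :: 'a measure) \<rightarrow>\<^sub>M borel"
    using measurable_vec_lambda_PiM measurable_cong_sets [OF sets refl] by blast
  have "(\<lambda>f. \<chi> i. f i) -` box l u \<inter> space (\<Pi>\<^sub>M i\<in>(UNIV::'p set). lborel) = (\<Pi>\<^sub>E i\<in>UNIV. box (l $ i) (u $ i))"
    by (auto simp: space_PiM mem_box Basis_vec_def inner_axis PiE_def Pi_def extensional_def)
  then have "emeasure (distr (\<Pi>\<^sub>M i\<in>(UNIV::'p set). lborel) borel (\<lambda>f. \<chi> i. f i)) (box l u) =
      (\<Prod>i\<in>UNIV. emeasure lborel (box (l $ i) (u $ i)))"
    using meas by (simp add: emeasure_distr emeasure_PiM)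
  also have "\<dots> = ennreal (\<Prod>b\<in>Basis. (u - l) \<bullet> b)"
    using lu' by (simp add: emeasure_lborel_box prod_Basis_vec inner_axis prod_ennreal prod_nonneg inner_diff_left)
  finally show "emeasure (distr (\<Pi>\<^sub>M i\<in>(UNIV::'p set). lborel) borel (\<lambda>f. \<chi> i. f i)) (box l u) = \<dots>" .
qed simp

lemma emeasure_cart_power:
  fixes S :: "'a::euclidean_space set"
  assumes "S \<in> sets borel"
  shows "emeasure lborel (cart_power S :: ('a^'p) set) = emeasure lborel S ^ CARD('p)"
    and "(cart_power S :: ('a^'p) set) \<in> sets borel"
proof -
  interpret product_sigma_finite "\<lambda>_::'p. lborel :: 'a measure" ..
  have sets: "sets (\<Pi>\<^sub>M i\<in>(UNIV::'p set). lborel :: 'a measure) = sets (\<Pi>\<^sub>M i\<in>(UNIV::'p set). borel)"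
    by (intro sets_PiM_cong) auto
  have meas: "(\<lambda>f. \<chi> i. f i) \<in> (\<Pi>\<^sub>M i\<in>(UNIV::'p set). lborel :: 'a measure) \<rightarrow>\<^sub>M borel"
    using measurable_vec_lambda_PiM measurable_cong_sets [OF sets refl] by blast
  have eq: "cart_power S = (\<Inter>i. (\<lambda>x::'a^'p. x $ i) -` S)" by (auto simp: cart_power_def)
  have "(\<lambda>x::'a^'p. x $ i) \<in> borel_measurable borel" for i
    by (intro borel_measurable_continuous_onI continuous_intros)
  from measurable_sets [OF this assms] have "(\<lambda>x::'a^'p. x $ i) -` S \<in> sets borel" for i
    by simp
  then show S: "(cart_power S :: ('a^'p) set) \<in> sets borel"
    unfolding eq by (intro sets.finite_INT) auto
  have "(\<lambda>f. \<chi> i. f i) -` (cart_power S :: ('a^'p) set) \<inter> space (\<Pi>\<^sub>M i\<in>(UNIV::'p set). lborel) = (\<Pi>\<^sub>E i\<in>UNIV. S)"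
    by (auto simp: space_PiM cart_power_def PiE_def Pi_def extensional_def)
  then have "emeasure (distr (\<Pi>\<^sub>M i\<in>(UNIV::'p set). lborel) borel (\<lambda>f. \<chi> i. f i)) (cart_power S :: ('a^'p) set)
     = emeasure lborel S ^ CARD('p)"
    using meas S assms by (simp add: emeasure_distr emeasure_PiM)
  then show "emeasure lborel (cart_power S :: ('a^'p) set) = emeasure lborel S ^ CARD('p)"
    by (simp add: distr_vec_lambda)
qed

section \<open>Gamma integrals and iterated integration\<close>

lemma nn_integral_power_exp:
  assumes "0 < (y::real)"
  shows "(\<integral>\<^sup>+s. ennreal (s ^ k * exp (- y * s)) * indicator {0..} s \<partial>lborel) = ennreal (fact k / y ^ Suc k)"
proof -
  have "(\<integral>\<^sup>+s. ennreal (s ^ k * exp (- y * s)) * indicator {0..} s \<partial>lborel) =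
    ennreal \<bar>1 / y\<bar> * (\<integral>\<^sup>+x. ennreal ((0 + 1 / y * x) ^ k * exp (- y * (0 + 1 / y * x))) * indicator {0..} (0 + 1 / y * x) \<partial>lborel)"
    using assms by (intro nn_integral_real_affine) auto
  also have "(\<integral>\<^sup>+x. ennreal ((0 + 1 / y * x) ^ k * exp (- y * (0 + 1 / y * x))) * indicator {0..} (0 + 1 / y * x) \<partial>lborel)
    = (\<integral>\<^sup>+x. ennreal (1 / y ^ k) * (ennreal (x ^ k * exp (- x)) * indicator {0..} x) \<partial>lborel)"
    using assms
    by (intro nn_integral_cong)
      (auto simp: indicator_def power_divide ennreal_mult' [symmetric] zero_le_divide_iff split: if_splits)
  also have "\<dots> = ennreal (1 / y ^ k) * ennreal (fact k)"
    by (subst nn_integral_cmult) (auto simp: nn_intergal_power_times_exp_Ici)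
  finally show ?thesis
    using assms by (simp add: ennreal_mult' [symmetric] field_simps)
qed

lemma has_bochner_integral_power_exp:
  assumes "0 < (y::real)"
  shows "has_bochner_integral lborel (\<lambda>s. indicator {0..} s * (s ^ k * exp (- y * s))) (fact k / y ^ Suc k)"
proof (rule has_bochner_integral_nn_integral)
  show "(\<integral>\<^sup>+s. ennreal (indicator {0..} s * (s ^ k * exp (- y * s))) \<partial>lborel) = ennreal (fact k / y ^ Suc k)"
    unfolding nn_integral_power_exp [OF assms, of k, symmetric]
    by (intro nn_integral_cong) (auto simp: indicator_def)
qed (use assms in \<open>auto simp: indicator_def\<close>)

text \<open>The coefficients may be negative, so the nonnegative integral cannot be split into its
  terms. The detour through the Bochner integral requires only that the whole sum be
  nonnegative.\<close>

lemma nn_integral_sum_power_exp: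
  assumes "0 < (y::real)" and nn: "\<And>s. 0 \<le> s \<Longrightarrow> 0 \<le> (\<Sum>i\<in>I. c i * s ^ k i)"
  shows "(\<integral>\<^sup>+s. indicator {0..} s * ennreal (exp (- y * s) * (\<Sum>i\<in>I. c i * s ^ k i)) \<partial>lborel) =
      ennreal (\<Sum>i\<in>I. c i * (fact (k i) / y ^ Suc (k i)))"
    and "0 \<le> (\<Sum>i\<in>I. c i * (fact (k i) / y ^ Suc (k i)))"
proof -
  let ?f = "\<lambda>s. \<Sum>i\<in>I. c i * (indicator {0..} s * (s ^ k i * exp (- y * s)))"
  have hb: "has_bochner_integral lborel ?f (\<Sum>i\<in>I. c i * (fact (k i) / y ^ Suc (k i)))"
    by (intro has_bochner_integral_sum has_bochner_integral_mult_right has_bochner_integral_power_exp assms)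
  have eq: "?f s = indicator {0..} s * (exp (- y * s) * (\<Sum>i\<in>I. c i * s ^ k i))" for s
    by (simp add: sum_distrib_left mult_ac)
  have nonneg: "0 \<le> ?f s" for s unfolding eq using nn by (auto simp: indicator_def)
  have "(\<integral>\<^sup>+s. indicator {0..} s * ennreal (exp (- y * s) * (\<Sum>i\<in>I. c i * s ^ k i)) \<partial>lborel) = (\<integral>\<^sup>+s. ennreal (?f s) \<partial>lborel)"
    unfolding eq by (intro nn_integral_cong) (auto simp: indicator_def)
  also have "\<dots> = ennreal (integral\<^sup>L lborel ?f)"
    using hb nonneg by (intro nn_integral_eq_integral) (auto simp: has_bochner_integral_iff)
  finally show "(\<integral>\<^sup>+s. indicator {0..} s * ennreal (exp (- y * s) * (\<Sum>i\<in>I. c i * s ^ k i)) \<partial>lborel) =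
      ennreal (\<Sum>i\<in>I. c i * (fact (k i) / y ^ Suc (k i)))"
    using hb by (simp add: has_bochner_integral_iff)
  show "0 \<le> (\<Sum>i\<in>I. c i * (fact (k i) / y ^ Suc (k i)))"
    using hb nonneg by (metis (no_types, lifting) has_bochner_integral_integral_eq Bochner_Integration.integral_nonneg)
qed

lemma nn_integral_lborel_triple:
  fixes f :: "real \<times> real \<times> 'b::euclidean_space \<Rightarrow> ennreal"
  assumes [measurable]: "f \<in> borel_measurable borel"
  shows "(\<integral>\<^sup>+q. f q \<partial>lborel) = (\<integral>\<^sup>+a. \<integral>\<^sup>+b. \<integral>\<^sup>+z. f (a, b, z) \<partial>lborel \<partial>lborel \<partial>lborel)"
proof -
  have "(\<integral>\<^sup>+q. f q \<partial>lborel) = (\<integral>\<^sup>+a. \<integral>\<^sup>+q. f (a, q) \<partial>lborel \<partial>lborel)"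
    by (subst lborel_prod [symmetric], subst lborel.nn_integral_fst [symmetric])
      (simp_all add: lborel_prod)
  also have "\<dots> = (\<integral>\<^sup>+a. \<integral>\<^sup>+b. \<integral>\<^sup>+z. f (a, b, z) \<partial>lborel \<partial>lborel \<partial>lborel)"
  proof (rule nn_integral_cong)
    fix a :: real
    have "(\<lambda>q. f (a, q)) \<in> borel_measurable (lborel \<Otimes>\<^sub>M lborel)"
      unfolding lborel_prod by measurable
    then show "(\<integral>\<^sup>+q. f (a, q) \<partial>lborel) = (\<integral>\<^sup>+b. \<integral>\<^sup>+z. f (a, b, z) \<partial>lborel \<partial>lborel)"
      by (subst lborel_prod [symmetric], subst lborel.nn_integral_fst [symmetric]) simp_all
  qed
  finally show ?thesis .
qed

section \<open>The cone inequality\<close>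

definition join_cone :: "'a::euclidean_space set \<Rightarrow> (real \<times> real \<times> ('a^'p)) set" where
  "join_cone K = {(a, b, z). 0 \<le> a \<and> 0 \<le> b \<and> (\<exists>x\<in>cart_power K. \<exists>v\<in>K. z = a *\<^sub>R x - b *\<^sub>R diag_emb v)}"

definition join_fibre :: "'a::euclidean_space set \<Rightarrow> real \<times> real \<times> ('a^'p) \<Rightarrow> 'a set" where
  "join_fibre K = (\<lambda>(a, b, z). {v. 0 \<le> a \<and> 0 \<le> b \<and> v \<in> (\<lambda>x. b *\<^sub>R x) ` K \<and>
     (\<forall>i. z $ i + v \<in> (\<lambda>x. a *\<^sub>R x) ` K)})"

text \<open>The density is the derivative of \<open>\<mu> ^ n\<close>, so the integral is at most
  \<open>s ^ n\<close> for the largest admissible \<open>s\<close>. An integral instead of a maximum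
  allows exchanging the order of integration and translating \<open>q\<close>.\<close>

definition fibre_bound :: "'a::euclidean_space set \<Rightarrow> real \<times> real \<times> ('a^'p) \<Rightarrow> ennreal" where
  "fibre_bound K q = emeasure lborel K *
     (\<integral>\<^sup>+\<mu>. indicator {0..} \<mu> * ennreal (real DIM('a) * \<mu> ^ (DIM('a) - 1)) * indicator (join_cone K) (q - (\<mu>, \<mu>, 0)) \<partial>lborel)"

section \<open>Closedness, compactness and convexity of cone and fibres\<close>

lemma diag_emb_nth [simp]: "diag_emb x $ i = x" by (simp add: diag_emb_def)

lemma linear_diag_emb: "linear (diag_emb :: 'a::euclidean_space \<Rightarrow> 'a^'p)"
  by (auto intro!: linearI simp: diag_emb_def vec_eq_iff)

lemma continuous_on_diag_emb [continuous_intros]: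
  "continuous_on S f \<Longrightarrow> continuous_on S (\<lambda>x. diag_emb (f x) :: 'a::euclidean_space^'p)"
  unfolding diag_emb_def by (intro continuous_intros)

lemma compact_cart_power:
  fixes K :: "'a::euclidean_space set"
  assumes "compact K"
  shows "compact (cart_power K :: ('a^'p) set)"
proof -
  have "closed (cart_power K :: ('a^'p) set)"
    unfolding cart_power_def using compact_imp_closed [OF assms]
    by (intro closed_Collect_all) (auto intro!: closed_vimage [of K "\<lambda>x. x $ _", unfolded vimage_def] continuous_intros)
  moreover obtain M where M: "\<And>z. z \<in> K \<Longrightarrow> norm z \<le> M"
    using assms compact_imp_bounded bounded_iff by metis
  have "norm x \<le> real CARD('p) * M" if "x \<in> (cart_power K :: ('a^'p) set)" for x
  proof -
    have "norm x \<le> (\<Sum>i\<in>UNIV. norm (x $ i))" unfolding norm_vec_def by (rule L2_set_le_sum) simp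
    also have "\<dots> \<le> (\<Sum>i\<in>(UNIV::'p set). M)" using that M by (intro sum_mono) (auto simp: cart_power_def)
    finally show ?thesis by simp
  qed
  then have "bounded (cart_power K :: ('a^'p) set)" unfolding bounded_iff by blast
  ultimately show ?thesis by (simp add: compact_eq_bounded_closed)
qed

lemma convex_cart_power: "convex K \<Longrightarrow> convex (cart_power K)"
  by (auto simp: convex_def cart_power_def)

lemma convex_body_cart_power:
  assumes "convex_body K"
  shows "convex_body (cart_power K :: ('a::euclidean_space^'p) set)"
proof -
  obtain x where "x \<in> K" using assms by (auto simp: convex_body_def)
  then have "diag_emb x \<in> (cart_power K :: ('a^'p) set)" by (simp add: cart_power_def)
  then show ?thesis
    using assms compact_cart_power convex_cart_power by (auto simp: convex_body_def)
qed

lemma interior_cart_power: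
  assumes "interior K \<noteq> {}"
  shows "interior (cart_power K :: ('a::euclidean_space^'p) set) \<noteq> {}"
proof -
  obtain x where x: "x \<in> interior K" using assms by auto
  have "open {z :: 'a^'p. \<forall>i. z $ i \<in> interior K}" by (intro open_vector_box) auto
  moreover have "{z :: 'a^'p. \<forall>i. z $ i \<in> interior K} \<subseteq> cart_power K"
    using interior_subset by (auto simp: cart_power_def)
  ultimately have "{z :: 'a^'p. \<forall>i. z $ i \<in> interior K} \<subseteq> interior (cart_power K)" by (rule interior_maximal [rotated])
  moreover have "diag_emb x \<in> {z :: 'a^'p. \<forall>i. z $ i \<in> interior K}" using x by simp
  ultimately show ?thesis by blast
qed

lemma convex_body_neg_diag:
  assumes "convex_body K"
  shows "convex_body ((\<lambda>x. - diag_emb x) ` K :: ('a::euclidean_space^'p) set)"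
  using assms
  by (auto simp: convex_body_def intro!: compact_continuous_image continuous_intros convex_linear_image
      linear_compose_neg linear_diag_emb)

text \<open>Closed jointly in factor and point, including factor 0, because \<open>K\<close> is
  compact. It serves both measurability and the limits of the equality case.\<close>

lemma closed_dilates:
  fixes K :: "'a::euclidean_space set"
  assumes "compact K"
  shows "closed {(b, v). 0 \<le> b \<and> v \<in> (\<lambda>x. b *\<^sub>R x) ` K}"
proof -
  have "closed {(x, b, v :: 'a). 0 \<le> b \<and> v = b *\<^sub>R x}"
    unfolding split_def by (intro closed_Collect_conj closed_Collect_le closed_Collect_eq continuous_intros)
  from closed_compact_projection [OF assms this] show ?thesis
    by (rule back_subst [of closed]) auto
qed

lemma closed_join_cone:
  fixes K :: "'a::euclidean_space set"
  assumes "compact K"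
  shows "closed (join_cone K :: (real \<times> real \<times> ('a^'p)) set)"
proof -
  have "closed {(u :: ('a^'p) \<times> 'a, a, b, z). 0 \<le> a \<and> 0 \<le> b \<and> z = a *\<^sub>R fst u - b *\<^sub>R diag_emb (snd u)}"
    unfolding split_def by (intro closed_Collect_conj closed_Collect_le closed_Collect_eq continuous_intros)
  moreover have "compact ((cart_power K :: ('a^'p) set) \<times> K)" by (intro compact_Times compact_cart_power assms)
  ultimately have "closed {q. \<exists>u. u \<in> (cart_power K :: ('a^'p) set) \<times> K \<and>
     (u, q) \<in> {(u :: ('a^'p) \<times> 'a, a, b, z). 0 \<le> a \<and> 0 \<le> b \<and> z = a *\<^sub>R fst u - b *\<^sub>R diag_emb (snd u)}}"
    by (intro closed_compact_projection)
  then show ?thesis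
    by (rule back_subst [of closed]) (auto simp: join_cone_def)
qed

lemma closed_join_fibre_graph:
  fixes K :: "'a::euclidean_space set"
  assumes "compact K"
  shows "closed {(q :: real \<times> real \<times> ('a^'p), v). v \<in> join_fibre K q}"
proof -
  let ?D = "{(b, v). 0 \<le> b \<and> v \<in> (\<lambda>x. b *\<^sub>R x) ` K}"
  let ?f = "\<lambda>(q :: real \<times> real \<times> ('a^'p), v :: 'a). (fst (snd q), v)"
  let ?g = "\<lambda>i (q :: real \<times> real \<times> ('a^'p), v :: 'a). (fst q, snd (snd q) $ i + v)"
  have "closed (?f -` ?D \<inter> (\<Inter>i. ?g i -` ?D))"
    unfolding split_def
    by (intro closed_Int closed_INT ballI closed_vimage closed_dilates [OF assms, unfolded split_def] continuous_intros)
  then show ?thesis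
    by (rule back_subst [of closed]) (auto simp: join_fibre_def)
qed

lemma join_fibre_convex_compact:
  fixes K :: "'a::euclidean_space set" and q :: "real \<times> real \<times> ('a^'p)"
  assumes "convex_body K"
  shows "compact (join_fibre K q)" "convex (join_fibre K q)"
proof -
  obtain a b z where q: "q = (a, b, z)" by (metis prod.exhaust)
  have K: "compact K" "convex K" using assms by (auto simp: convex_body_def)
  have "closed ((\<lambda>v. (q, v)) -` {(q :: real \<times> real \<times> ('a^'p), v). v \<in> join_fibre K q})"
    by (intro closed_vimage closed_join_fibre_graph K continuous_intros)
  then have "closed (join_fibre K q)" by (simp add: vimage_def)
  moreover have "join_fibre K q \<subseteq> (\<lambda>x. b *\<^sub>R x) ` K" by (auto simp: q join_fibre_def)
  then have "bounded (join_fibre K q)"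
    using compact_scaling [OF K(1), THEN compact_imp_bounded] bounded_subset by blast
  ultimately show "compact (join_fibre K q)" by (simp add: compact_eq_bounded_closed)
  show "convex (join_fibre K q)"
  proof (cases "0 \<le> a \<and> 0 \<le> b")
    case True
    have "join_fibre K q = (\<lambda>x. b *\<^sub>R x) ` K \<inter> (\<Inter>i. (\<lambda>x. - (z $ i) + x) ` (\<lambda>x. a *\<^sub>R x) ` K)"
      using True by (force simp: q join_fibre_def image_iff algebra_simps)
    then show ?thesis
      by (simp only:) (intro convex_Int convex_INT convex_translation convex_scaling K)
  next
    case False
    then have "join_fibre K q = {}" by (auto simp: q join_fibre_def)
    then show ?thesis by simp
  qed
qed

lemma dilate_subset_join_fibre:
  assumes K: "convex K" and q: "(a, b, z) - (\<mu>, \<mu>, 0) \<in> join_cone K" and \<mu>: "0 \<le> \<mu>"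
  obtains v where "(\<lambda>x. v + \<mu> *\<^sub>R x) ` K \<subseteq> join_fibre K (a, b, z)"
proof -
  obtain x v where xv: "\<mu> \<le> a" "\<mu> \<le> b" "x \<in> cart_power K" "v \<in> K"
    "z = (a - \<mu>) *\<^sub>R x - (b - \<mu>) *\<^sub>R diag_emb v"
    using q by (auto simp: join_cone_def)
  \<comment> \<open>For \<open>c > 0\<close>, a convex combination of \<open>u\<close> and
    \<open>k\<close> with weights \<open>(c - \<mu>) / c\<close> and \<open>\<mu> / c\<close>,
    dilated by \<open>c\<close>.\<close>
  have mix: "(c - \<mu>) *\<^sub>R u + \<mu> *\<^sub>R k \<in> (\<lambda>x. c *\<^sub>R x) ` K" if "u \<in> K" "k \<in> K" "\<mu> \<le> c" for u k c
  proof (cases "c = 0")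
    case True
    then show ?thesis using that \<mu> by auto
  next
    case False
    then have c: "0 < c" using that \<mu> by simp
    then have "((c - \<mu>) / c) *\<^sub>R u + (\<mu> / c) *\<^sub>R k \<in> K"
      using that \<mu> by (intro convexD [OF K]) (auto simp: field_simps)
    moreover have "(c - \<mu>) *\<^sub>R u + \<mu> *\<^sub>R k = c *\<^sub>R (((c - \<mu>) / c) *\<^sub>R u + (\<mu> / c) *\<^sub>R k)"
      using c by (simp add: scaleR_add_right)
    ultimately show ?thesis by blast
  qed
  have "(\<lambda>k. (b - \<mu>) *\<^sub>R v + \<mu> *\<^sub>R k) ` K \<subseteq> join_fibre K (a, b, z)"
  proof clarify
    fix k assume k: "k \<in> K"
    \<comment> \<open>One translation vector serves all coordinates at once: the diagonal part of
      \<open>z\<close> cancels in each of them.\<close>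
    have "z $ i + ((b - \<mu>) *\<^sub>R v + \<mu> *\<^sub>R k) = (a - \<mu>) *\<^sub>R (x $ i) + \<mu> *\<^sub>R k" for i
      by (simp add: xv(5))
    then show "(b - \<mu>) *\<^sub>R v + \<mu> *\<^sub>R k \<in> join_fibre K (a, b, z)"
      using mix xv k \<mu> by (auto simp: join_fibre_def cart_power_def)
  qed
  then show thesis by (rule that)
qed

lemma emeasure_lborel_compact:
  fixes S :: "'a::euclidean_space set"
  assumes "compact S"
  shows "emeasure lborel S = ennreal (measure lebesgue S)"
  using emeasure_eq_measure2 [OF fmeasurable_compact [OF assms]] borel_compact [OF assms]
  by (simp add: measure_completion)

lemma emeasure_lborel_affine_body:
  fixes K :: "'a::euclidean_space set"
  assumes "compact K" "0 \<le> b"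
  shows "emeasure lborel ((\<lambda>x. v + b *\<^sub>R x) ` K) = ennreal (b ^ DIM('a) * measure lebesgue K)"
proof -
  have "compact ((\<lambda>x. v + b *\<^sub>R x) ` K)"
    using assms by (intro compact_continuous_image continuous_intros)
  then have "emeasure lborel ((\<lambda>x. v + b *\<^sub>R x) ` K) = ennreal (measure lebesgue ((\<lambda>x. b *\<^sub>R x + v) ` K))"
    by (simp add: emeasure_lborel_compact add.commute)
  then show ?thesis using measure_lebesgue_affine [of b v K] assms by simp
qed

lemma nn_integral_lborel_shift:
  fixes f :: "'a::euclidean_space \<Rightarrow> ennreal"
  assumes [measurable]: "f \<in> borel_measurable borel"
  shows "(\<integral>\<^sup>+x. f (c + x) \<partial>lborel) = (\<integral>\<^sup>+x. f x \<partial>lborel)"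
  by (subst (2) lborel_distr_plus [of c, symmetric]) (simp add: nn_integral_distr)

lemma measurable_borel_lborel:
  "measurable (borel \<Otimes>\<^sub>M lborel) M =
    measurable (borel :: ('a::second_countable_topology \<times> 'b::euclidean_space) measure) M"
  by (rule measurable_cong_sets) (auto simp: borel_prod [symmetric] intro!: sets_pair_measure_cong)

abbreviation weight :: "real \<Rightarrow> real \<Rightarrow> real \<times> real \<times> ('a::euclidean_space^'p) \<Rightarrow> ennreal" where
  "weight x y q \<equiv> ennreal (exp (- x * fst q) * exp (- y * fst (snd q)))"

lemma measurable_weight: "weight x y \<in> borel_measurable (borel :: (real \<times> real \<times> ('a::euclidean_space^'p)) measure)"
  by (intro measurable_compose [OF _ measurable_ennreal] borel_measurable_continuous_onI continuous_intros)

section \<open>Integrals of the fibre volume and of its lower bound\<close>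

context
  fixes K :: "'a::euclidean_space set"
  assumes K: "convex_body K"
begin

lemma borel_sets_join:
  "join_cone K \<in> sets (borel :: (real \<times> real \<times> ('a^'p)) measure)"
  "{(q :: real \<times> real \<times> ('a^'p), v). v \<in> join_fibre K q} \<in> sets borel"
  using K closed_join_cone closed_join_fibre_graph by (auto simp: convex_body_def intro!: borel_closed)

lemma measurable_indicator_join_fibre:
  "(\<lambda>(q, v). indicator (join_fibre K q) v :: ennreal) \<in>
     borel_measurable (borel :: ((real \<times> real \<times> ('a^'p)) \<times> 'a) measure)"
proof -
  have "(\<lambda>(q, v). indicator (join_fibre K q) v) =
      (indicator {(q :: real \<times> real \<times> ('a^'p), v). v \<in> join_fibre K q} :: _ \<Rightarrow> ennreal)"
    by (auto simp: indicator_def fun_eq_iff)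
  then show ?thesis
    by (simp only:) (intro borel_measurable_indicator borel_sets_join)
qed

lemma emeasure_join_fibre_eq:
  "emeasure lborel (join_fibre K q) = (\<integral>\<^sup>+v. indicator (join_fibre K q) v \<partial>lborel)"
  using join_fibre_convex_compact [OF K, of q] by (simp add: borel_compact)

lemma measurable_emeasure_join_fibre:
  "(\<lambda>q. emeasure lborel (join_fibre K q)) \<in> borel_measurable (borel :: (real \<times> real \<times> ('a^'p)) measure)"
proof -
  have "(\<lambda>(q, v). indicator (join_fibre K q) v :: ennreal) \<in>
     borel_measurable ((borel :: (real \<times> real \<times> ('a^'p)) measure) \<Otimes>\<^sub>M lborel)"
    unfolding measurable_borel_lborel by (rule measurable_indicator_join_fibre)
  then show ?thesis
    unfolding emeasure_join_fibre_eq by (intro lborel.borel_measurable_nn_integral) simp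
qed

text \<open>After exchanging the integrals, for fixed \<open>v\<close> in \<open>b K\<close> the
  points \<open>z\<close> form a translate of the p-th power of \<open>a K\<close>, so the inner
  integral does not depend on \<open>v\<close>.\<close>

lemma nn_integral_join_fibre:
  assumes ab: "0 \<le> a" "0 \<le> b"
  shows "(\<integral>\<^sup>+z. emeasure lborel (join_fibre K (a, b, z :: 'a^'p)) \<partial>lborel) =
    ennreal (measure lebesgue K ^ Suc CARD('p) * b ^ DIM('a) * a ^ DIM('a^'p))"
proof -
  let ?B = "(\<lambda>x. b *\<^sub>R x) ` K" and ?A = "(\<lambda>x. a *\<^sub>R x) ` K"
  have cpt: "compact ?A" "compact ?B" using K by (auto simp: convex_body_def compact_scaling)
  note [measurable] = borel_compact [OF cpt(1)] borel_compact [OF cpt(2)]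
  have [measurable]: "(cart_power ?A :: ('a^'p) set) \<in> sets borel"
    by (rule emeasure_cart_power) measurable
  have meas: "(\<lambda>(z :: 'a^'p, v). indicator (join_fibre K (a, b, z)) v :: ennreal) \<in> borel_measurable (lborel \<Otimes>\<^sub>M lborel)"
  proof -
    have "(\<lambda>p :: ('a^'p) \<times> 'a. ((a, b, fst p), snd p)) \<in> borel_measurable borel"
      by (intro borel_measurable_continuous_onI continuous_intros)
    from measurable_compose [OF this measurable_indicator_join_fibre] show ?thesis
      by (simp add: lborel_prod split_def)
  qed
  have "(\<integral>\<^sup>+z. emeasure lborel (join_fibre K (a, b, z :: 'a^'p)) \<partial>lborel) =
      (\<integral>\<^sup>+z. \<integral>\<^sup>+v. indicator (join_fibre K (a, b, z :: 'a^'p)) v \<partial>lborel \<partial>lborel)"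
    by (simp only: emeasure_join_fibre_eq)
  also have "\<dots> = (\<integral>\<^sup>+v. \<integral>\<^sup>+z. indicator (join_fibre K (a, b, z :: 'a^'p)) v \<partial>lborel \<partial>lborel)"
    by (rule lborel_pair.Fubini' [OF meas, symmetric])
  also have "\<dots> = (\<integral>\<^sup>+v. ennreal (a ^ DIM('a) * measure lebesgue K) ^ CARD('p) * indicator ?B v \<partial>lborel)"
  proof (rule nn_integral_cong)
    fix v :: 'a
    have "indicator (join_fibre K (a, b, z)) v =
        indicator ?B v * (indicator (cart_power ?A) (diag_emb v + z) :: ennreal)" for z :: "'a^'p"
      using ab by (auto simp: join_fibre_def cart_power_def indicator_def add.commute)
    then have "(\<integral>\<^sup>+z. indicator (join_fibre K (a, b, z :: 'a^'p)) v \<partial>lborel) =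
        indicator ?B v * (\<integral>\<^sup>+z. indicator (cart_power ?A) (diag_emb v + z :: 'a^'p) \<partial>lborel)"
      by (simp add: nn_integral_cmult)
    also have "(\<integral>\<^sup>+z. indicator (cart_power ?A) (diag_emb v + z :: 'a^'p) \<partial>lborel) = emeasure lborel (cart_power ?A :: ('a^'p) set)"
      by (subst nn_integral_lborel_shift) simp_all
    also have "\<dots> = ennreal (a ^ DIM('a) * measure lebesgue K) ^ CARD('p)"
      using emeasure_lborel_affine_body [of K a 0] K ab by (simp add: emeasure_cart_power convex_body_def)
    finally show "(\<integral>\<^sup>+z. indicator (join_fibre K (a, b, z :: 'a^'p)) v \<partial>lborel) =
        ennreal (a ^ DIM('a) * measure lebesgue K) ^ CARD('p) * indicator ?B v" by (simp add: mult.commute)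
  qed
  also have "\<dots> = ennreal (a ^ DIM('a) * measure lebesgue K) ^ CARD('p) * ennreal (b ^ DIM('a) * measure lebesgue K)"
    using emeasure_lborel_affine_body [of K b 0] K ab by (simp add: nn_integral_cmult_indicator convex_body_def)
  also have "\<dots> = ennreal (measure lebesgue K ^ Suc CARD('p) * b ^ DIM('a) * a ^ DIM('a^'p))"
    using ab by (simp add: ennreal_power ennreal_mult [symmetric] power_mult_distrib power_mult [symmetric] mult_ac)
  finally show ?thesis .
qed

lemma join_fibre_empty: "\<not> (0 \<le> a \<and> 0 \<le> b) \<Longrightarrow> join_fibre K (a, b, z) = {}"
  by (auto simp: join_fibre_def)

lemma nn_integral_weight_join_fibre:
  assumes xy: "0 < x" "0 < y"
  shows "(\<integral>\<^sup>+q. weight x y q * emeasure lborel (join_fibre K (q :: real \<times> real \<times> ('a^'p))) \<partial>lborel) =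
    ennreal (measure lebesgue K ^ Suc CARD('p) * (fact DIM('a) / y ^ Suc DIM('a)) * (fact DIM('a^'p) / x ^ Suc DIM('a^'p)))"
proof -
  let ?N = "DIM('a^'p)" and ?n = "DIM('a)"
  let ?m = "ennreal (measure lebesgue K ^ Suc CARD('p))"
  note [measurable] = measurable_weight measurable_emeasure_join_fibre
  have "(\<integral>\<^sup>+q. weight x y q * emeasure lborel (join_fibre K (q :: real \<times> real \<times> ('a^'p))) \<partial>lborel) =
    (\<integral>\<^sup>+a. \<integral>\<^sup>+b. \<integral>\<^sup>+z. weight x y (a, b, z) * emeasure lborel (join_fibre K (a, b, z :: 'a^'p)) \<partial>lborel \<partial>lborel \<partial>lborel)"
    by (rule nn_integral_lborel_triple) measurable
  also have "\<dots> = (\<integral>\<^sup>+a. \<integral>\<^sup>+b. (?m * (ennreal (a ^ ?N * exp (- x * a)) * indicator {0..} a)) *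
      (ennreal (b ^ ?n * exp (- y * b)) * indicator {0..} b) \<partial>lborel \<partial>lborel)"
  proof (intro nn_integral_cong)
    fix a b :: real
    have [measurable]: "(\<lambda>z :: 'a^'p. emeasure lborel (join_fibre K (a, b, z))) \<in> borel_measurable borel"
      by (rule measurable_compose [OF _ measurable_emeasure_join_fibre])
        (intro borel_measurable_continuous_onI continuous_intros)
    show "(\<integral>\<^sup>+z. weight x y (a, b, z) * emeasure lborel (join_fibre K (a, b, z :: 'a^'p)) \<partial>lborel) =
      (?m * (ennreal (a ^ ?N * exp (- x * a)) * indicator {0..} a)) * (ennreal (b ^ ?n * exp (- y * b)) * indicator {0..} b)"
    proof (cases "0 \<le> a \<and> 0 \<le> b")
      case True
      then have "(\<integral>\<^sup>+z. weight x y (a, b, z) * emeasure lborel (join_fibre K (a, b, z :: 'a^'p)) \<partial>lborel) =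
          ennreal (exp (- x * a) * exp (- y * b)) * ennreal (measure lebesgue K ^ Suc CARD('p) * b ^ ?n * a ^ ?N)"
        by (simp only: fst_conv snd_conv nn_integral_join_fibre [symmetric]) (rule nn_integral_cmult, measurable)
      also have "\<dots> = ?m * ennreal (a ^ ?N * exp (- x * a)) * ennreal (b ^ ?n * exp (- y * b))"
        using True by (simp add: ennreal_mult [symmetric] mult_ac del: power_Suc)
      finally show ?thesis using True by simp
    next
      case False
      then show ?thesis by (auto simp: join_fibre_empty)
    qed
  qed
  also have "\<dots> = (\<integral>\<^sup>+a. ?m * (ennreal (a ^ ?N * exp (- x * a)) * indicator {0..} a) * ennreal (fact ?n / y ^ Suc ?n) \<partial>lborel)"
    by (rule nn_integral_cong, subst nn_integral_cmult, measurable, simp only: nn_integral_power_exp [OF xy(2)])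
  also have "\<dots> = ?m * ennreal (fact ?N / x ^ Suc ?N) * ennreal (fact ?n / y ^ Suc ?n)"
    by (subst nn_integral_multc, measurable, subst nn_integral_cmult, measurable)
      (simp only: nn_integral_power_exp [OF xy(1)])
  finally show ?thesis
    using xy by (simp add: ennreal_mult [symmetric] mult_ac del: power_Suc)
qed

text \<open>Unless the bound is 0, it is at most the volume of a single homothet of \<open>K\<close>
  inside the fibre. This yields the inequality and also identifies the fibre when equality
  holds.\<close>

lemma fibre_bound_cases:
  fixes q :: "real \<times> real \<times> ('a^'p)"
  shows "fibre_bound K q = 0 \<or> (\<exists>\<mu>\<ge>0. \<exists>v. (\<lambda>x. v + \<mu> *\<^sub>R x) ` K \<subseteq> join_fibre K q \<and>
           fibre_bound K q \<le> emeasure lborel ((\<lambda>x. v + \<mu> *\<^sub>R x) ` K))"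
proof -
  obtain a b z where q: "q = (a, b, z)" by (metis prod.exhaust)
  have cK: "compact K" "convex K" using K by (auto simp: convex_body_def)
  let ?n = "DIM('a)"
  let ?M = "{\<mu>. 0 \<le> \<mu> \<and> q - (\<mu>, \<mu>, 0) \<in> join_cone K}"
  have "?M = {0..} \<inter> (\<lambda>\<mu>. q - (\<mu>, \<mu>, 0)) -` join_cone K" by auto
  then have "closed ?M"
    by (simp only:) (intro closed_Int closed_atLeast closed_vimage closed_join_cone cK continuous_intros)
  moreover have sub: "?M \<subseteq> {0..a}" by (auto simp: q join_cone_def)
  ultimately have cM: "compact ?M"
    using bounded_subset compact_eq_bounded_closed by blast
  show ?thesis
  proof (cases "?M = {}")
    case True
    then have "indicator {0..} \<mu> * ennreal (real ?n * \<mu> ^ (?n - 1)) * indicator (join_cone K) (q - (\<mu>, \<mu>, 0)) = (0::ennreal)" for \<mu>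
      by (auto simp: indicator_def)
    then have "fibre_bound K q = 0" by (simp only: fibre_bound_def) simp
    then show ?thesis by simp
  next
    case False
    \<comment> \<open>The admissible \<open>\<mu>\<close> form a compact set; its largest element
      gives the homothet.\<close>
    then obtain s where s: "s \<in> ?M" "\<And>\<mu>. \<mu> \<in> ?M \<Longrightarrow> \<mu> \<le> s"
      using compact_attains_sup [OF cM] by blast
    then obtain v where v: "(\<lambda>x. v + s *\<^sub>R x) ` K \<subseteq> join_fibre K q"
      using dilate_subset_join_fibre [OF cK(2), of a b z s] by (auto simp: q)
    have "(\<integral>\<^sup>+\<mu>. indicator {0..} \<mu> * ennreal (real ?n * \<mu> ^ (?n - 1)) * indicator (join_cone K) (q - (\<mu>, \<mu>, 0)) \<partial>lborel)
        \<le> (\<integral>\<^sup>+\<mu>. ennreal (real ?n * \<mu> ^ (?n - 1)) * indicator {0..s} \<mu> \<partial>lborel)"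
      using s by (intro nn_integral_mono) (auto simp: indicator_def)
    also have "\<dots> = ennreal (s ^ ?n - 0 ^ ?n)"
      using s by (intro nn_integral_FTC_Icc) (auto intro!: derivative_eq_intros)
    also have "s ^ ?n - 0 ^ ?n = s ^ ?n" by simp
    finally have "fibre_bound K q \<le> emeasure lborel K * ennreal (s ^ ?n)"
      unfolding fibre_bound_def by (rule mult_left_mono) simp
    also have "\<dots> = emeasure lborel ((\<lambda>x. v + s *\<^sub>R x) ` K)"
      using s by (simp add: emeasure_lborel_affine_body cK emeasure_lborel_compact ennreal_mult [symmetric] mult.commute)
    finally show ?thesis using v s by blast
  qed
qed

lemma fibre_bound_le: "fibre_bound K q \<le> emeasure lborel (join_fibre K q)"
proof -
  have "join_fibre K q \<in> sets lborel" using join_fibre_convex_compact [OF K, of q] by (simp add: borel_compact)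
  then show ?thesis
    using fibre_bound_cases [of q] emeasure_mono [of _ "join_fibre K q" lborel] by (metis order.trans zero_le)
qed

lemma measurable_bound_integrand:
  "(\<lambda>(q :: real \<times> real \<times> ('a^'p), \<mu>). indicator {0..} \<mu> * ennreal (real DIM('a) * \<mu> ^ (DIM('a) - 1)) *
      indicator (join_cone K) (q - (\<mu>, \<mu>, 0))) \<in> borel_measurable borel"
proof -
  have [measurable]: "(\<lambda>p :: (real \<times> real \<times> ('a^'p)) \<times> real. fst p - (snd p, snd p, 0)) \<in> borel_measurable borel"
    by (intro borel_measurable_continuous_onI continuous_intros)
  note [measurable] = borel_sets_join(1)
  have [measurable]: "(snd :: (real \<times> real \<times> ('a^'p)) \<times> real \<Rightarrow> real) \<in> borel_measurable borel"
    by (intro borel_measurable_continuous_onI continuous_intros)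
  show ?thesis unfolding split_def by measurable
qed

lemma measurable_fibre_bound: "fibre_bound K \<in> borel_measurable (borel :: (real \<times> real \<times> ('a^'p)) measure)"
proof -
  have [measurable]: "(\<lambda>q :: real \<times> real \<times> ('a^'p). \<integral>\<^sup>+\<mu>. indicator {0..} \<mu> *
      ennreal (real DIM('a) * \<mu> ^ (DIM('a) - 1)) * indicator (join_cone K) (q - (\<mu>, \<mu>, 0)) \<partial>lborel) \<in> borel_measurable borel"
    by (rule lborel.borel_measurable_nn_integral) (unfold measurable_borel_lborel, rule measurable_bound_integrand)
  show ?thesis unfolding fibre_bound_def [abs_def] by measurable
qed

text \<open>Moving \<open>q\<close> by \<open>(\<mu>, \<mu>, 0)\<close> multiplies the weight by
  \<open>exp (- (x + y) * \<mu>)\<close>. The integral thus splits into a Gamma integral in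
  \<open>\<mu>\<close> with rate \<open>x + y\<close> and the weighted volume of the cone.\<close>

lemma nn_integral_weight_fibre_bound:
  assumes xy: "0 < x" "0 < y"
  shows "(\<integral>\<^sup>+q. weight x y q * fibre_bound K (q :: real \<times> real \<times> ('a^'p)) \<partial>lborel) =
    emeasure lborel K * ennreal (fact DIM('a) / (x + y) ^ DIM('a)) *
      (\<integral>\<^sup>+q. weight x y q * indicator (join_cone K) (q :: real \<times> real \<times> ('a^'p)) \<partial>lborel)"
proof -
  let ?n = "DIM('a)"
  let ?g = "\<lambda>\<mu>. indicator {0..} \<mu> * ennreal (real ?n * \<mu> ^ (?n - 1)) :: ennreal"
  let ?C = "join_cone K :: (real \<times> real \<times> ('a^'p)) set"
  note [measurable] = borel_sets_join(1)
  have meas2: "(\<lambda>(q, \<mu>). weight x y q * (?g \<mu> * indicator ?C (q - (\<mu>, \<mu>, 0)))) \<in> borel_measurable (lborel \<Otimes>\<^sub>M lborel)"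
  proof -
    have [measurable]: "(\<lambda>p :: (real \<times> real \<times> ('a^'p)) \<times> real. weight x y (fst p)) \<in> borel_measurable borel"
      by (intro measurable_compose [OF _ measurable_ennreal] borel_measurable_continuous_onI continuous_intros)
    note [measurable] = measurable_bound_integrand [unfolded split_def]
    show ?thesis unfolding lborel_prod split_def measurable_lborel1 by measurable
  qed
  have "(\<integral>\<^sup>+q. weight x y q * fibre_bound K (q :: real \<times> real \<times> ('a^'p)) \<partial>lborel) =
      (\<integral>\<^sup>+q. emeasure lborel K * (\<integral>\<^sup>+\<mu>. weight x y q * (?g \<mu> * indicator ?C (q - (\<mu>, \<mu>, 0))) \<partial>lborel) \<partial>lborel)"
  proof (rule nn_integral_cong)
    fix q :: "real \<times> real \<times> ('a^'p)"
    have "(\<lambda>\<mu> :: real. (q, \<mu>)) \<in> borel_measurable borel"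
      by (intro borel_measurable_continuous_onI continuous_intros)
    from measurable_compose [OF this measurable_bound_integrand]
    have "(\<lambda>\<mu>. ?g \<mu> * indicator ?C (q - (\<mu>, \<mu>, 0))) \<in> borel_measurable borel"
      by simp
    then have eq: "(\<integral>\<^sup>+\<mu>. weight x y q * (?g \<mu> * indicator ?C (q - (\<mu>, \<mu>, 0))) \<partial>lborel) =
        weight x y q * (\<integral>\<^sup>+\<mu>. ?g \<mu> * indicator ?C (q - (\<mu>, \<mu>, 0)) \<partial>lborel)"
      by (intro nn_integral_cmult) simp
    show "weight x y q * fibre_bound K q =
        emeasure lborel K * (\<integral>\<^sup>+\<mu>. weight x y q * (?g \<mu> * indicator ?C (q - (\<mu>, \<mu>, 0))) \<partial>lborel)"
      unfolding eq fibre_bound_def by (rule mult.left_commute)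
  qed
  also have "\<dots> = emeasure lborel K * (\<integral>\<^sup>+q. \<integral>\<^sup>+\<mu>. weight x y q * (?g \<mu> * indicator ?C (q - (\<mu>, \<mu>, 0))) \<partial>lborel \<partial>lborel)"
    using lborel.borel_measurable_nn_integral_fst [OF meas2] by (intro nn_integral_cmult) simp
  also have "(\<integral>\<^sup>+q. \<integral>\<^sup>+\<mu>. weight x y q * (?g \<mu> * indicator ?C (q - (\<mu>, \<mu>, 0))) \<partial>lborel \<partial>lborel)
    = (\<integral>\<^sup>+\<mu>. \<integral>\<^sup>+q. weight x y q * (?g \<mu> * indicator ?C (q - (\<mu>, \<mu>, 0))) \<partial>lborel \<partial>lborel)"
    by (rule lborel_pair.Fubini' [OF meas2, symmetric])
  also have "\<dots> = (\<integral>\<^sup>+\<mu>. (ennreal (real ?n) * (ennreal (\<mu> ^ (?n - 1) * exp (- (x + y) * \<mu>)) * indicator {0..} \<mu>)) *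
     (\<integral>\<^sup>+q. weight x y q * indicator ?C q \<partial>lborel) \<partial>lborel)"
  proof (rule nn_integral_cong)
    fix \<mu> :: real
    have [measurable]: "(\<lambda>q. indicator ?C (q - (\<mu>, \<mu>, 0)) :: ennreal) \<in> borel_measurable borel"
      by (rule measurable_compose [of _ borel borel]) (auto intro!: borel_measurable_continuous_onI continuous_intros)
    note [measurable] = measurable_weight [of x y]
    have "(\<integral>\<^sup>+q. weight x y q * (?g \<mu> * indicator ?C (q - (\<mu>, \<mu>, 0))) \<partial>lborel) =
       (\<integral>\<^sup>+q. weight x y ((\<mu>, \<mu>, 0) + q) * (?g \<mu> * indicator ?C ((\<mu>, \<mu>, 0) + q - (\<mu>, \<mu>, 0))) \<partial>lborel)"
      by (rule nn_integral_lborel_shift [symmetric]) measurable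
    also have "\<dots> = (\<integral>\<^sup>+q. (ennreal (exp (- (x + y) * \<mu>)) * ?g \<mu>) * (weight x y q * indicator ?C q) \<partial>lborel)"
    proof (rule nn_integral_cong)
      fix q :: "real \<times> real \<times> ('a^'p)"
      have "exp (- x * fst ((\<mu>, \<mu>, 0) + q)) * exp (- y * fst (snd ((\<mu>, \<mu>, 0) + q))) =
         exp (- (x + y) * \<mu>) * (exp (- x * fst q) * exp (- y * fst (snd q)))"
        by (simp add: mult_exp_exp algebra_simps)
      moreover have "(\<mu>, \<mu>, 0) + q - (\<mu>, \<mu>, 0) = q" by (rule add_diff_cancel_left')
      ultimately show "weight x y ((\<mu>, \<mu>, 0) + q) * (?g \<mu> * indicator ?C ((\<mu>, \<mu>, 0) + q - (\<mu>, \<mu>, 0))) =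
         (ennreal (exp (- (x + y) * \<mu>)) * ?g \<mu>) * (weight x y q * indicator ?C q)"
        by (simp only: ennreal_mult'' exp_ge_zero mult_ac mult_nonneg_nonneg)
    qed
    also have "\<dots> = (ennreal (exp (- (x + y) * \<mu>)) * ?g \<mu>) * (\<integral>\<^sup>+q. weight x y q * indicator ?C q \<partial>lborel)"
      by (rule nn_integral_cmult) measurable
    also have "ennreal (exp (- (x + y) * \<mu>)) * ?g \<mu> =
       ennreal (real ?n) * (ennreal (\<mu> ^ (?n - 1) * exp (- (x + y) * \<mu>)) * indicator {0..} \<mu>)"
      by (cases "0 \<le> \<mu>") (simp_all add: ennreal_mult [symmetric] mult_ac)
    finally show "(\<integral>\<^sup>+q. weight x y q * (?g \<mu> * indicator ?C (q - (\<mu>, \<mu>, 0))) \<partial>lborel) =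
       (ennreal (real ?n) * (ennreal (\<mu> ^ (?n - 1) * exp (- (x + y) * \<mu>)) * indicator {0..} \<mu>)) *
       (\<integral>\<^sup>+q. weight x y q * indicator ?C q \<partial>lborel)" .
  qed
  also have "\<dots> = (ennreal (real ?n) * ennreal (fact (?n - 1) / (x + y) ^ Suc (?n - 1))) *
     (\<integral>\<^sup>+q. weight x y q * indicator ?C q \<partial>lborel)"
    using xy by (subst nn_integral_multc, measurable, subst nn_integral_cmult, measurable)
      (simp only: nn_integral_power_exp add_pos_pos)
  also have "ennreal (real ?n) * ennreal (fact (?n - 1) / (x + y) ^ Suc (?n - 1)) = ennreal (fact ?n / (x + y) ^ ?n)"
    using fact_reduce [of ?n, where 'a = real] DIM_positive [where 'a = 'a] xy
    by (simp add: ennreal_mult [symmetric] del: power_Suc)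
  finally show ?thesis by (simp only: mult.assoc)
qed

end

section \<open>Integral over the cone and the resulting inequality\<close>

context
  fixes K :: "'a::euclidean_space set" and c :: "nat \<Rightarrow> real" and p :: "'p::finite itself"
  assumes K: "convex_body K"
    and vol: "\<And>a b. 0 \<le> a \<Longrightarrow> 0 \<le> b \<Longrightarrow>
      measure lebesgue ((\<lambda>x. a *\<^sub>R x) ` (\<lambda>x. - diag_emb x) ` K + (\<lambda>x. b *\<^sub>R x) ` (cart_power K :: ('a^'p) set)) =
      (\<Sum>j\<le>DIM('a^'p). c j * a ^ j * b ^ (DIM('a^'p) - j))"
begin

lemma emeasure_join_cone_section:
  "emeasure lborel {z :: 'a^'p. (a, b, z) \<in> join_cone K} =
     indicator {0..} a * (indicator {0..} b * ennreal (\<Sum>j\<le>DIM('a^'p). c j * b ^ j * a ^ (DIM('a^'p) - j)))"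
proof (cases "0 \<le> a \<and> 0 \<le> b")
  case True
  let ?S = "(\<lambda>x. b *\<^sub>R x) ` (\<lambda>x. - diag_emb x) ` K + (\<lambda>x. a *\<^sub>R x) ` (cart_power K :: ('a^'p) set)"
  have eq: "{z :: 'a^'p. (a, b, z) \<in> join_cone K} = ?S"
    using True by (force simp: join_cone_def set_plus_def image_iff)
  have "compact ?S"
    using convex_body_neg_diag [OF K] convex_body_cart_power [OF K]
    by (auto simp: convex_body_def intro!: compact_set_plus compact_scaling)
  then show ?thesis
    unfolding eq using True by (simp add: emeasure_lborel_compact vol)
next
  case False
  then show ?thesis by (auto simp: join_cone_def)
qed

lemma nn_integral_weight_join_cone:
  assumes xy: "0 < x" "0 < y"
  shows "(\<integral>\<^sup>+q. weight x y q * indicator (join_cone K) (q :: real \<times> real \<times> ('a^'p)) \<partial>lborel) =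
      ennreal (\<Sum>j\<le>DIM('a^'p). c j * (fact j / y ^ Suc j) * (fact (DIM('a^'p) - j) / x ^ Suc (DIM('a^'p) - j)))" (is ?thesis1)
    and "0 \<le> (\<Sum>j\<le>DIM('a^'p). c j * (fact j / y ^ Suc j) * (fact (DIM('a^'p) - j) / x ^ Suc (DIM('a^'p) - j)))" (is ?thesis2)
proof -
  let ?N = "DIM('a^'p)"
  let ?C = "join_cone K :: (real \<times> real \<times> ('a^'p)) set"
  note [measurable] = borel_sets_join(1) [OF K] measurable_weight
  have nn: "0 \<le> (\<Sum>j\<le>?N. (c j * a ^ (?N - j)) * b ^ j)" if "0 \<le> a" "0 \<le> b" for a b
  proof -
    have "(\<Sum>j\<le>?N. (c j * a ^ (?N - j)) * b ^ j) = (\<Sum>j\<le>?N. c j * b ^ j * a ^ (?N - j))"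
      by (intro sum.cong refl) (simp only: mult_ac)
    also have "\<dots> \<ge> 0" unfolding vol [OF that(2,1), symmetric] by (rule measure_nonneg)
    finally show ?thesis .
  qed
  have inner: "(\<integral>\<^sup>+b. indicator {0..} b * ennreal (exp (- y * b) * (\<Sum>j\<le>?N. (c j * a ^ (?N - j)) * b ^ j)) \<partial>lborel) =
      ennreal (\<Sum>j\<le>?N. (c j * a ^ (?N - j)) * (fact j / y ^ Suc j))"
    "0 \<le> (\<Sum>j\<le>?N. (c j * a ^ (?N - j)) * (fact j / y ^ Suc j))" if "0 \<le> a" for a
    using nn_integral_sum_power_exp [OF xy(2) nn [OF that]] by auto
  have "(\<integral>\<^sup>+q. weight x y q * indicator ?C q \<partial>lborel) =
      (\<integral>\<^sup>+a. \<integral>\<^sup>+b. \<integral>\<^sup>+z. weight x y (a, b, z) * indicator ?C (a, b, z) \<partial>lborel \<partial>lborel \<partial>lborel)"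
    by (rule nn_integral_lborel_triple)
      (intro borel_measurable_times_ennreal measurable_weight borel_measurable_indicator borel_sets_join(1) [OF K])
  also have "\<dots> = (\<integral>\<^sup>+a. \<integral>\<^sup>+b. (indicator {0..} a * ennreal (exp (- x * a))) *
      (indicator {0..} b * ennreal (exp (- y * b) * (\<Sum>j\<le>?N. (c j * a ^ (?N - j)) * b ^ j))) \<partial>lborel \<partial>lborel)"
  proof (intro nn_integral_cong)
    fix a b :: real
    have sets [measurable]: "{z :: 'a^'p. (a, b, z) \<in> ?C} \<in> sets borel"
      using closed_join_cone [of K] K
      by (intro borel_closed closed_vimage [of ?C "\<lambda>z. (a, b, z)", unfolded vimage_def])
        (auto simp: convex_body_def intro!: continuous_intros)
    have ind: "indicator ?C (a, b, z) = (indicator {z. (a, b, z) \<in> ?C} z :: ennreal)" for z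
      by (simp add: indicator_def)
    have "(\<integral>\<^sup>+z. weight x y (a, b, z) * indicator ?C (a, b, z) \<partial>lborel) =
        ennreal (exp (- x * a) * exp (- y * b)) * emeasure lborel {z. (a, b, z) \<in> ?C}"
      unfolding ind fst_conv snd_conv by (rule nn_integral_cmult_indicator) simp
    also have "\<dots> = (indicator {0..} a * ennreal (exp (- x * a))) *
      (indicator {0..} b * ennreal (exp (- y * b) * (\<Sum>j\<le>?N. (c j * a ^ (?N - j)) * b ^ j)))"
    proof (cases "0 \<le> a \<and> 0 \<le> b")
      case True
      have "(\<Sum>j\<le>?N. c j * b ^ j * a ^ (?N - j)) = (\<Sum>j\<le>?N. (c j * a ^ (?N - j)) * b ^ j)"
        by (simp add: mult_ac)
      then show ?thesis
        unfolding emeasure_join_cone_section using True nn [of a b] by (simp add: ennreal_mult mult.assoc del: DIM_cart)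
    next
      case False
      then show ?thesis unfolding emeasure_join_cone_section by auto
    qed
    finally show "(\<integral>\<^sup>+z. weight x y (a, b, z) * indicator ?C (a, b, z) \<partial>lborel) = \<dots>" .
  qed
  also have "\<dots> = (\<integral>\<^sup>+a. indicator {0..} a * ennreal (exp (- x * a) *
      (\<Sum>j\<le>?N. (c j * (fact j / y ^ Suc j)) * a ^ (?N - j))) \<partial>lborel)"
  proof (rule nn_integral_cong)
    fix a :: real
    show "(\<integral>\<^sup>+b. (indicator {0..} a * ennreal (exp (- x * a))) *
      (indicator {0..} b * ennreal (exp (- y * b) * (\<Sum>j\<le>?N. (c j * a ^ (?N - j)) * b ^ j))) \<partial>lborel) =
      indicator {0..} a * ennreal (exp (- x * a) * (\<Sum>j\<le>?N. (c j * (fact j / y ^ Suc j)) * a ^ (?N - j)))"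
    proof (cases "0 \<le> a")
      case True
      have eq: "(\<Sum>j\<le>?N. (c j * a ^ (?N - j)) * (fact j / y ^ Suc j)) = (\<Sum>j\<le>?N. (c j * (fact j / y ^ Suc j)) * a ^ (?N - j))"
        by (intro sum.cong refl) (simp only: mult_ac)
      have "(\<integral>\<^sup>+b. (indicator {0..} a * ennreal (exp (- x * a))) *
        (indicator {0..} b * ennreal (exp (- y * b) * (\<Sum>j\<le>?N. (c j * a ^ (?N - j)) * b ^ j))) \<partial>lborel) =
        (indicator {0..} a * ennreal (exp (- x * a))) * ennreal (\<Sum>j\<le>?N. (c j * a ^ (?N - j)) * (fact j / y ^ Suc j))"
        unfolding inner(1) [OF True, symmetric] by (rule nn_integral_cmult) measurable
      also have "\<dots> = indicator {0..} a * ennreal (exp (- x * a) * (\<Sum>j\<le>?N. (c j * (fact j / y ^ Suc j)) * a ^ (?N - j)))"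
        using inner(2) [OF True] unfolding eq by (simp only: ennreal_mult exp_ge_zero mult.assoc)
      finally show ?thesis .
    qed simp
  qed
  also have "\<dots> = ennreal (\<Sum>j\<le>?N. (c j * (fact j / y ^ Suc j)) * (fact (?N - j) / x ^ Suc (?N - j)))"
    by (rule nn_integral_sum_power_exp(1) [OF xy(1)])
      (use inner(2) in \<open>simp only: mult_ac\<close>)
  finally show ?thesis1 .
  show ?thesis2
    by (rule nn_integral_sum_power_exp(2) [OF xy(1), where k = "\<lambda>j. ?N - j"])
      (use inner(2) in \<open>simp only: mult_ac\<close>)
qed

text \<open>Both sides are integrals of pointwise comparable functions. If they agree, their common
  value is finite, so the nonnegative difference vanishes almost everywhere; the weight is positive
  and finite and can be divided out.\<close>

lemma cone_inequality:
  assumes xy: "0 < x" "0 < y"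
  defines "S \<equiv> (\<Sum>j\<le>DIM('a^'p). c j * (fact j / y ^ Suc j) * (fact (DIM('a^'p) - j) / x ^ Suc (DIM('a^'p) - j)))"
    and "T \<equiv> measure lebesgue K ^ Suc CARD('p) * (fact DIM('a) / y ^ Suc DIM('a)) * (fact DIM('a^'p) / x ^ Suc DIM('a^'p))"
  shows "measure lebesgue K * (fact DIM('a) / (x + y) ^ DIM('a)) * S \<le> T"
    and "measure lebesgue K * (fact DIM('a) / (x + y) ^ DIM('a)) * S = T \<Longrightarrow>
      AE q in lborel. emeasure lborel (join_fibre K (q :: real \<times> real \<times> ('a^'p))) \<le> fibre_bound K q"
proof -
  let ?F = "\<lambda>q :: real \<times> real \<times> ('a^'p). weight x y q * emeasure lborel (join_fibre K q)"
  let ?B = "\<lambda>q :: real \<times> real \<times> ('a^'p). weight x y q * fibre_bound K q"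
  note [measurable] = measurable_weight measurable_emeasure_join_fibre [OF K] measurable_fibre_bound [OF K]
  have meas: "?F \<in> borel_measurable lborel" "?B \<in> borel_measurable lborel"
    unfolding measurable_lborel2
    by (intro borel_measurable_times_ennreal measurable_weight measurable_emeasure_join_fibre [OF K] measurable_fibre_bound [OF K])+
  have S: "0 \<le> S" unfolding S_def by (rule nn_integral_weight_join_cone(2) [OF xy])
  have T: "0 \<le> T" unfolding T_def using xy by simp
  have F: "integral\<^sup>N lborel ?F = ennreal T"
    unfolding T_def by (rule nn_integral_weight_join_fibre [OF K xy])
  have B: "integral\<^sup>N lborel ?B = ennreal (measure lebesgue K * (fact DIM('a) / (x + y) ^ DIM('a)) * S)"
  proof -
    have "(\<integral>\<^sup>+q. weight x y q * indicator (join_cone K) (q :: real \<times> real \<times> ('a^'p)) \<partial>lborel) = ennreal S"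
      unfolding S_def by (rule nn_integral_weight_join_cone(1) [OF xy])
    moreover have "emeasure lborel K = ennreal (measure lebesgue K)"
      using K by (simp add: emeasure_lborel_compact convex_body_def)
    ultimately have "integral\<^sup>N lborel ?B =
        ennreal (measure lebesgue K) * ennreal (fact DIM('a) / (x + y) ^ DIM('a)) * ennreal S"
      by (simp only: nn_integral_weight_fibre_bound [OF K xy])
    also have "\<dots> = ennreal (measure lebesgue K * (fact DIM('a) / (x + y) ^ DIM('a)) * S)"
    proof -
      have "0 \<le> fact DIM('a) / (x + y) ^ DIM('a)" using xy by simp
      then show ?thesis using S by (simp only: ennreal_mult measure_nonneg mult_nonneg_nonneg)
    qed
    finally show ?thesis .
  qed
  have le: "?B q \<le> ?F q" for q by (intro mult_left_mono fibre_bound_le [OF K]) simp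
  have "integral\<^sup>N lborel ?B \<le> integral\<^sup>N lborel ?F" by (intro nn_integral_mono le)
  then show "measure lebesgue K * (fact DIM('a) / (x + y) ^ DIM('a)) * S \<le> T"
    using T unfolding F B by simp
  assume "measure lebesgue K * (fact DIM('a) / (x + y) ^ DIM('a)) * S = T"
  then have eq: "integral\<^sup>N lborel ?B = ennreal T" using B by simp
  have "(\<integral>\<^sup>+q. ?F q - ?B q \<partial>lborel) = 0"
    by (subst nn_integral_diff [OF meas]) (use eq F le in auto)
  then have "AE q in lborel. ?F q - ?B q = 0"
    by (subst (asm) nn_integral_0_iff_AE) (use meas in \<open>auto simp del: measurable_lborel2\<close>)
  then show "AE q in lborel. emeasure lborel (join_fibre K (q :: real \<times> real \<times> ('a^'p))) \<le> fibre_bound K q"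
  proof (rule AE_mp, intro AE_I2 impI)
    fix q :: "real \<times> real \<times> ('a^'p)"
    assume "?F q - ?B q = 0"
    then have "?F q \<le> ?B q"
      by (simp add: diff_eq_0_iff_ennreal)
    then show "emeasure lborel (join_fibre K q) \<le> fibre_bound K q"
      by (simp add: ennreal_mult_le_mult_iff)
  qed
qed

end

section \<open>Bodies with homothetic caps\<close>

text \<open>A ball inside \<open>K\<close> that touches the supporting hyperplane with outer normal
  \<open>u\<close> at \<open>c + r u\<close>. Seen from the contact point, large dilates of the
  ball, and so of \<open>K\<close>, eventually contain every point of the open half-space below the
  hyperplane.\<close>

definition tangent_ball :: "'a::euclidean_space set \<Rightarrow> 'a \<Rightarrow> real \<Rightarrow> 'a \<Rightarrow> bool" where
  "tangent_ball K c r u \<longleftrightarrow> 0 < r \<and> norm u = 1 \<and> cball c r \<subseteq> K \<and> (\<forall>y\<in>K. u \<bullet> y \<le> u \<bullet> (c + r *\<^sub>R u))"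

text \<open>A small ball moved from the interior of \<open>K\<close> towards \<open>w\<close> gets stuck at a point where the
  supporting hyperplane is unique and separates \<open>w\<close> from \<open>K\<close>.\<close>

lemma tangent_ball_separating:
  fixes K :: "'a::euclidean_space set"
  assumes K: "convex K" "compact K" and int: "interior K \<noteq> {}" and w: "w \<notin> K"
  obtains c r u where "tangent_ball K c r u" "u \<bullet> (c + r *\<^sub>R u) < u \<bullet> w"
proof -
  obtain c \<epsilon> where c: "0 < \<epsilon>" "cball c \<epsilon> \<subseteq> K"
    using int mem_interior_cball by (metis ex_in_conv)
  have "open (- K)" using K(2) compact_imp_closed by blast
  then obtain \<delta> where \<delta>: "0 < \<delta>" "ball w \<delta> \<subseteq> - K" using w open_contains_ball by (metis ComplI)
  define d where "d = w - c"
  have "c \<in> K" using c by auto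
  then have d: "0 < norm d" using w by (auto simp: d_def)
  define \<kappa> where "\<kappa> = \<delta> / norm d"
  have \<kappa>: "0 < \<kappa>" using \<delta> d by (simp add: \<kappa>_def)
  \<comment> \<open>Any radius with \<open>\<rho> < \<kappa> * (\<epsilon> - \<rho>)\<close> would
    do; this is the inequality that finally separates the contact hyperplane from \<open>w\<close>.
    The ratio \<open>\<kappa>\<close> is the part of the way that is certainly left when the ball
    stops.\<close>
  define \<rho> where "\<rho> = \<kappa> * \<epsilon> / (2 * (1 + \<kappa>))"
  have \<rho>: "0 < \<rho>" "\<rho> < \<epsilon>" "\<rho> < \<kappa> * (\<epsilon> - \<rho>)"
  proof -
    show "0 < \<rho>" using \<kappa> c by (simp add: \<rho>_def)
    have eq: "\<rho> * (1 + \<kappa>) = \<kappa> * \<epsilon> / 2" using \<kappa> by (simp add: \<rho>_def field_simps)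
    have "0 < \<kappa> * \<epsilon>" using \<kappa> c by simp
    then show "\<rho> < \<kappa> * (\<epsilon> - \<rho>)" using eq by (simp add: algebra_simps)
    then have "0 < \<kappa> * (\<epsilon> - \<rho>)" using \<open>0 < \<rho>\<close> by linarith
    then show "\<rho> < \<epsilon>" using \<kappa> by (simp add: zero_less_mult_iff)
  qed
  define S where "S = {s. 0 \<le> s \<and> s \<le> 1 \<and> (\<forall>h\<in>cball 0 \<rho>. c + s *\<^sub>R d + h \<in> K)}"
  have "S = {0..1} \<inter> (\<Inter>h\<in>cball 0 \<rho>. (\<lambda>s. c + s *\<^sub>R d + h) -` K)"
    by (auto simp: S_def)
  then have "compact S"
    using compact_imp_closed [OF K(2)]
    by (simp only:) (intro compact_Int_closed compact_Icc closed_INT ballI closed_vimage continuous_intros)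
  moreover have "c + h \<in> K" if "h \<in> cball 0 \<rho>" for h
    using that c(2) \<rho> by (intro subsetD [OF c(2)]) (simp add: dist_norm)
  then have "0 \<in> S" by (auto simp: S_def)
  ultimately obtain s where s: "s \<in> S" "\<And>t. t \<in> S \<Longrightarrow> t \<le> s"
    using compact_attains_sup [of S] by blast
  define z where "z = c + s *\<^sub>R d"
  have zK: "cball z \<rho> \<subseteq> K"
  proof
    fix y assume "y \<in> cball z \<rho>"
    then have "y - z \<in> cball 0 \<rho>" by (simp add: dist_norm norm_minus_commute)
    then have "z + (y - z) \<in> K" using s(1) unfolding S_def z_def by blast
    then show "y \<in> K" by simp
  qed
  then have "z \<in> K" using \<rho> by auto
  then have "w - z \<notin> ball 0 \<delta>" using \<delta>(2) by (auto simp: dist_norm norm_minus_commute)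
  moreover have "w - z = (1 - s) *\<^sub>R d" by (simp add: z_def d_def algebra_simps)
  ultimately have "\<delta> \<le> (1 - s) * norm d" using s(1) by (simp add: S_def)
  then have \<kappa>s: "\<kappa> \<le> 1 - s" using d by (simp add: \<kappa>_def field_simps)
  \<comment> \<open>A ball in the interior at the last position could move on a little;
    \<open>\<kappa> \<le> 1 - s\<close> leaves room for that in the parameter interval.\<close>
  have "\<not> cball z \<rho> \<subseteq> interior K"
  proof
    assume sub: "cball z \<rho> \<subseteq> interior K"
    obtain e where e: "0 < e" "(\<Union>x\<in>cball z \<rho>. ball x e) \<subseteq> interior K"
      using compact_subset_open_imp_ball_epsilon_subset [OF compact_cball open_interior sub] by blast
    define t where "t = min \<kappa> (e / (2 * norm d))"
    have t: "0 < t" "t \<le> \<kappa>" "t * norm d < e"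
    proof -
      show "0 < t" "t \<le> \<kappa>" using \<kappa> e d by (auto simp: t_def)
      have "t * norm d \<le> e / (2 * norm d) * norm d" using d by (intro mult_right_mono) (auto simp: t_def)
      then show "t * norm d < e" using e d by simp
    qed
    have "c + (s + t) *\<^sub>R d + h \<in> K" if "h \<in> cball 0 \<rho>" for h
    proof -
      have "z + h \<in> cball z \<rho>" using that by (simp add: dist_norm)
      moreover have "c + (s + t) *\<^sub>R d + h \<in> ball (z + h) e"
        using t by (simp add: z_def dist_norm algebra_simps)
      ultimately show ?thesis using e(2) interior_subset by blast
    qed
    then have "s + t \<in> S" using s(1) t \<kappa>s by (simp add: S_def)
    then show False using s(2) t by fastforce
  qed
  then obtain y where y: "y \<in> cball z \<rho>" "y \<notin> interior K" by blast
  then have "y \<in> closure K" using zK closure_subset by blast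
  moreover have "y \<notin> rel_interior K" using y int rel_interior_nonempty_interior by metis
  ultimately obtain a0 where a0: "a0 \<noteq> 0" "\<And>x. x \<in> K \<Longrightarrow> a0 \<bullet> y \<le> a0 \<bullet> x"
    using supporting_hyperplane_rel_boundary [OF K(1), of y] zK y by (metis subsetD)
  define u where "u = - a0 /\<^sub>R norm a0"
  have u: "norm u = 1" "\<And>x. x \<in> K \<Longrightarrow> u \<bullet> x \<le> u \<bullet> y"
    using a0 by (auto simp: u_def divide_right_mono)
  have uu: "u \<bullet> u = 1" using u(1) by (simp add: norm_eq_1)
  have "z + \<rho> *\<^sub>R u \<in> K" using u(1) \<rho> by (intro subsetD [OF zK]) (simp add: dist_norm)
  then have "u \<bullet> z + \<rho> \<le> u \<bullet> y" using u(2) uu by (force simp: inner_add_right)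
  then have "\<rho> \<le> (y - z) \<bullet> u" by (simp add: inner_diff_right inner_commute [of _ u])
  then have "\<rho> * \<rho> \<le> \<rho> * ((y - z) \<bullet> u)" using \<rho> by simp
  moreover have "(y - z) \<bullet> (y - z) \<le> \<rho> * \<rho>"
    using y(1) \<rho> power_mono [of "norm (y - z)" \<rho> 2]
    by (simp add: dist_norm norm_minus_commute dot_square_norm power2_eq_square)
  \<comment> \<open>The equality case of Cauchy--Schwarz: \<open>y - z\<close> has length at most
    \<open>\<rho>\<close> and component at least \<open>\<rho>\<close> along the unit vector
    \<open>u\<close>.\<close>
  moreover have "(y - z - \<rho> *\<^sub>R u) \<bullet> (y - z - \<rho> *\<^sub>R u) = (y - z) \<bullet> (y - z) - 2 * (\<rho> * ((y - z) \<bullet> u)) + \<rho> * \<rho>"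
    using uu by (simp add: inner_diff_left inner_diff_right inner_commute algebra_simps)
  ultimately have "(y - z - \<rho> *\<^sub>R u) \<bullet> (y - z - \<rho> *\<^sub>R u) \<le> 0" by linarith
  then have yz: "y = z + \<rho> *\<^sub>R u" by (metis inner_gt_zero_iff linorder_not_less diff_diff_add eq_iff_diff_eq_0)
  have tb: "tangent_ball K z \<rho> u"
    unfolding tangent_ball_def using \<rho> u zK yz by auto
  \<comment> \<open>The larger ball at the starting point also respects the supporting hyperplane.
    This bounds \<open>u \<bullet> d\<close> from below, so the remaining way to \<open>w\<close>
    rises by more than \<open>\<rho>\<close>.\<close>
  have "c + \<epsilon> *\<^sub>R u \<in> K" using u(1) c by (intro subsetD [OF c(2)]) (simp add: dist_norm)
  then have "u \<bullet> c + \<epsilon> \<le> u \<bullet> y" using u(2) uu by (force simp: inner_add_right)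
  then have ge: "\<epsilon> - \<rho> \<le> s * (u \<bullet> d)" using uu by (simp add: yz z_def inner_add_right)
  have s01: "0 \<le> s" "s \<le> 1" using s(1) by (auto simp: S_def)
  have ud: "\<epsilon> - \<rho> \<le> u \<bullet> d"
  proof -
    have "0 < s * (u \<bullet> d)" using ge \<rho> by linarith
    then have "0 \<le> u \<bullet> d" using s01 by (simp add: zero_less_mult_iff)
    then have "s * (u \<bullet> d) \<le> u \<bullet> d" using s01 by (simp add: mult_left_le_one_le)
    then show ?thesis using ge by linarith
  qed
  have "\<rho> < \<kappa> * (\<epsilon> - \<rho>)" by (rule \<rho>)
  also have "\<dots> \<le> (1 - s) * (u \<bullet> d)" using \<kappa>s ud \<rho> \<kappa> by (intro mult_mono) auto
  finally have "u \<bullet> (z + \<rho> *\<^sub>R u) < u \<bullet> w"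
    using uu by (simp add: z_def d_def inner_add_right inner_diff_right algebra_simps)
  with tb show thesis by (rule that)
qed

section \<open>From homothetic caps to a simplex\<close>

text \<open>Comparing the extreme values of \<open>u\<close> fixes the ratio of each homothety. The
  one of ratio 1/2 maps the lowest face onto itself, so that face is a point \<open>x0\<close>;
  every homothety is then centred at \<open>x0\<close>, and a point strictly between the extreme
  levels lies inside a segment starting at \<open>x0\<close>.\<close>

lemma caps_homothetic_imp_pyramid:
  fixes K :: "'a::euclidean_space set"
  assumes K: "convex K" "compact K" and int: "interior K \<noteq> {}" and u: "u \<noteq> 0"
    and M: "y0 \<in> K" "\<And>y. y \<in> K \<Longrightarrow> u \<bullet> y \<le> u \<bullet> y0"
    and caps: "\<And>\<gamma>. \<exists>x\<in>interior K. u \<bullet> x < \<gamma> \<Longrightarrow>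
      \<exists>v \<mu>. 0 \<le> \<mu> \<and> K \<inter> {x. u \<bullet> x \<le> \<gamma>} = (\<lambda>x. v + \<mu> *\<^sub>R x) ` K"
  obtains x0 where "u \<bullet> x0 < u \<bullet> y0" "\<And>e. e extreme_point_of K \<Longrightarrow> e \<noteq> x0 \<Longrightarrow> u \<bullet> e = u \<bullet> y0"
proof -
  let ?M = "u \<bullet> y0"
  have "K \<noteq> {}" using M by auto
  have "\<exists>x\<in>K. \<forall>y\<in>K. u \<bullet> x \<le> u \<bullet> y"
    by (rule continuous_attains_inf [OF K(2) \<open>K \<noteq> {}\<close>]) (intro continuous_intros)
  then obtain x0 where x0: "x0 \<in> K" "\<And>y. y \<in> K \<Longrightarrow> u \<bullet> x0 \<le> u \<bullet> y"
    by blast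
  let ?m = "u \<bullet> x0"
  have mM: "?m < ?M"
  proof (rule ccontr)
    assume "\<not> ?m < ?M"
    moreover have "u \<bullet> x0 \<le> u \<bullet> x" "u \<bullet> x \<le> ?M" if "x \<in> K" for x
      using x0(2) [OF that] M(2) [OF that] by blast+
    ultimately have "K \<subseteq> {x. u \<bullet> x = ?M}" by fastforce
    then have "interior K \<subseteq> interior {x. u \<bullet> x = ?M}" by (rule interior_mono)
    then show False using int u by simp
  qed
  have cap: "\<exists>v. K \<inter> {x. u \<bullet> x \<le> \<gamma>} = (\<lambda>x. v + ((\<gamma> - ?m) / (?M - ?m)) *\<^sub>R x) ` K \<and>
      u \<bullet> v = (1 - (\<gamma> - ?m) / (?M - ?m)) * ?m" if \<gamma>: "?m < \<gamma>" "\<gamma> < ?M" for \<gamma>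
  proof -
    \<comment> \<open>\<open>caps\<close> asks for an interior point below \<open>\<gamma>\<close>,
      whereas \<open>x0\<close> lies on the boundary.\<close>
    have "K = closure (interior K)"
      using convex_closure_interior [OF K(1) int] closure_closed [OF compact_imp_closed [OF K(2)]] by simp
    moreover have "open {x. u \<bullet> x < \<gamma>}" by (rule open_halfspace_lt)
    moreover have "x0 \<in> {x. u \<bullet> x < \<gamma>}" using \<gamma> by simp
    ultimately have "interior K \<inter> {x. u \<bullet> x < \<gamma>} \<noteq> {}"
      using x0(1) by (metis closure_iff_nhds_not_empty Int_commute order_refl)
    then obtain v \<mu> where v: "0 \<le> \<mu>" "K \<inter> {x. u \<bullet> x \<le> \<gamma>} = (\<lambda>x. v + \<mu> *\<^sub>R x) ` K"
      using caps by blast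
    have "x0 \<in> (\<lambda>x. v + \<mu> *\<^sub>R x) ` K" unfolding v(2) [symmetric] using x0(1) \<gamma> by simp
    then obtain x where x: "x \<in> K" "v + \<mu> *\<^sub>R x = x0" by blast
    have le: "?m \<le> u \<bullet> v + \<mu> * (u \<bullet> y)" "u \<bullet> v + \<mu> * (u \<bullet> y) \<le> \<gamma>" if "y \<in> K" for y
    proof -
      have "v + \<mu> *\<^sub>R y \<in> K \<inter> {x. u \<bullet> x \<le> \<gamma>}" using that v(2) by blast
      then show "?m \<le> u \<bullet> v + \<mu> * (u \<bullet> y)" "u \<bullet> v + \<mu> * (u \<bullet> y) \<le> \<gamma>"
        using x0(2) [of "v + \<mu> *\<^sub>R y"] by (auto simp: inner_add_right)
    qed
    have low: "u \<bullet> v + \<mu> * ?m = ?m"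
    proof (rule antisym)
      have "u \<bullet> v + \<mu> * ?m \<le> u \<bullet> v + \<mu> * (u \<bullet> x)" using x0(2) [OF x(1)] v(1) by (simp add: mult_left_mono)
      also have "\<dots> = ?m" using arg_cong [OF x(2), of "\<lambda>z. u \<bullet> z"] by (simp add: inner_add_right)
      finally show "u \<bullet> v + \<mu> * ?m \<le> ?m" .
    qed (use le x0 in auto)
    \<comment> \<open>A point of \<open>K\<close> exactly at level \<open>\<gamma>\<close>: it shows
      that the cap attains the value \<open>\<gamma>\<close>, which determines
      \<open>\<mu>\<close>.\<close>
    define p where "p = x0 + ((\<gamma> - ?m) / (?M - ?m)) *\<^sub>R (y0 - x0)"
    have "u \<bullet> p = \<gamma>" using mM by (simp add: p_def inner_add_right inner_diff_right)
    moreover have "p \<in> K"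
    proof -
      have "p = (1 - (\<gamma> - ?m) / (?M - ?m)) *\<^sub>R x0 + ((\<gamma> - ?m) / (?M - ?m)) *\<^sub>R y0"
        by (simp add: p_def algebra_simps)
      then show ?thesis using \<gamma> mM x0(1) M(1) by (simp only:) (intro convexD_alt K; simp)
    qed
    ultimately have "p \<in> (\<lambda>x. v + \<mu> *\<^sub>R x) ` K" using v(2) by auto
    then obtain y where y: "y \<in> K" "p = v + \<mu> *\<^sub>R y" by blast
    have high: "u \<bullet> v + \<mu> * ?M = \<gamma>"
    proof (rule antisym)
      have "\<gamma> = u \<bullet> v + \<mu> * (u \<bullet> y)" using \<open>u \<bullet> p = \<gamma>\<close> y by (simp add: inner_add_right)
      also have "\<dots> \<le> u \<bullet> v + \<mu> * ?M" using M(2) [OF y(1)] v(1) by (simp add: mult_left_mono)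
      finally show "\<gamma> \<le> u \<bullet> v + \<mu> * ?M" .
    qed (use le M in auto)
    have "\<mu> * (?M - ?m) = \<gamma> - ?m" using low high by (simp add: algebra_simps)
    then have "\<mu> = (\<gamma> - ?m) / (?M - ?m)" using mM by (simp add: field_simps)
    then show ?thesis using v(2) low by (auto simp: algebra_simps)
  qed
  have uniq: "x = x0" if x: "x \<in> K" "u \<bullet> x = ?m" for x
  proof -
    define F where "F = K \<inter> {x. u \<bullet> x = ?m}"
    define \<mu> :: real where "\<mu> = 1 / 2"
    define \<gamma> where "\<gamma> = (?m + ?M) / 2"
    have \<gamma>: "?m < \<gamma>" "\<gamma> < ?M" and q: "(\<gamma> - ?m) / (?M - ?m) = \<mu>"
      using mM by (auto simp: \<gamma>_def \<mu>_def field_simps)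
    obtain v where v: "K \<inter> {x. u \<bullet> x \<le> \<gamma>} = (\<lambda>x. v + \<mu> *\<^sub>R x) ` K" "u \<bullet> v = (1 - \<mu>) * ?m"
      using cap [OF \<gamma>] unfolding q by blast
    have cF: "compact F" unfolding F_def by (intro compact_Int_closed K closed_hyperplane)
    have neF: "F \<noteq> {}" using x0 by (auto simp: F_def)
    \<comment> \<open>The fixed point of \<open>x \<mapsto> v + x / 2\<close>. A point of the face
      farthest from it has its preimage in the face at twice the distance, so that distance is
      0.\<close>
    define o' where "o' = 2 *\<^sub>R v"
    have "\<exists>f\<in>F. \<forall>g\<in>F. dist g o' \<le> dist f o'"
      by (rule continuous_attains_sup [OF cF neF]) (intro continuous_intros)
    then obtain f where f: "f \<in> F" "\<And>g. g \<in> F \<Longrightarrow> dist g o' \<le> dist f o'"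
      by blast
    have "f \<in> K \<inter> {x. u \<bullet> x \<le> \<gamma>}" using f(1) \<gamma> by (auto simp: F_def)
    then obtain g where g: "g \<in> K" "f = v + \<mu> *\<^sub>R g" unfolding v(1) by blast
    have gF: "g \<in> F"
      using f(1) g v(2) by (auto simp: F_def \<mu>_def inner_add_right)
    have "dist f o' = \<mu> * dist g o'"
    proof -
      have "v + \<mu> *\<^sub>R o' = o'"
        unfolding o'_def \<mu>_def by (simp, rule scaleR_2 [symmetric])
      then have "f - o' = \<mu> *\<^sub>R (g - o')"
        unfolding g(2) by (metis add_diff_cancel_left scaleR_diff_right)
      then show ?thesis by (simp add: dist_norm \<mu>_def)
    qed
    then have "dist f o' \<le> 0" using f(2) [OF gF] unfolding \<mu>_def by linarith
    then have "h = o'" if "h \<in> F" for h using f(2) [OF that] by simp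
    then show ?thesis using x x0 by (auto simp: F_def)
  qed
  show thesis
  proof (rule that [OF mM])
    fix e assume e: "e extreme_point_of K" "e \<noteq> x0"
    then have eK: "e \<in> K" by (simp add: extreme_point_of_def)
    show "u \<bullet> e = ?M"
    proof (rule ccontr)
      assume "u \<bullet> e \<noteq> ?M"
      then have "u \<bullet> e < ?M" using M(2) [OF eK] by simp
      moreover have "?m < u \<bullet> e" using x0(2) [OF eK] uniq [OF eK] e(2) by fastforce
      ultimately obtain v where v: "K \<inter> {x. u \<bullet> x \<le> u \<bullet> e} = (\<lambda>x. v + ((u \<bullet> e - ?m) / (?M - ?m)) *\<^sub>R x) ` K"
        "u \<bullet> v = (1 - (u \<bullet> e - ?m) / (?M - ?m)) * ?m"
        using cap by blast
      define \<mu> where "\<mu> = (u \<bullet> e - ?m) / (?M - ?m)"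
      have \<mu>: "0 < \<mu>" "\<mu> < 1" using mM \<open>u \<bullet> e < ?M\<close> \<open>?m < u \<bullet> e\<close> by (auto simp: \<mu>_def)
      have "e \<in> (\<lambda>x. v + \<mu> *\<^sub>R x) ` K" using v(1) eK by (auto simp: \<mu>_def)
      then obtain y where y: "y \<in> K" "e = v + \<mu> *\<^sub>R y" by blast
      have "x0 \<in> (\<lambda>x. v + \<mu> *\<^sub>R x) ` K" using v(1) x0(1) \<open>?m < u \<bullet> e\<close> by (auto simp: \<mu>_def)
      then obtain x where x: "x \<in> K" "x0 = v + \<mu> *\<^sub>R x" by blast
      \<comment> \<open>The preimage of \<open>x0\<close> is again at the lowest level, hence is
        \<open>x0\<close> itself, and \<open>x0\<close> is the centre of the homothety.\<close>
      have "u \<bullet> x = ?m"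
        using arg_cong [OF x(2), of "\<lambda>z. u \<bullet> z"] v(2) \<mu> by (simp add: inner_add_right \<mu>_def [symmetric] algebra_simps)
      then have "x = x0" using uniq x by blast
      then have "e = (1 - \<mu>) *\<^sub>R x0 + \<mu> *\<^sub>R y"
        using x(2) y(2) by (simp add: algebra_simps)
      moreover have "x0 \<noteq> y"
        using calculation e(2) by (auto simp: algebra_simps)
      ultimately have "e \<in> open_segment x0 y" using \<mu> by (auto simp: in_segment)
      then show False using e(1) x0(1) y(1) by (auto simp: extreme_point_of_def)
    qed
  qed
qed

text \<open>For each extreme point \<open>e\<close> a tangent hyperplane avoiding \<open>e\<close>
  is found. Then \<open>e\<close> must be the apex of the pyramid, all other extreme points lie in
  the hyperplane, and \<open>e\<close> is outside their affine hull.\<close>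

lemma simplex_if_caps_homothetic:
  fixes K :: "'a::euclidean_space set"
  assumes K: "convex K" "compact K" and int: "interior K \<noteq> {}"
    and caps: "\<And>c r u \<gamma>. tangent_ball K c r u \<Longrightarrow> \<exists>x\<in>interior K. u \<bullet> x < \<gamma> \<Longrightarrow>
      \<exists>v \<mu>. 0 \<le> \<mu> \<and> K \<inter> {x. u \<bullet> x \<le> \<gamma>} = (\<lambda>x. v + \<mu> *\<^sub>R x) ` K"
  shows "\<exists>m. m simplex K"
proof -
  define E where "E = {e. e extreme_point_of K}"
  have hull: "K = convex hull E" unfolding E_def by (rule Krein_Milman_Minkowski [OF K(2,1)])
  have pyramid: "\<exists>x0. u \<bullet> x0 < u \<bullet> (c + r *\<^sub>R u) \<and> (\<forall>e\<in>E. e \<noteq> x0 \<longrightarrow> u \<bullet> e = u \<bullet> (c + r *\<^sub>R u))"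
    if tb: "tangent_ball K c r u" for c r u
  proof -
    have "c + r *\<^sub>R u \<in> K" "u \<noteq> 0" "\<And>y. y \<in> K \<Longrightarrow> u \<bullet> y \<le> u \<bullet> (c + r *\<^sub>R u)"
      using tb by (auto simp: tangent_ball_def dist_norm intro!: subsetD [of "cball c r" K])
    then show ?thesis
      using caps_homothetic_imp_pyramid [OF K int _ _ _ caps [OF tb]] unfolding E_def by (metis mem_Collect_eq)
  qed
  have "e \<notin> affine hull (E - {e})" if e: "e \<in> E" for e
  proof -
    have eK: "e \<in> K" using e by (simp add: E_def extreme_point_of_def)
    obtain i where i: "i \<in> interior K" "i \<noteq> e"
    proof -
      have "interior K \<noteq> {e}" by (metis open_interior not_open_singleton)
      then show thesis using that int by blast
    qed
    have iK: "i \<in> K" using i interior_subset by blast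
    \<comment> \<open>A point beyond \<open>K\<close> on the ray from \<open>e\<close> through the
      interior point \<open>i\<close>. A supporting hyperplane through \<open>e\<close> would have
      the whole ray on the side of \<open>K\<close>, so one that cuts this point off cannot contain
      \<open>e\<close>.\<close>
    obtain s where s: "1 \<le> s" "e + s *\<^sub>R (i - e) \<notin> K"
    proof -
      obtain R where R: "\<And>x. x \<in> K \<Longrightarrow> dist e x \<le> R"
        using compact_imp_bounded [OF K(2)] bounded_any_center [of K e] by metis
      define s where "s = max 1 ((R + 1) / norm (i - e))"
      have "(R + 1) / norm (i - e) * norm (i - e) \<le> s * norm (i - e)" by (intro mult_right_mono) (auto simp: s_def)
      then have "R < s * norm (i - e)" using i by simp
      moreover have "0 \<le> s" by (simp add: s_def)
      ultimately have "e + s *\<^sub>R (i - e) \<notin> K" using R [of "e + s *\<^sub>R (i - e)"] by (auto simp: dist_norm)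
      moreover have "1 \<le> s" by (simp add: s_def)
      ultimately show thesis using that by blast
    qed
    obtain c r u where tb: "tangent_ball K c r u" "u \<bullet> (c + r *\<^sub>R u) < u \<bullet> (e + s *\<^sub>R (i - e))"
      using tangent_ball_separating [OF K int s(2)] by blast
    let ?M = "u \<bullet> (c + r *\<^sub>R u)"
    obtain x0 where x0: "u \<bullet> x0 < ?M" "\<And>e'. e' \<in> E \<Longrightarrow> e' \<noteq> x0 \<Longrightarrow> u \<bullet> e' = ?M"
      using pyramid [OF tb(1)] by blast
    have "u \<bullet> e \<noteq> ?M"
    proof
      assume eM: "u \<bullet> e = ?M"
      have "u \<bullet> i \<le> ?M" using tb(1) iK by (simp add: tangent_ball_def)
      then have "s * (u \<bullet> i - u \<bullet> e) \<le> 0" using s eM by (intro mult_nonneg_nonpos) auto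
      then have "u \<bullet> (e + s *\<^sub>R (i - e)) \<le> u \<bullet> e"
        by (simp add: inner_add_right inner_diff_right)
      with tb(2) eM show False by simp
    qed
    then have "E - {e} \<subseteq> {x. u \<bullet> x = ?M}" using x0(2) e by auto
    then have "affine hull (E - {e}) \<subseteq> {x. u \<bullet> x = ?M}" by (intro hull_minimal affine_hyperplane)
    then show ?thesis using \<open>u \<bullet> e \<noteq> ?M\<close> by auto
  qed
  then have ind: "\<not> affine_dependent E" by (auto simp: affine_dependent_def)
  show ?thesis
    unfolding simplex_def using ind hull by (intro exI [of _ "int (card E) - 1"] exI [of _ E]) simp
qed

section \<open>The equality case\<close>

lemma AE_lborel_open_ex:
  fixes S :: "'a::euclidean_space set"
  assumes "AE x in lborel. P x" "open S" "S \<noteq> {}"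
  obtains x where "x \<in> S" "P x"
proof -
  obtain N where N: "{x. \<not> P x} \<subseteq> N" "N \<in> null_sets lborel"
    using assms(1) by (auto elim!: AE_E simp: null_sets_def)
  have "N \<in> null_sets lebesgue" using N(2) by (rule null_sets_completionI)
  then have "negligible N" by (simp add: negligible_iff_null_sets)
  then have "\<not> S \<subseteq> N" using assms open_not_negligible negligible_subset by blast
  then show thesis using N(1) that by blast
qed

lemma eq_if_measure_le:
  fixes G H :: "'a::euclidean_space set"
  assumes G: "compact G" "convex G" "interior G \<noteq> {}" and H: "compact H" "H \<subseteq> G"
    and le: "measure lebesgue G \<le> measure lebesgue H"
  shows "G = H"
proof -
  have meas: "G \<in> lmeasurable" "H \<in> lmeasurable" using G H lmeasurable_compact by auto
  have "measure lebesgue (G - H) = measure lebesgue G - measure lebesgue H"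
    using meas H by (intro measurable_measure_Diff) auto
  then have "measure lebesgue (G - H) = 0" using le measure_nonneg [of lebesgue "G - H"] by linarith
  moreover have "G - H \<in> lmeasurable" using meas by (intro fmeasurable.Diff)
  ultimately have "negligible (G - H)" using negligible_iff_measure by blast
  then have "negligible (interior G - H)" by (rule negligible_subset) (use interior_subset in blast)
  moreover have "open (interior G - H)" using compact_imp_closed [OF H(1)] by (intro open_Diff) auto
  ultimately have "interior G - H = {}" using open_not_negligible by blast
  then have "closure (interior G) \<subseteq> H" using compact_imp_closed [OF H(1)] by (intro closure_minimal) auto
  then show ?thesis
    using convex_closure_interior [OF G(2,3)] closure_subset [of G] H(2) by blast
qed

context
  fixes K :: "'a::euclidean_space set"
  assumes K: "convex_body K" and int: "interior K \<noteq> {}"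
begin

text \<open>Positive volume excludes a zero bound, so the fibre contains a homothet of at least its
  own volume; a compact subset of full volume in a convex body is the whole body.\<close>

lemma join_fibre_homothetic:
  assumes "emeasure lborel (join_fibre K q) \<le> fibre_bound K q" "interior (join_fibre K q) \<noteq> {}"
  obtains v \<mu> where "0 \<le> \<mu>" "join_fibre K q = (\<lambda>x. v + \<mu> *\<^sub>R x) ` K"
proof -
  note G = join_fibre_convex_compact [OF K, of q]
  have pos: "0 < measure lebesgue (join_fibre K q)" using measure_pos_if_interior [OF G] assms(2) by blast
  then have "fibre_bound K q \<noteq> 0" using assms(1) emeasure_lborel_compact [OF G(1)] by auto
  then obtain \<mu> v where H: "0 \<le> \<mu>" "(\<lambda>x. v + \<mu> *\<^sub>R x) ` K \<subseteq> join_fibre K q"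
      "fibre_bound K q \<le> emeasure lborel ((\<lambda>x. v + \<mu> *\<^sub>R x) ` K)"
    using fibre_bound_cases [OF K, of q] by blast
  have cH: "compact ((\<lambda>x. v + \<mu> *\<^sub>R x) ` K)"
    using K by (intro compact_continuous_image continuous_intros) (simp add: convex_body_def)
  have "ennreal (measure lebesgue (join_fibre K q)) \<le> ennreal (measure lebesgue ((\<lambda>x. v + \<mu> *\<^sub>R x) ` K))"
    using order.trans [OF assms(1) H(3)] by (simp only: emeasure_lborel_compact [OF G(1)] emeasure_lborel_compact [OF cH])
  then have "measure lebesgue (join_fibre K q) \<le> measure lebesgue ((\<lambda>x. v + \<mu> *\<^sub>R x) ` K)"
    by simp
  then have "join_fibre K q = (\<lambda>x. v + \<mu> *\<^sub>R x) ` K"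
    by (intro eq_if_measure_le G assms(2) cH H(2))
  with H(1) show thesis by (rule that)
qed

text \<open>A selection argument carried out on the parameters of the homotheties, which stay in a
  compact set. Since it only yields a subsequence, \<open>outer\<close> is stated along arbitrary
  subsequences; \<open>inner\<close> and \<open>outer\<close> together say that the sets
  \<open>A k\<close> converge to \<open>G\<close>.\<close>

lemma homothetic_limit:
  assumes G: "closed G" and U: "G \<subseteq> closure U" "U \<noteq> {}"
    and hom: "\<forall>\<^sub>F k in sequentially. \<exists>v \<mu>. 0 \<le> \<mu> \<and> A k = (\<lambda>x. v + \<mu> *\<^sub>R x) ` K"
    and bdd: "\<And>k. A k \<subseteq> cball 0 R"
    and inner: "\<And>x. x \<in> U \<Longrightarrow> \<forall>\<^sub>F k in sequentially. x \<in> A k"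
    and outer: "\<And>r f x. strict_mono (r :: nat \<Rightarrow> nat) \<Longrightarrow> \<forall>\<^sub>F k in sequentially. f k \<in> A (r k) \<Longrightarrow> f \<longlonglongrightarrow> x \<Longrightarrow> x \<in> G"
  shows "\<exists>v \<mu>. 0 \<le> \<mu> \<and> G = (\<lambda>x. v + \<mu> *\<^sub>R x) ` K"
proof -
  have cK: "compact K" using K by (simp add: convex_body_def)
  obtain k0 where k0': "\<forall>k\<ge>k0. \<exists>v \<mu>. 0 \<le> \<mu> \<and> A k = (\<lambda>x. v + \<mu> *\<^sub>R x) ` K"
    using hom unfolding eventually_sequentially by (rule exE)
  have "\<forall>k\<in>{k0..}. \<exists>h. 0 \<le> snd h \<and> A k = (\<lambda>x. fst h + snd h *\<^sub>R x) ` K"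
  proof
    fix k assume "k \<in> {k0..}"
    then obtain v \<mu> where "0 \<le> \<mu>" "A k = (\<lambda>x. v + \<mu> *\<^sub>R x) ` K" using k0' by auto
    then show "\<exists>h. 0 \<le> snd h \<and> A k = (\<lambda>x. fst h + snd h *\<^sub>R x) ` K"
      by (intro exI [of _ "(v, \<mu>)"]) simp
  qed
  from bchoice [OF this] obtain h where h: "\<forall>k\<in>{k0..}. 0 \<le> snd (h k) \<and> A k = (\<lambda>x. fst (h k) + snd (h k) *\<^sub>R x) ` K"
    by (rule exE)
  define v \<mu> where "v k = fst (h k)" and "\<mu> k = snd (h k)" for k
  have k0: "0 \<le> \<mu> k" "A k = (\<lambda>x. v k + \<mu> k *\<^sub>R x) ` K" if "k0 \<le> k" for k
    using h that by (simp_all add: v_def \<mu>_def)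
  \<comment> \<open>Two distinct points of \<open>K\<close>: their images stay within a bounded
    distance, which bounds the ratios \<open>\<mu> k\<close> and then the translations.\<close>
  obtain y where y: "y \<in> interior K" using int by blast
  then have "interior K \<noteq> {y}" by (metis open_interior not_open_singleton)
  then obtain x where x: "x \<in> interior K" "x \<noteq> y" using y by blast
  have xyK: "x \<in> K" "y \<in> K" using x y interior_subset by auto
  have bd: "norm (v k + \<mu> k *\<^sub>R z) \<le> R" if "k0 \<le> k" "z \<in> K" for k z
    using bdd [of k] k0(2) [OF that(1)] that(2) by auto
  have "\<mu> k * norm (x - y) \<le> 2 * R" if k: "k0 \<le> k" for k
  proof -
    have "\<mu> k * norm (x - y) = norm ((v k + \<mu> k *\<^sub>R x) - (v k + \<mu> k *\<^sub>R y))"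
      using k0(1) [OF k] by (simp add: scaleR_diff_right [symmetric])
    also have "\<dots> \<le> R + R" using bd [OF k xyK(1)] bd [OF k xyK(2)] by (rule norm_triangle_le_diff [OF add_mono])
    finally show ?thesis by simp
  qed
  then have mu_bd: "\<mu> k \<in> {0..2 * R / norm (x - y)}" if "k0 \<le> k" for k
    using k0(1) that x by (auto simp: field_simps)
  have v_bd: "v k \<in> cball 0 (R + 2 * R / norm (x - y) * norm x)" if k: "k0 \<le> k" for k
  proof -
    have "norm (v k) \<le> norm (v k + \<mu> k *\<^sub>R x) + norm (\<mu> k *\<^sub>R x)"
      by (metis add_diff_cancel_right' norm_triangle_ineq4)
    also have "\<dots> \<le> R + 2 * R / norm (x - y) * norm x"
    proof (rule add_mono [OF bd [OF k xyK(1)]])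
      have "norm (\<mu> k *\<^sub>R x) = \<mu> k * norm x" using k0(1) [OF k] by simp
      also have "\<dots> \<le> 2 * R / norm (x - y) * norm x"
        using mu_bd [OF k] by (intro mult_right_mono norm_ge_zero) simp
      finally show "norm (\<mu> k *\<^sub>R x) \<le> 2 * R / norm (x - y) * norm x" .
    qed
    finally show ?thesis by simp
  qed
  define T where "T = {0..2 * R / norm (x - y)} \<times> cball (0 :: 'a) (R + 2 * R / norm (x - y) * norm x)"
  have "seq_compact T"
    unfolding T_def compact_eq_seq_compact_metric [symmetric]
    by (intro compact_Times compact_Icc compact_cball)
  moreover have "\<forall>k. (\<mu> (k + k0), v (k + k0)) \<in> T"
    unfolding T_def using mu_bd v_bd by (intro allI SigmaI) auto
  ultimately obtain l s where l0: "strict_mono s" "((\<lambda>k. (\<mu> (k + k0), v (k + k0))) \<circ> s) \<longlonglongrightarrow> l"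
    by (rule seq_compactE)
  have l: "strict_mono s" "(\<lambda>k. (\<mu> (s k + k0), v (s k + k0))) \<longlonglongrightarrow> l"
    using l0 by (simp_all add: o_def)
  define r where "r k = s k + k0" for k
  obtain m w where mw: "l = (m, w)" by (cases l)
  have r: "strict_mono r" using l(1) by (simp add: r_def strict_mono_def)
  have rk0: "k0 \<le> r k" for k by (simp add: r_def)
  have lim: "(\<lambda>k. \<mu> (r k)) \<longlonglongrightarrow> m" "(\<lambda>k. v (r k)) \<longlonglongrightarrow> w"
    using tendsto_fst [OF l(2)] tendsto_snd [OF l(2)] by (simp_all add: mw r_def)
  have m: "0 \<le> m" using lim(1) k0(1) [OF rk0] by (intro LIMSEQ_le_const) auto
  have "(\<lambda>x. w + m *\<^sub>R x) ` K \<subseteq> G"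
  proof clarify
    fix z assume z: "z \<in> K"
    have "\<forall>\<^sub>F k in sequentially. v (r k) + \<mu> (r k) *\<^sub>R z \<in> A (r k)"
      unfolding k0(2) [OF rk0] by (intro always_eventually allI imageI z)
    moreover have "(\<lambda>k. v (r k) + \<mu> (r k) *\<^sub>R z) \<longlonglongrightarrow> w + m *\<^sub>R z" by (intro tendsto_intros lim)
    ultimately show "w + m *\<^sub>R z \<in> G" by (rule outer [OF r])
  qed
  moreover have "U \<subseteq> (\<lambda>x. w + m *\<^sub>R x) ` K"
  proof
    fix z assume "z \<in> U"
    then have "\<forall>\<^sub>F k in sequentially. z \<in> A (r k)"
      using inner eventually_subseq [OF r] by blast
    then have ev: "\<forall>\<^sub>F k in sequentially. (\<mu> (r k), z - v (r k)) \<in> {(b, v). 0 \<le> b \<and> v \<in> (\<lambda>x. b *\<^sub>R x) ` K}"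
      by eventually_elim (use k0 rk0 in auto)
    have "(\<lambda>k. (\<mu> (r k), z - v (r k))) \<longlonglongrightarrow> (m, z - w)" by (intro tendsto_intros lim)
    then have "(m, z - w) \<in> {(b, v). 0 \<le> b \<and> v \<in> (\<lambda>x. b *\<^sub>R x) ` K}"
      by (intro Lim_in_closed_set [OF closed_dilates [OF cK] ev]) auto
    then obtain t where "t \<in> K" "z - w = m *\<^sub>R t" by auto
    then have "z = w + m *\<^sub>R t" by (metis add.commute diff_add_cancel)
    then show "z \<in> (\<lambda>x. w + m *\<^sub>R x) ` K" using \<open>t \<in> K\<close> by blast
  qed
  moreover have "closed ((\<lambda>x. w + m *\<^sub>R x) ` K)"
    by (intro compact_imp_closed compact_continuous_image continuous_intros cK)
  ultimately have "G = (\<lambda>x. w + m *\<^sub>R x) ` K"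
    using U(1) closure_minimal by blast
  with m show ?thesis by blast
qed

lemma cap_homothetic:
  fixes p :: "'p::finite itself"
  assumes AE: "AE q in lborel. emeasure lborel (join_fibre K (q :: real \<times> real \<times> ('a^'p))) \<le> fibre_bound K q"
    and tb: "tangent_ball K c \<rho> u" and \<gamma>: "\<exists>x\<in>interior K. u \<bullet> x < \<gamma>"
  shows "\<exists>v \<mu>. 0 \<le> \<mu> \<and> K \<inter> {x. u \<bullet> x \<le> \<gamma>} = (\<lambda>x. v + \<mu> *\<^sub>R x) ` K"
proof -
  have cK: "compact K" "convex K" using K by (auto simp: convex_body_def)
  have \<rho>: "0 < \<rho>" and nu: "norm u = 1" and ball: "cball c \<rho> \<subseteq> K"
    and sup: "\<And>y. y \<in> K \<Longrightarrow> u \<bullet> y \<le> u \<bullet> (c + \<rho> *\<^sub>R u)"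
    using tb by (auto simp: tangent_ball_def)
  have uu: "u \<bullet> u = 1" using nu by (simp add: norm_eq_1)
  define y0 where "y0 = c + \<rho> *\<^sub>R u"
  \<comment> \<open>The fibre over this point consists of the \<open>v\<close> in \<open>K\<close>
    with \<open>v - \<gamma> u\<close> in \<open>k (K - y0)\<close>. As k grows, these dilates
    approach the half-space below the tangent hyperplane, so the condition becomes
    \<open>u \<bullet> v \<le> \<gamma>\<close>.\<close>
  define q0 :: "nat \<Rightarrow> real \<times> real \<times> ('a^'p)" where
    "q0 k = (real k, 1, diag_emb (real k *\<^sub>R y0 - \<gamma> *\<^sub>R u))" for k
  \<comment> \<open>The hypothesis holds only almost everywhere, so \<open>q0 k\<close> is replaced
    by a nearby good point. The absolute error has to tend to 0 because the offset
    \<open>\<gamma> u\<close> is not scaled with k.\<close>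
  have "\<exists>q. dist (q0 k) q < 1 / real (Suc k) \<and> emeasure lborel (join_fibre K q) \<le> fibre_bound K q" for k
  proof (rule AE_lborel_open_ex [OF AE open_ball])
    show "ball (q0 k) (1 / real (Suc k)) \<noteq> {}" by simp
    show ?thesis if "q \<in> ball (q0 k) (1 / real (Suc k))" "emeasure lborel (join_fibre K q) \<le> fibre_bound K q" for q
      using that unfolding mem_ball by blast
  qed
  then obtain q where q: "\<And>k. dist (q0 k) (q k) < 1 / real (Suc k)"
    "\<And>k. emeasure lborel (join_fibre K (q k)) \<le> fibre_bound K (q k)"
    by metis
  define a where "a k = fst (q k)" for k
  define b where "b k = fst (snd (q k))" for k
  define z where "z k = snd (snd (q k))" for k
  define e where "e i k = z k $ i - (real k *\<^sub>R y0 - \<gamma> *\<^sub>R u)" for i k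
  have q_eq: "q k = (a k, b k, z k)" for k by (simp add: a_def b_def z_def)
  have l0: "(\<lambda>k. q k - q0 k) \<longlonglongrightarrow> 0"
  proof (rule Lim_null_comparison [OF _ LIMSEQ_inverse_real_of_nat])
    show "\<forall>\<^sub>F k in sequentially. norm (q k - q0 k) \<le> inverse (real (Suc k))"
      using q(1) by (auto simp: dist_norm norm_minus_commute inverse_eq_divide intro!: always_eventually less_imp_le)
  qed
  have lim: "(\<lambda>k. a k - real k) \<longlonglongrightarrow> 0" "(\<lambda>k. b k - 1) \<longlonglongrightarrow> 0"
      "(\<lambda>k. z k - diag_emb (real k *\<^sub>R y0 - \<gamma> *\<^sub>R u)) \<longlonglongrightarrow> 0"
    using tendsto_fst [OF l0] tendsto_fst [OF tendsto_snd [OF l0]] tendsto_snd [OF tendsto_snd [OF l0]]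
    by (simp_all add: q0_def a_def b_def z_def)
  have lim_e: "e i \<longlonglongrightarrow> 0" for i
  proof -
    have "e i = (\<lambda>k. z k $ i - (real k *\<^sub>R y0 - \<gamma> *\<^sub>R u))" by (simp add: fun_eq_iff e_def)
    then show ?thesis using tendsto_vec_nth [OF lim(3), of i] by simp
  qed
  have lim_b: "b \<longlonglongrightarrow> 1" using LIM_zero_cancel [OF lim(2)] .
  have lim_a: "filterlim a at_top sequentially"
    using filterlim_tendsto_add_at_top [OF lim(1) filterlim_real_sequentially] by simp
  let ?G = "K \<inter> {x. u \<bullet> x \<le> \<gamma>}" and ?U = "interior K \<inter> {x. u \<bullet> x < \<gamma>}"
  obtain x1 where x1: "x1 \<in> ?U" using \<gamma> by auto
  have inner: "\<forall>\<^sub>F k in sequentially. w k \<in> join_fibre K (q k)" if x: "x \<in> ?U" and w: "w \<longlonglongrightarrow> x" for w x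
  proof -
    have "\<forall>\<^sub>F k in sequentially. z k $ i + w k \<in> (\<lambda>x. a k *\<^sub>R x) ` K" for i
    proof -
      \<comment> \<open>The displacement of \<open>z k $ i + w k\<close> from
        \<open>a k *\<^sub>R y0\<close>; its limit \<open>x - \<gamma> u\<close> has negative
        component along \<open>u\<close>.\<close>
      define h where "h k = e i k - \<gamma> *\<^sub>R u + w k - (a k - real k) *\<^sub>R y0" for k
      have h: "h \<longlonglongrightarrow> 0 - \<gamma> *\<^sub>R u + x - 0 *\<^sub>R y0"
        unfolding h_def by (intro tendsto_intros lim_e w lim)
      have "(\<lambda>k. 2 * \<rho> * (u \<bullet> h k) + norm (h k) ^ 2 * inverse (a k)) \<longlonglongrightarrow>
        2 * \<rho> * (u \<bullet> (0 - \<gamma> *\<^sub>R u + x - 0 *\<^sub>R y0)) + norm (0 - \<gamma> *\<^sub>R u + x - 0 *\<^sub>R y0) ^ 2 * 0"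
        by (intro tendsto_intros h tendsto_inverse_0_at_top lim_a)
      moreover have "2 * \<rho> * (u \<bullet> (0 - \<gamma> *\<^sub>R u + x - 0 *\<^sub>R y0)) + norm (0 - \<gamma> *\<^sub>R u + x - 0 *\<^sub>R y0) ^ 2 * 0 < 0"
        using \<rho> x uu by (simp add: inner_add_right inner_diff_right mult_less_0_iff)
      ultimately have "\<forall>\<^sub>F k in sequentially. 2 * \<rho> * (u \<bullet> h k) + norm (h k) ^ 2 * inverse (a k) < 0"
        by (rule order_tendstoD(2))
      moreover have "\<forall>\<^sub>F k in sequentially. 0 < a k" using lim_a by (simp add: filterlim_at_top_dense)
      ultimately show ?thesis
      proof eventually_elim
        case (elim k)
        have hz: "z k $ i + w k = a k *\<^sub>R y0 + h k" by (simp add: h_def e_def algebra_simps)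
        \<comment> \<open>The bracket tends to
          \<open>2 \<rho> (u \<bullet> x - \<gamma>) < 0\<close>, its quadratic part being O(1/a).
          So the rescaled point lies in the tangent ball; this is where the ball is used.\<close>
        have "(norm (\<rho> *\<^sub>R u + inverse (a k) *\<^sub>R h k))\<^sup>2 =
            \<rho>\<^sup>2 + inverse (a k) * (2 * \<rho> * (u \<bullet> h k) + norm (h k) ^ 2 * inverse (a k))"
          using uu unfolding power2_norm_eq_inner
          by (simp add: inner_add_left inner_add_right inner_commute power2_eq_square algebra_simps)
        also have "\<dots> \<le> \<rho>\<^sup>2"
          using elim by (simp add: mult_le_0_iff)
        finally have "norm (\<rho> *\<^sub>R u + inverse (a k) *\<^sub>R h k) \<le> \<rho>"
          using \<rho> by (simp add: power2_le_iff_abs_le)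
        moreover have "c - (y0 + inverse (a k) *\<^sub>R h k) = - (\<rho> *\<^sub>R u + inverse (a k) *\<^sub>R h k)"
          by (simp add: y0_def)
        ultimately have "y0 + inverse (a k) *\<^sub>R h k \<in> cball c \<rho>"
          by (simp only: mem_cball dist_norm norm_minus_cancel)
        then have "y0 + inverse (a k) *\<^sub>R h k \<in> K" using ball by blast
        moreover have "z k $ i + w k = a k *\<^sub>R (y0 + inverse (a k) *\<^sub>R h k)"
          using elim by (simp add: hz scaleR_add_right)
        ultimately show ?case by blast
      qed
    qed
    then have "\<forall>\<^sub>F k in sequentially. \<forall>i. z k $ i + w k \<in> (\<lambda>x. a k *\<^sub>R x) ` K"
      by (rule eventually_all_finite)
    moreover have "\<forall>\<^sub>F k in sequentially. 0 < a k" using lim_a by (simp add: filterlim_at_top_dense)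
    moreover have "\<forall>\<^sub>F k in sequentially. 0 < b k" using lim_b by (rule order_tendstoD) simp
    moreover have "\<forall>\<^sub>F k in sequentially. inverse (b k) *\<^sub>R w k \<in> interior K"
    proof (rule topological_tendstoD)
      show "(\<lambda>k. inverse (b k) *\<^sub>R w k) \<longlonglongrightarrow> inverse 1 *\<^sub>R x"
        by (intro tendsto_intros lim_b w) simp
      show "inverse 1 *\<^sub>R x \<in> interior K" using x by simp
    qed simp
    ultimately show ?thesis
    proof eventually_elim
      case (elim k)
      then have "w k = b k *\<^sub>R (inverse (b k) *\<^sub>R w k)" "inverse (b k) *\<^sub>R w k \<in> K"
        using interior_subset by auto
      then have "w k \<in> (\<lambda>x. b k *\<^sub>R x) ` K" by blast
      then show ?case using elim by (simp add: q_eq join_fibre_def)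
    qed
  qed
  have ball_in: "\<forall>\<^sub>F k in sequentially. ball x1 (1 / real (Suc k)) \<subseteq> join_fibre K (q k)"
  proof -
    \<comment> \<open>Fibres need interior points. A sequence that picks a point outside the fibre
      whenever the small ball contains one still converges to \<open>x1\<close>, so
      \<open>inner\<close> shows that eventually there is none.\<close>
    have "\<forall>k. \<exists>y. y \<in> ball x1 (1 / real (Suc k)) \<and>
        (\<not> ball x1 (1 / real (Suc k)) \<subseteq> join_fibre K (q k) \<longrightarrow> y \<notin> join_fibre K (q k))"
    proof
      fix k
      have "x1 \<in> ball x1 (1 / real (Suc k))" by simp
      then show "\<exists>y. y \<in> ball x1 (1 / real (Suc k)) \<and>
        (\<not> ball x1 (1 / real (Suc k)) \<subseteq> join_fibre K (q k) \<longrightarrow> y \<notin> join_fibre K (q k))"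
        by blast
    qed
    from choice [OF this] obtain w where w: "\<And>k. w k \<in> ball x1 (1 / real (Suc k))"
      "\<And>k. \<not> ball x1 (1 / real (Suc k)) \<subseteq> join_fibre K (q k) \<Longrightarrow> w k \<notin> join_fibre K (q k)"
      by blast
    have "(\<lambda>k. w k - x1) \<longlonglongrightarrow> 0"
    proof (rule Lim_null_comparison [OF _ LIMSEQ_inverse_real_of_nat], intro always_eventually allI)
      show "norm (w k - x1) \<le> inverse (real (Suc k))" for k
        using w(1) [of k] by (simp add: dist_norm norm_minus_commute inverse_eq_divide)
    qed
    then have "w \<longlonglongrightarrow> x1" by (rule LIM_zero_cancel)
    from inner [OF x1 this] show ?thesis by eventually_elim (use w(2) in blast)
  qed
  obtain R where R: "\<And>x. x \<in> K \<Longrightarrow> norm x \<le> R" using cK compact_imp_bounded bounded_iff by metis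
  show ?thesis
  proof (rule homothetic_limit [where A = "\<lambda>k. join_fibre K (q k)" and U = ?U and R = "2 * R"])
    show "closed ?G" by (intro closed_Int compact_imp_closed cK closed_halfspace_le)
    show "?U \<noteq> {}" using x1 by blast
    show "?G \<subseteq> closure ?U"
    proof
      fix x assume x: "x \<in> ?G"
      define f where "f k = x - inverse (real (Suc k)) *\<^sub>R (x - x1)" for k
      have "f k \<in> closure ?U" for k
      proof (rule subsetD [OF closure_subset])
        have le: "inverse (real (Suc k)) \<le> 1" by (simp add: inverse_le_1_iff)
        have "f k \<in> interior K"
          unfolding f_def using x x1 cK closure_subset le by (intro mem_interior_closure_convex_shrink) auto
        moreover have "u \<bullet> f k < \<gamma>"
        proof -
          define s where "s = inverse (real (Suc k))"
          have s: "0 < s" "s \<le> 1" using le by (auto simp: s_def)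
          have "u \<bullet> f k = (1 - s) * (u \<bullet> x) + s * (u \<bullet> x1)"
            unfolding f_def s_def [symmetric] by (simp add: inner_diff_right algebra_simps)
          also have "\<dots> < (1 - s) * \<gamma> + s * \<gamma>"
            using x x1 s by (intro add_le_less_mono mult_left_mono mult_strict_left_mono) auto
          finally show ?thesis by (simp add: algebra_simps)
        qed
        ultimately show "f k \<in> ?U" by simp
      qed
      moreover have "f \<longlonglongrightarrow> x - 0 *\<^sub>R (x - x1)"
        unfolding f_def by (intro tendsto_intros LIMSEQ_inverse_real_of_nat)
      ultimately show "x \<in> closure ?U" using closed_sequentially [OF closed_closure] by fastforce
    qed
    show "\<forall>\<^sub>F k in sequentially. \<exists>v \<mu>. 0 \<le> \<mu> \<and> join_fibre K (q k) = (\<lambda>x. v + \<mu> *\<^sub>R x) ` K"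
      using ball_in
    proof eventually_elim
      case (elim k)
      then have "ball x1 (1 / real (Suc k)) \<subseteq> interior (join_fibre K (q k))"
        by (intro interior_maximal) auto
      moreover have "x1 \<in> ball x1 (1 / real (Suc k))" by simp
      ultimately show ?case using join_fibre_homothetic [OF q(2)] by (metis empty_iff subsetD)
    qed
    show "join_fibre K (q k) \<subseteq> cball 0 (2 * R)" for k
    proof
      fix v assume "v \<in> join_fibre K (q k)"
      then obtain x where x: "x \<in> K" "v = b k *\<^sub>R x" "0 \<le> b k" by (auto simp: q_eq join_fibre_def)
      have "dist 1 (b k) \<le> dist (snd (q0 k)) (snd (q k))"
        using dist_fst_le [of "snd (q0 k)" "snd (q k)"] by (simp add: q0_def b_def)
      also have "\<dots> \<le> dist (q0 k) (q k)" by (rule dist_snd_le)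
      also have "\<dots> < 1 / real (Suc k)" by (rule q)
      also have "\<dots> \<le> 1" by simp
      finally have "b k \<le> 2" by (simp add: dist_real_def)
      moreover have "norm v = b k * norm x" using x by simp
      ultimately have "norm v \<le> 2 * R" using R [OF x(1)] x(3) by (auto intro: mult_mono)
      then show "v \<in> cball 0 (2 * R)" by simp
    qed
    show "\<forall>\<^sub>F k in sequentially. x \<in> join_fibre K (q k)" if "x \<in> ?U" for x
      using inner [OF that tendsto_const] .
    fix r :: "nat \<Rightarrow> nat" and f x
    assume r: "strict_mono r" and f: "\<forall>\<^sub>F k in sequentially. f k \<in> join_fibre K (q (r k))" "f \<longlonglongrightarrow> x"
    have ev: "\<forall>\<^sub>F k in sequentially. (b (r k), f k) \<in> {(b, v). 0 \<le> b \<and> v \<in> (\<lambda>x. b *\<^sub>R x) ` K}"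
      using f(1) by eventually_elim (auto simp: q_eq join_fibre_def)
    have "(\<lambda>k. (b (r k), f k)) \<longlonglongrightarrow> (1, x)"
      using LIMSEQ_subseq_LIMSEQ [OF lim_b r] f(2) by (intro tendsto_Pair) (simp_all add: o_def)
    then have "(1, x) \<in> {(b, v). 0 \<le> b \<and> v \<in> (\<lambda>x. b *\<^sub>R x) ` K}"
      by (intro Lim_in_closed_set [OF closed_dilates [OF cK(1)] ev]) auto
    then have "x \<in> K" by auto
    moreover have "u \<bullet> x \<le> \<gamma>"
    proof -
      obtain i :: 'p where True by blast
      \<comment> \<open>The opposite inclusion uses only the supporting hyperplane at
        \<open>y0\<close>, in a single coordinate \<open>i\<close>.\<close>
      have "\<forall>\<^sub>F k in sequentially. u \<bullet> f k \<le> \<gamma> - u \<bullet> e i (r k) + (a (r k) - real (r k)) * (u \<bullet> y0)"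
        using f(1)
      proof eventually_elim
        case (elim k)
        then obtain y where y: "0 \<le> a (r k)" "y \<in> K" "z (r k) $ i + f k = a (r k) *\<^sub>R y"
          by (auto simp: q_eq join_fibre_def)
        have "u \<bullet> (z (r k) $ i + f k) \<le> a (r k) * (u \<bullet> y0)"
          unfolding y(3) y0_def using y(1) sup [OF y(2)] by (simp add: mult_left_mono)
        moreover have "z (r k) $ i = e i (r k) + (real (r k) *\<^sub>R y0 - \<gamma> *\<^sub>R u)" by (simp add: e_def)
        ultimately show ?case using uu by (simp add: inner_add_right inner_diff_right algebra_simps)
      qed
      moreover have "(\<lambda>k. \<gamma> - u \<bullet> e i (r k) + (a (r k) - real (r k)) * (u \<bullet> y0)) \<longlonglongrightarrow> \<gamma> - u \<bullet> 0 + 0 * (u \<bullet> y0)"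
        using LIMSEQ_subseq_LIMSEQ [OF lim_e r] LIMSEQ_subseq_LIMSEQ [OF lim(1) r]
        by (intro tendsto_intros) (simp_all add: o_def)
      moreover have "(\<lambda>k. u \<bullet> f k) \<longlonglongrightarrow> u \<bullet> x" by (intro tendsto_intros f)
      ultimately show ?thesis using tendsto_le [of sequentially] by fastforce
    qed
    ultimately show "x \<in> ?G" by simp
  qed
qed

theorem simplex_if_AE_fibre_bound:
  assumes "AE q in lborel. emeasure lborel (join_fibre K (q :: real \<times> real \<times> ('a^'p))) \<le> fibre_bound K q"
  shows "\<exists>m. m simplex K"
proof -
  have cK: "convex K" "compact K" using K by (auto simp: convex_body_def)
  show ?thesis by (rule simplex_if_caps_homothetic [OF cK int cap_homothetic [OF assms]])
qed

end

section \<open>The inequality for mixed volumes\<close>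

text \<open>Once all lower coefficients are 0, dividing by \<open>x ^ i\<close> isolates
  \<open>d i\<close> as the limit at 0, while the bound divided by \<open>x ^ i\<close> still tends
  to 0.\<close>

lemma power_sum_coeff_zero:
  fixes d :: "nat \<Rightarrow> real"
  assumes bound: "\<And>x. 0 < x \<Longrightarrow> x < 1 \<Longrightarrow> \<bar>\<Sum>i\<le>N. d i * x ^ i\<bar> \<le> C * x ^ D" and i: "i < D" "i \<le> N"
  shows "d i = 0"
  using i
proof (induction i rule: less_induct)
  case (less i)
  let ?f = "\<lambda>x. \<Sum>k=i..N. d k * x ^ (k - i)"
  have "(?f \<longlongrightarrow> ?f 0) (at_right 0)"
    by (intro tendsto_intros)
  moreover have "?f 0 = d i"
  proof -
    have "?f 0 = (\<Sum>k=i..N. if k = i then d k else 0)" by (intro sum.cong) auto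
    then show ?thesis using less.prems by simp
  qed
  ultimately have lim: "(?f \<longlongrightarrow> d i) (at_right 0)" by simp
  have "((\<lambda>x. C * x ^ (D - i)) \<longlongrightarrow> C * 0 ^ (D - i)) (at_right 0)"
    by (intro tendsto_intros)
  then have lim0: "((\<lambda>x. C * x ^ (D - i)) \<longlongrightarrow> 0) (at_right 0)"
    using less.prems by (simp add: power_0_left)
  have "\<forall>\<^sub>F x in at_right (0::real). x \<in> {0<..<1}"
    by (rule eventually_at_right_real) simp
  then have "\<forall>\<^sub>F x in at_right 0. norm (?f x) \<le> C * x ^ (D - i)"
  proof eventually_elim
    case (elim x)
    then have x: "0 < x" "x < 1" by auto
    have "{..N} = {..<i} \<union> {i..N}" using less.prems by auto
    then have "(\<Sum>k\<le>N. d k * x ^ k) = (\<Sum>k<i. d k * x ^ k) + (\<Sum>k=i..N. d k * x ^ k)"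
      by (simp add: sum.union_disjoint ivl_disj_int)
    also have "(\<Sum>k<i. d k * x ^ k) = 0"
      using less.IH less.prems by (intro sum.neutral) auto
    also have "(\<Sum>k=i..N. d k * x ^ k) = x ^ i * ?f x"
      unfolding sum_distrib_left by (intro sum.cong refl) (simp add: power_add [symmetric])
    finally have "\<bar>x ^ i * ?f x\<bar> \<le> C * x ^ D" using bound [OF x] by simp
    also have "C * x ^ D = x ^ i * (C * x ^ (D - i))"
      using less.prems by (simp add: power_add [symmetric])
    finally show ?case using x by (simp add: abs_mult)
  qed
  then have "(?f \<longlongrightarrow> 0) (at_right 0)" by (rule Lim_null_comparison [OF _ lim0])
  with lim show ?case
    using tendsto_unique [OF trivial_limit_at_right_real] by blast
qed

text \<open>A hyperplane containing \<open>K\<close>, read in one of the p coordinates, gives a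
  hyperplane that contains the whole combination.\<close>

lemma flat_body_volume_zero:
  fixes K :: "'a::euclidean_space set"
  assumes K: "convex K" and flat: "interior K = {}"
  shows "measure lebesgue ((\<lambda>x. a *\<^sub>R x) ` (\<lambda>x. - diag_emb x) ` K + (\<lambda>x. b *\<^sub>R x) ` (cart_power K :: ('a^'p) set)) = 0"
proof -
  obtain w \<beta> where w: "w \<noteq> 0" "K \<subseteq> {x. w \<bullet> x = \<beta>}"
    using empty_interior_subset_hyperplane [OF K flat] by blast
  obtain i :: 'p where True by blast
  have "(\<lambda>x. a *\<^sub>R x) ` (\<lambda>x. - diag_emb x) ` K + (\<lambda>x. b *\<^sub>R x) ` (cart_power K :: ('a^'p) set)
      \<subseteq> {z. axis i w \<bullet> z = b * \<beta> - a * \<beta>}"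
  proof
    fix z :: "'a^'p"
    assume "z \<in> (\<lambda>x. a *\<^sub>R x) ` (\<lambda>x. - diag_emb x) ` K + (\<lambda>x. b *\<^sub>R x) ` cart_power K"
    then obtain v x where z: "v \<in> K" "x \<in> cart_power K" "z = a *\<^sub>R (- diag_emb v) + b *\<^sub>R x"
      by (auto elim!: set_plus_elim)
    then have "w \<bullet> v = \<beta>" "w \<bullet> (x $ i) = \<beta>" using w(2) by (auto simp: cart_power_def)
    then show "z \<in> {z. axis i w \<bullet> z = b * \<beta> - a * \<beta>}"
      by (simp add: z(3) inner_axis' inner_add_right inner_diff_right)
  qed
  moreover have "axis i w \<noteq> (0 :: 'a^'p)" using w(1) by (simp add: axis_eq_0_iff)
  ultimately have "negligible ((\<lambda>x. a *\<^sub>R x) ` (\<lambda>x. - diag_emb x) ` K + (\<lambda>x. b *\<^sub>R x) ` (cart_power K :: ('a^'p) set))"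
    using negligible_hyperplane [of "axis i w" "b * \<beta> - a * \<beta>"] by (blast intro: negligible_subset)
  then show ?thesis by (rule negligible_imp_measure0)
qed

section \<open>The inequality for bodies with interior\<close>

context
  fixes K :: "'a::euclidean_space set" and p :: "'p::finite itself" and V :: "nat \<Rightarrow> real" and N n :: nat
  assumes K: "convex_body K" and int: "interior K \<noteq> {}"
  defines "N \<equiv> DIM('a^'p)" and "n \<equiv> DIM('a)"
    and "V \<equiv> \<lambda>j. mixed_volume (replicate j ((\<lambda>x. - diag_emb x) ` K) @
           replicate (DIM('a^'p) - j) (cart_power K :: ('a^'p) set))"
begin

lemma measure_body_pos: "0 < measure lebesgue K"
  using K int measure_pos_if_interior by (auto simp: convex_body_def)

lemma weighted_sum_inequality:
  assumes t: "0 < t" "t < 1"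
  defines "S \<equiv> (\<Sum>j\<le>N. t ^ j * (1 - t) ^ (N - j) * V j)"
  shows "0 \<le> S" "S \<le> measure lebesgue K ^ CARD('p) * (1 - t) ^ (N - n)"
    and "S = measure lebesgue K ^ CARD('p) * (1 - t) ^ (N - n) \<Longrightarrow> \<exists>m. m simplex K"
proof -
  note bodies = convex_body_neg_diag [OF K, where 'p = 'p] convex_body_cart_power [OF K, where 'p = 'p]
  obtain c where c: "\<And>a b. 0 \<le> a \<Longrightarrow> 0 \<le> b \<Longrightarrow>
      measure lebesgue ((\<lambda>x. a *\<^sub>R x) ` (\<lambda>x. - diag_emb x) ` K + (\<lambda>x. b *\<^sub>R x) ` (cart_power K :: ('a^'p) set)) =
      (\<Sum>j\<le>DIM('a^'p). c j * a ^ j * b ^ (DIM('a^'p) - j))"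
    using volume_polynomial [OF bodies interior_cart_power [OF int]] by blast
  have V: "V j = c j * fact j * fact (N - j) / fact N" if "j \<le> N" for j
    unfolding V_def N_def using that unfolding N_def by (intro mixed_volume_two bodies c)
  define x y where "x = 1 / (1 - t)" and "y = 1 / t"
  have xy: "0 < x" "0 < y" using t by (auto simp: x_def y_def)
  let ?m = "measure lebesgue K"
  let ?S = "\<Sum>j\<le>N. c j * (fact j / y ^ Suc j) * (fact (N - j) / x ^ Suc (N - j))"
  let ?T = "?m ^ Suc CARD('p) * (fact n / y ^ Suc n) * (fact N / x ^ Suc N)"
  have nN: "n \<le> N" by (simp add: n_def N_def)
  have S: "?S = fact N * (t * (1 - t)) * S"
    unfolding S_def sum_distrib_left
  proof (intro sum.cong refl)
    fix j assume "j \<in> {..N}"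
    then show "c j * (fact j / y ^ Suc j) * (fact (N - j) / x ^ Suc (N - j)) =
        fact N * (t * (1 - t)) * (t ^ j * (1 - t) ^ (N - j) * V j)"
      by (simp add: V x_def y_def power_divide)
  qed
  have pos: "0 < fact N * (t * (1 - t))" using t by simp
  have "0 \<le> ?S" unfolding N_def by (rule nn_integral_weight_join_cone(2) [OF K c xy])
  then show "0 \<le> S" unfolding S using pos by (simp add: zero_le_mult_iff)
  define q where "q = ?m * fact n * fact N * (t * (1 - t)) ^ Suc n"
  have q: "0 < q" using t measure_body_pos by (simp add: q_def)
  \<comment> \<open>The identity \<open>x + y = x * y\<close> behind the choice of the rates:
    \<open>(x + y) ^ n\<close> contributes the same power of \<open>t\<close> as the fibre volume,
    and only \<open>(1 - t) ^ (N - n)\<close> is left over.\<close>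
  have xy': "x + y = 1 / (t * (1 - t))" using t by (simp add: x_def y_def field_simps)
  have L: "?m * (fact n / (x + y) ^ n) * ?S = q * S"
    unfolding S xy' q_def by (simp add: power_divide)
  have R: "?T = q * (?m ^ CARD('p) * (1 - t) ^ (N - n))"
  proof -
    have "(1 - t) ^ Suc N = (1 - t) ^ Suc n * (1 - t) ^ (N - n)"
      using nN by (simp add: power_add [symmetric])
    then show ?thesis
      by (simp add: q_def x_def y_def power_divide power_mult_distrib)
  qed
  have "?m * (fact n / (x + y) ^ n) * ?S \<le> ?T"
    unfolding N_def n_def by (rule cone_inequality(1) [OF K c xy])
  then show "S \<le> ?m ^ CARD('p) * (1 - t) ^ (N - n)"
    unfolding L R using q by simp
  assume "S = ?m ^ CARD('p) * (1 - t) ^ (N - n)"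
  then have eq: "?m * (fact n / (x + y) ^ n) * ?S = ?T" unfolding L R by simp
  have "AE q in lborel. emeasure lborel (join_fibre K (q :: real \<times> real \<times> ('a^'p))) \<le> fibre_bound K q"
    by (rule cone_inequality(2) [OF K c xy eq [unfolded N_def n_def]])
  then show "\<exists>m. m simplex K" by (rule simplex_if_AE_fibre_bound [OF K int])
qed

text \<open>The inequality itself forces the growth \<open>O((1 - t)^(N - n))\<close> at \<open>t = 1\<close>.\<close>

lemma mixed_volume_neg_diag_zero:
  assumes j: "n < j" "j \<le> N"
  shows "V j = 0"
proof -
  let ?m = "measure lebesgue K"
  have nN: "n \<le> N" by (simp add: n_def N_def)
  have "\<bar>\<Sum>i\<le>N. V (N - i) * x ^ i\<bar> \<le> (?m ^ CARD('p) * 2 ^ n) * x ^ (N - n)" if x: "0 < x" "x < 1" for x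
  proof -
    \<comment> \<open>Chosen so that \<open>(1 - t) / t = x\<close>; the homogeneous sum becomes
      \<open>t ^ N\<close> times a polynomial in \<open>x\<close>, and x near 0 corresponds to t
      near 1.\<close>
    define t where "t = 1 / (1 + x)"
    have t: "0 < t" "t < 1" "1 - t = x * t" using x by (auto simp: t_def field_simps)
    have "(\<Sum>j\<le>N. t ^ j * (1 - t) ^ (N - j) * V j) = (\<Sum>i\<le>N. t ^ (N - i) * (1 - t) ^ i * V (N - i))"
      by (rule sum.reindex_bij_witness [of _ "\<lambda>i. N - i" "\<lambda>i. N - i"]) auto
    also have "\<dots> = (\<Sum>i\<le>N. t ^ N * (V (N - i) * x ^ i))"
    proof (intro sum.cong refl)
      fix i assume "i \<in> {..N}"
      then have "t ^ N = t ^ (N - i) * t ^ i" by (simp add: power_add [symmetric])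
      then show "t ^ (N - i) * (1 - t) ^ i * V (N - i) = t ^ N * (V (N - i) * x ^ i)"
        unfolding t(3) power_mult_distrib by (simp only: mult_ac)
    qed
    finally have eq: "(\<Sum>j\<le>N. t ^ j * (1 - t) ^ (N - j) * V j) = t ^ N * (\<Sum>i\<le>N. V (N - i) * x ^ i)"
      by (simp add: sum_distrib_left)
    have lo: "0 \<le> (\<Sum>i\<le>N. V (N - i) * x ^ i)"
    proof -
      have "0 \<le> t ^ N * (\<Sum>i\<le>N. V (N - i) * x ^ i)"
        using weighted_sum_inequality(1) [OF t(1,2)] unfolding eq .
      moreover have "0 < t ^ N" using t by simp
      ultimately show ?thesis by (metis zero_le_mult_iff order_less_le_trans order_less_irrefl)
    qed
    have "t ^ N * (\<Sum>i\<le>N. V (N - i) * x ^ i) \<le> ?m ^ CARD('p) * (x ^ (N - n) * t ^ (N - n))"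
      using weighted_sum_inequality(2) [OF t(1,2), unfolded eq] unfolding t(3) power_mult_distrib .
    moreover have "t ^ N = t ^ n * t ^ (N - n)" using nN by (simp add: power_add [symmetric])
    ultimately have "t ^ (N - n) * (t ^ n * (\<Sum>i\<le>N. V (N - i) * x ^ i)) \<le> t ^ (N - n) * (?m ^ CARD('p) * x ^ (N - n))"
      by (simp add: mult_ac)
    then have "t ^ n * (\<Sum>i\<le>N. V (N - i) * x ^ i) \<le> ?m ^ CARD('p) * x ^ (N - n)"
      using t(1) by simp
    \<comment> \<open>Since x < 1 gives t > 1/2, the leftover factor \<open>t ^ n\<close> only costs
      a constant.\<close>
    moreover have "(1 / 2) ^ n \<le> t ^ n" using x by (intro power_mono) (auto simp: t_def field_simps)
    then have "(1 / 2) ^ n * (\<Sum>i\<le>N. V (N - i) * x ^ i) \<le> t ^ n * (\<Sum>i\<le>N. V (N - i) * x ^ i)"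
      using lo by (rule mult_right_mono)
    ultimately have "(1 / 2) ^ n * (\<Sum>i\<le>N. V (N - i) * x ^ i) \<le> ?m ^ CARD('p) * x ^ (N - n)" by linarith
    then show ?thesis using lo by (simp add: power_divide field_simps)
  qed
  then have "V (N - (N - j)) = 0"
    by (rule power_sum_coeff_zero) (use j in auto)
  then show ?thesis using j by simp
qed

lemma mixed_volume_sum_inequality:
  assumes t: "0 < t" "t < 1"
  shows "(\<Sum>j=0..n. t ^ j * (1 - t) ^ (n - j) * V j) \<le> measure lebesgue K ^ CARD('p)"
    and "(\<Sum>j=0..n. t ^ j * (1 - t) ^ (n - j) * V j) = measure lebesgue K ^ CARD('p) \<Longrightarrow> \<exists>m. m simplex K"
proof -
  have nN: "n \<le> N" by (simp add: n_def N_def)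
  let ?S = "\<Sum>j=0..n. t ^ j * (1 - t) ^ (n - j) * V j"
  have "(\<Sum>j\<le>N. t ^ j * (1 - t) ^ (N - j) * V j) = (\<Sum>j=0..n. t ^ j * (1 - t) ^ (N - j) * V j)"
    using nN mixed_volume_neg_diag_zero by (intro sum.mono_neutral_right) auto
  also have "\<dots> = (\<Sum>j=0..n. (1 - t) ^ (N - n) * (t ^ j * (1 - t) ^ (n - j) * V j))"
  proof (intro sum.cong refl)
    fix j assume "j \<in> {0..n}"
    then have "(1 - t) ^ (N - j) = (1 - t) ^ (N - n) * (1 - t) ^ (n - j)"
      using nN by (simp add: power_add [symmetric])
    then show "t ^ j * (1 - t) ^ (N - j) * V j = (1 - t) ^ (N - n) * (t ^ j * (1 - t) ^ (n - j) * V j)"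
      by simp
  qed
  finally have eq: "(\<Sum>j\<le>N. t ^ j * (1 - t) ^ (N - j) * V j) = (1 - t) ^ (N - n) * ?S"
    by (simp add: sum_distrib_left)
  have pos: "0 < (1 - t) ^ (N - n)" using t by simp
  have "(1 - t) ^ (N - n) * ?S \<le> (1 - t) ^ (N - n) * measure lebesgue K ^ CARD('p)"
    using weighted_sum_inequality(2) [OF t] unfolding eq by (simp only: mult.commute)
  then show "?S \<le> measure lebesgue K ^ CARD('p)" using pos by simp
  assume "?S = measure lebesgue K ^ CARD('p)"
  then have "(\<Sum>j\<le>N. t ^ j * (1 - t) ^ (N - j) * V j) = measure lebesgue K ^ CARD('p) * (1 - t) ^ (N - n)"
    unfolding eq by simp
  then show "\<exists>m. m simplex K" by (rule weighted_sum_inequality(3) [OF t])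
qed

end

text \<open>\<open>volume_polynomial\<close> requires interior, but here the volume vanishes
  identically, so the zero coefficients serve directly.\<close>

lemma mixed_volume_flat_zero:
  fixes K :: "'a::euclidean_space set"
  assumes K: "convex_body K" and flat: "interior K = {}" and j: "j \<le> DIM('a^'p)"
  shows "mixed_volume (replicate j ((\<lambda>x. - diag_emb x) ` K) @
    replicate (DIM('a^'p) - j) (cart_power K :: ('a^'p) set)) = 0"
proof -
  have "convex K" using K by (simp add: convex_body_def)
  then have "mixed_volume (replicate j ((\<lambda>x. - diag_emb x) ` K) @
    replicate (DIM('a^'p) - j) (cart_power K :: ('a^'p) set)) = 0 * fact j * fact (DIM('a^'p) - j) / fact DIM('a^'p)"
    using flat_body_volume_zero [OF _ flat, where 'p = 'p]
    by (intro mixed_volume_two [where c = "\<lambda>_. 0"] convex_body_neg_diag convex_body_cart_power K j) simp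
  then show ?thesis by simp
qed

theorem theorem1p5:
  fixes K :: "(real ^ 'n) set"
  assumes "CARD('n) \<ge> 2"
    and "convex_body K"
  shows "(\<forall>t\<in>{0..1::real}.
      (\<Sum>j=0..CARD('n). t ^ j * (1 - t) ^ (CARD('n) - j) *
         mixed_volume (replicate j ((\<lambda>x. - diag_emb x) ` K) @
           replicate (CARD('n) * CARD('p) - j) (cart_power K :: ((real ^ 'n) ^ 'p) set)))
      \<le> measure lebesgue K ^ CARD('p)) \<and>
    (aff_dim K = int CARD('n) \<and>
      (\<exists>t\<in>{0<..<1::real}.
        (\<Sum>j=0..CARD('n). t ^ j * (1 - t) ^ (CARD('n) - j) *
           mixed_volume (replicate j ((\<lambda>x. - diag_emb x) ` K) @
             replicate (CARD('n) * CARD('p) - j) (cart_power K :: ((real ^ 'n) ^ 'p) set)))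
        = measure lebesgue K ^ CARD('p))
      \<longrightarrow> (\<exists>m. m simplex K))"
proof -
  let ?V = "\<lambda>j. mixed_volume (replicate j ((\<lambda>x. - diag_emb x) ` K) @
     replicate (CARD('n) * CARD('p) - j) (cart_power K :: ((real ^ 'n) ^ 'p) set))"
  let ?f = "\<lambda>t::real. \<Sum>j=0..CARD('n). t ^ j * (1 - t) ^ (CARD('n) - j) * ?V j"
  let ?m = "measure lebesgue K ^ CARD('p)"
  note K = \<open>convex_body K\<close>
  have N: "DIM((real ^ 'n) ^ 'p) = CARD('n) * CARD('p)" by (simp add: mult.commute)
  have n: "DIM(real ^ 'n) = CARD('n)" by simp
  have main: "?f t \<le> ?m" "?f t = ?m \<Longrightarrow> \<exists>m. m simplex K" if "interior K \<noteq> {}" "0 < t" "t < 1" for t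
    using mixed_volume_sum_inequality [OF K that, where 'p = 'p] unfolding N n by blast+
  have "?f t \<le> ?m" if t: "t \<in> {0..1}" for t
  proof (cases "interior K = {}")
    case True
    have "?V j = 0" if "j \<in> {0..CARD('n)}" for j
    proof -
      have "j \<le> CARD('n)" using that by simp
      also have "CARD('n) \<le> CARD('n) * CARD('p)" by simp
      finally have "j \<le> DIM((real ^ 'n) ^ 'p)" unfolding N .
      from mixed_volume_flat_zero [OF K True this] show ?thesis unfolding N .
    qed
    then have "?f t = 0" by (intro sum.neutral ballI) simp
    then show ?thesis by simp
  next
    case False
    \<comment> \<open>At t = 0 and t = 1 one of the rates would be infinite; the inequality extends
      from the open interval by continuity.\<close>
    have "continuous_on (closure {0<..<1}) ?f" by (intro continuous_intros)
    moreover have "t \<in> closure {0<..<1}" using t by simp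
    moreover have "?f s \<le> ?m" if "s \<in> {0<..<1}" for s
      by (rule main(1) [OF False]) (use that in simp_all)
    ultimately show ?thesis by (rule continuous_le_on_closure)
  qed
  moreover have "interior K \<noteq> {}" if "aff_dim K = int CARD('n)"
  proof -
    have "interior K = rel_interior K" using that by (simp add: interior_rel_interior_gen)
    then show ?thesis using K rel_interior_eq_empty [of K] by (simp add: convex_body_def)
  qed
  ultimately show ?thesis using main(2) by (meson greaterThanLessThan_iff)
qed

end
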